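(* Let $f=x^2+y^3+yz^3\in\mathbb{C}[[x,y,z]]$. Then the limit $h$-function of $f$ is given, for $x\in[0,1]$, by $$h_{f,\infty}(x)=\begin{cases}-\dfrac94x^3+\dfrac{95}{48}x & x\in\left[0,\dfrac1{18}\right],\\[8pt] -\dfrac98x^3-\dfrac3{16}x^2+\dfrac{191}{96}x-\dfrac1{5184} & x\in\left[\dfrac1{18},\dfrac7{18}\right],\\[8pt] -\dfrac32x^2+\dfrac52x-\dfrac{43}{648} & x\in\left[\dfrac7{18},\dfrac12\right],\\[8pt] h_{f,\infty}(1-x)+2x-1 & x\in\left[\dfrac12,1\right].\end{cases}$$ In particular, $h_{f,\infty}$ is continuous and $\mathcal C^2$ on $(0,1)$.
   Context: For a field $k$ of characteristic $p>0$ and $f$ in the maximal ideal of $S=k[[x_1,\dots,x_m]]$, the $h$-function is $h_f(t)=\lim_{e\to\infty}\frac1{p^{em}}\ell\bigl(S/(f^{\lceil tp^e\rceil},x_1^{p^e},\dots,x_m^{p^e})\bigr)$, where a non-positive power of an ideal is the unit ideal. For $f$ with integer coefficients, the limit $h$-function is $h_{f,\infty}(t)=\lim_{p\to\infty}h_{f_p}(t)$, with $f_p\in\mathbb{F}_p[[x_1,\dots,x_m]]$ the reduction of $f$ mod $p$ (existence of the limit is part of the claim). In the formula the letter $x$ on the right denotes the real argument of the function. *)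

theory Defs
  imports
    "HOL-Analysis.Analysis"
    "HOL-Algebra.Module"
    "HOL-Algebra.QuotRing"
    "HOL-Algebra.IntRing"
    "HOL-Number_Theory.Residues"
    "HOL-Library.Extended_Nat"
begin

section \<open>Formal power series in finitely many variables\<close>

text \<open>
  The ring \<open>R[[x\<^sub>v | v \<in> 'v]]\<close> for a finite index type \<open>'v\<close>. An exponent vector is an element
  of \<open>nat ^ 'v\<close>, and a power series is its family of coefficients. This is a ring record rather
  than a type class instance because the coefficient ring \<open>\<int>/p\<close> has to vary with \<open>p\<close> inside a
  single formula.
\<close>

definition mpower_series :: "('a, 'm) ring_scheme \<Rightarrow> (nat ^ 'v \<Rightarrow> 'a) ring" where
  "mpower_series R =
    \<lparr>carrier = {f. \<forall>a. f a \<in> carrier R},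
     monoid.mult = (\<lambda>f g a. \<Oplus>\<^bsub>R\<^esub>bc\<in>{(b, c). b + c = a}. f (fst bc) \<otimes>\<^bsub>R\<^esub> g (snd bc)),
     monoid.one = (\<lambda>a. if a = 0 then \<one>\<^bsub>R\<^esub> else \<zero>\<^bsub>R\<^esub>),
     ring.zero = (\<lambda>a. \<zero>\<^bsub>R\<^esub>),
     ring.add = (\<lambda>f g a. f a \<oplus>\<^bsub>R\<^esub> g a)\<rparr>"

definition mvar :: "('a, 'm) ring_scheme \<Rightarrow> 'v \<Rightarrow> (nat ^ 'v \<Rightarrow> 'a)" where
  "mvar R v = (\<lambda>a. if a = axis v 1 then \<one>\<^bsub>R\<^esub> else \<zero>\<^bsub>R\<^esub>)"

section \<open>Length of a module\<close>

text \<open>The supremum of the lengths \<open>n\<close> of strict chains \<open>N 0 \<subset> N 1 \<subset> \<dots> \<subset> N n\<close> of submodules.\<close>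

definition module_length :: "('a, 'm) ring_scheme \<Rightarrow> ('a, 'b, 'n) module_scheme \<Rightarrow> enat" where
  "module_length R M =
    Sup {enat n | n. \<exists>N. (\<forall>i\<le>n. submodule (N i) R M) \<and> (\<forall>i<n. N i \<subset> N (Suc i))}"

text \<open>\<open>R/I\<close> as an \<open>R\<close>-module: the quotient ring, with scalars acting through their residue classes.\<close>

definition quot_module :: "('a, 'm) ring_scheme \<Rightarrow> 'a set \<Rightarrow> ('a, 'a set) module" where
  "quot_module R I =
    \<lparr>carrier = carrier (R Quot I), monoid.mult = monoid.mult (R Quot I), monoid.one = monoid.one (R Quot I),
     ring.zero = ring.zero (R Quot I), ring.add = ring.add (R Quot I),
     smult = (\<lambda>r A. (I +>\<^bsub>R\<^esub> r) \<otimes>\<^bsub>R Quot I\<^esub> A)\<rparr>"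

section \<open>The \<open>h\<close>-function\<close>

text \<open>
  The ideal \<open>(f\<^bsup>\<lceil>tq\<rceil>\<^esup>, x\<^sub>v\<^bsup>q\<^esup> | v)\<close>. The truncation of \<^const>\<open>nat\<close> turns an exponent
  \<open>\<lceil>tq\<rceil> \<le> 0\<close> into \<open>0\<close>, so that the ideal is then the unit ideal, as the convention on
  non-positive powers requires.
\<close>

definition h_ideal ::
  "('a, 'm) ring_scheme \<Rightarrow> (nat ^ 'v \<Rightarrow> 'a) \<Rightarrow> real \<Rightarrow> nat \<Rightarrow> (nat ^ 'v \<Rightarrow> 'a) set" where
  "h_ideal R f t q =
    (let S = mpower_series R in
      Idl\<^bsub>S\<^esub> (insert (f [^]\<^bsub>S\<^esub> nat \<lceil>t * real q\<rceil>) (range (\<lambda>v. mvar R v [^]\<^bsub>S\<^esub> q))))"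

text \<open>
  The terms of the sequence defining the \<open>h\<close>-function; \<open>p\<close> is the characteristic of the field
  \<open>R\<close>. The length is finite because the ideal contains a power of every variable.
\<close>

definition h_seq ::
  "nat \<Rightarrow> ('a, 'm) ring_scheme \<Rightarrow> (nat ^ 'v \<Rightarrow> 'a) \<Rightarrow> real \<Rightarrow> nat \<Rightarrow> real" where
  "h_seq p R f t e =
    (let S = mpower_series R in
      real (the_enat (module_length S (quot_module S (h_ideal R f t (p ^ e)))))
        / real (p ^ (e * CARD('v))))"

definition h_function ::
  "nat \<Rightarrow> ('a, 'm) ring_scheme \<Rightarrow> (nat ^ 'v \<Rightarrow> 'a) \<Rightarrow> real \<Rightarrow> real" where
  "h_function p R f t = lim (h_seq p R f t)"

section \<open>The limit \<open>h\<close>-function\<close>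

definition reduce_mod :: "nat \<Rightarrow> (nat ^ 'v \<Rightarrow> int) \<Rightarrow> (nat ^ 'v \<Rightarrow> int)" where
  "reduce_mod p f = (\<lambda>a. f a mod int p)"

text \<open>The filter of \<open>p \<rightarrow> \<infinity>\<close> along the primes.\<close>

definition primes_at_top :: "nat filter" where
  "primes_at_top = inf at_top (principal {p. prime p})"

definition h_mod :: "(nat ^ 'v \<Rightarrow> int) \<Rightarrow> nat \<Rightarrow> real \<Rightarrow> real" where
  "h_mod f p t = h_function p (residue_ring (int p)) (reduce_mod p f) t"

definition limit_h :: "(nat ^ 'v \<Rightarrow> int) \<Rightarrow> real \<Rightarrow> real" where
  "limit_h f t = Lim primes_at_top (\<lambda>p. h_mod f p t)"

text \<open>Twice continuously differentiable on a set \<open>U\<close>, which is meant to be open.\<close>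

definition C2_on :: "real set \<Rightarrow> (real \<Rightarrow> real) \<Rightarrow> bool" where
  "C2_on U g \<longleftrightarrow>
    (\<exists>g' g''. (\<forall>x\<in>U. (g has_real_derivative g' x) (at x)) \<and>
              (\<forall>x\<in>U. (g' has_real_derivative g'' x) (at x)) \<and>
              continuous_on U g'')"

end

theory Submission
  imports Defs "HOL-Library.Function_Algebras"
begin

text \<open>
  Write \<open>A = k[x,y,z]/(x\<^sup>q, y\<^sup>q, z\<^sup>q)\<close> with \<open>k = \<int>/p\<close>. The length of \<open>A/(f\<^sup>n)\<close> is the
  dimension of the kernel of \<open>f\<^sup>n\<close> on \<open>A\<close>, which is computed here by counting elements, on Macaulay's
  inverse system: the functions on the box \<open>[0,q)\<^sup>3\<close>, on which the variables act as shifts.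

  Freeness of Frobenius shows that the sequence defining \<open>h\<close> is decreasing and that its term at \<open>q = p\<close>
  differs from the limit by at most \<open>4/p\<close>, so only \<open>q = p\<close> matters as \<open>p \<rightarrow> \<infinity>\<close>.
  At that level, if \<open>T\<close> acts on a finite-dimensional space \<open>B\<close> and \<open>a + m \<le> p + 1\<close>, then the kernel of
  \<open>(X + T)\<^sup>m\<close> on \<open>B[X]/(X\<^sup>a)\<close> has dimension \<open>\<Sum> dim ker T\<^bsup>a+m-1-2j\<^esup>\<close> over
  \<open>j < min a m\<close>, as for the tensor product of two Jordan blocks in characteristic \<open>0\<close>. Splitting
  \<open>k[x]\<close> over \<open>k[x\<^sup>2]\<close> reduces \<open>x\<^sup>2 + g\<close> to \<open>g = y (y\<^sup>2 + z\<^sup>3)\<close>; peeling off the factor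
  \<open>y\<^sup>n\<close> of \<open>g\<^sup>n\<close> and splitting \<open>k[y]\<close> over \<open>k[y\<^sup>2]\<close> reduces \<open>g\<close> to \<open>z\<^sup>3\<close>. The resulting sums
  are Riemann sums: with \<open>\<eta>\<close> the limit two-variable function of \<open>g\<close>, one gets
  \<open>h t = \<integral> \<eta>\<close> over \<open>[1/2 - t, 1/2 + t]\<close> for \<open>t \<le> 1/2\<close>. For \<open>t \<ge> 1/2\<close> the reflection
  \<open>(a, m) \<mapsto> (p - a, p - m)\<close> applies.
\<close>

section \<open>Counting in finite abelian groups\<close>

text \<open>Since \<open>p\<close> varies, dimensions are read off as \<open>log p\<close> of
  cardinalities, and \<open>card_kernel_image\<close> plays the role of rank-nullity. The bound
  \<open>a + m <= p + 1\<close> keeps the coefficients of \<open>(1 + X)^(-m)\<close> up to degree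
  \<open>a - 1\<close> invertible modulo \<open>p\<close>. Each half of \<open>k[x]\<close> over
  \<open>k[x^2]\<close> has size about \<open>p/2\<close>, so exponents up to about
  \<open>p/2\<close> are reached directly and the reflection must supply the rest. In the inner step
  the sizes are about \<open>(p - n)/2\<close> and \<open>n\<close>, so the bound holds for every
  \<open>n <= p\<close>. The breakpoints come from a single kink: \<open>z^(3 n)\<close> has a
  kernel of dimension \<open>min p (3 n)\<close> on \<open>k[z]/(z^p)\<close>, which bends at
  \<open>1/3\<close> after scaling. The Riemann sum for \<open>g\<close> runs from
  \<open>|1 - 3 s|/2\<close> to \<open>(1 + s)/2\<close>; only the lower end meets
  \<open>1/3\<close>, at \<open>s = 1/9\<close> and \<open>s = 5/9\<close>. Solving
  \<open>1/2 + t = 5/9\<close> and \<open>1/2 - t = 1/9\<close> gives \<open>t = 1/18\<close> and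
  \<open>t = 7/18\<close>. The scaled kernel dimension is continuous and each of the two summations
  integrates once, whence \<open>C^2\<close>.\<close>

definition add_subgroup :: "'a::ab_group_add set \<Rightarrow> bool" where
  "add_subgroup V \<longleftrightarrow> 0 \<in> V \<and> (\<forall>x\<in>V. \<forall>y\<in>V. x - y \<in> V)"

lemma add_subgroupI:
  assumes "0 \<in> V" "\<And>x y. x \<in> V \<Longrightarrow> y \<in> V \<Longrightarrow> x - y \<in> V"
  shows "add_subgroup V"
  using assms by (simp add: add_subgroup_def)

lemma
  assumes "add_subgroup V"
  shows add_subgroup_zero: "0 \<in> V"
    and add_subgroup_diff: "x \<in> V \<Longrightarrow> y \<in> V \<Longrightarrow> x - y \<in> V"
    and add_subgroup_minus: "x \<in> V \<Longrightarrow> - x \<in> V"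
    and add_subgroup_add: "x \<in> V \<Longrightarrow> y \<in> V \<Longrightarrow> x + y \<in> V"
proof -
  show z: "0 \<in> V" and d: "\<And>x y. x \<in> V \<Longrightarrow> y \<in> V \<Longrightarrow> x - y \<in> V"
    using assms by (auto simp: add_subgroup_def)
  show m: "- x \<in> V" if "x \<in> V" for x using d[OF z that] by simp
  show "x + y \<in> V" if "x \<in> V" "y \<in> V" for x y using d[OF that(1) m[OF that(2)]] by simp
qed

lemma add_subgroup_of_nat:
  fixes V :: "'a::comm_ring_1 set"
  assumes "add_subgroup V" "x \<in> V"
  shows "of_nat n * x \<in> V"
  by (induction n) (auto simp: algebra_simps assms intro: add_subgroup_zero add_subgroup_add)

lemma add_subgroup_of_int:
  fixes V :: "'a::comm_ring_1 set"
  assumes "add_subgroup V" "x \<in> V"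
  shows "of_int k * x \<in> V"
proof (cases k)
  case (nonneg n)
  then show ?thesis using add_subgroup_of_nat[OF assms] by simp
next
  case (neg n)
  then show ?thesis
    using add_subgroup_minus[OF assms(1) add_subgroup_of_nat[OF assms, of "Suc n"]]
    by (simp del: of_nat_Suc add: of_int_minus)
qed

lemma add_subgroup_kernel:
  assumes "add_subgroup V" "Modules.additive f"
  shows "add_subgroup {x \<in> V. f x = 0}"
  using assms by (auto simp: add_subgroup_def Modules.additive.zero Modules.additive.diff)

lemma add_subgroup_image:
  assumes "add_subgroup V" "Modules.additive f"
  shows "add_subgroup (f ` V)"
proof (rule add_subgroupI)
  show "0 \<in> f ` V"
    by (rule image_eqI[where x = 0])
       (simp_all add: Modules.additive.zero[OF assms(2)] add_subgroup_zero[OF assms(1)])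
next
  fix x y assume "x \<in> f ` V" "y \<in> f ` V"
  then obtain v w where "v \<in> V" "x = f v" "w \<in> V" "y = f w" by auto
  then show "x - y \<in> f ` V"
    by (intro image_eqI[where x = "v - w"])
       (simp_all add: Modules.additive.diff[OF assms(2)] add_subgroup_diff[OF assms(1)])
qed

lemma card_fibres_const:
  fixes f :: "'a \<Rightarrow> 'b"
  assumes "finite A" and "\<And>y. y \<in> f ` A \<Longrightarrow> card {x \<in> A. f x = y} = c"
  shows "card A = c * card (f ` A)"
proof -
  have "card A = (\<Sum>y\<in>f ` A. card {x \<in> A. f x = y})"
    using sum.image_gen[OF assms(1), of "\<lambda>_. 1::nat" f] by simp
  also have "\<dots> = (\<Sum>y\<in>f ` A. c)" using assms(2) by (rule sum.cong[OF refl])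
  finally show ?thesis by (simp add: mult.commute)
qed

lemma card_kernel_image:
  assumes "add_subgroup V" "finite V" "Modules.additive f"
  shows "card V = card {x \<in> V. f x = 0} * card (f ` V)"
proof (rule card_fibres_const[OF assms(2)])
  fix y assume "y \<in> f ` V"
  then obtain v where v: "v \<in> V" "y = f v" by auto
  have "bij_betw (\<lambda>x. v + x) {x \<in> V. f x = 0} {x \<in> V. f x = y}"
    by (rule bij_betw_byWitness[where f' = "\<lambda>x. x - v"])
       (use v assms(1,3) in \<open>auto simp: Modules.additive.add Modules.additive.diff intro: add_subgroup_add add_subgroup_diff\<close>)
  then show "card {x \<in> V. f x = y} = card {x \<in> V. f x = 0}" by (rule bij_betw_same_card[symmetric])
qed

lemma card_subgroup_pos:
  assumes "add_subgroup V" "finite V"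
  shows "card V > 0"
  using assms add_subgroup_zero card_gt_0_iff by blast

section \<open>Additive maps and their powers\<close>

lemma additive_funpow:
  fixes f :: "'a::ab_group_add \<Rightarrow> 'a"
  shows "Modules.additive f \<Longrightarrow> Modules.additive (f ^^ n)"
  by (induction n) (auto simp: Modules.additive_def)

lemma additive_comp: "Modules.additive f \<Longrightarrow> Modules.additive g \<Longrightarrow> Modules.additive (f \<circ> g)"
  by (auto simp: Modules.additive_def)

lemma additive_of_nat:
  fixes f :: "'a::comm_ring_1 \<Rightarrow> 'b::comm_ring_1"
  assumes "Modules.additive f" shows "f (of_nat n * x) = of_nat n * f x"
  by (induction n) (auto simp: algebra_simps Modules.additive.zero[OF assms] Modules.additive.add[OF assms])

lemma additive_of_int:
  fixes f :: "'a::comm_ring_1 \<Rightarrow> 'b::comm_ring_1"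
  assumes "Modules.additive f" shows "f (of_int k * x) = of_int k * f x"
proof (cases k)
  case (nonneg n)
  then show ?thesis using additive_of_nat[OF assms] by simp
next
  case (neg n)
  then show ?thesis
    using additive_of_nat[OF assms, of "Suc n" x] Modules.additive.minus[OF assms, of "of_nat (Suc n) * x"]
    by (simp del: of_nat_Suc)
qed

lemma of_int_fun_apply [simp]:
  "(of_int k :: 'a \<Rightarrow> 'b::comm_ring_1) x = of_int k"
proof (cases k)
  case (nonneg n)
  then show ?thesis by (simp add: of_nat_fun)
next
  case (neg n)
  then show ?thesis by (simp del: of_nat_Suc add: of_nat_fun)
qed

lemma sum_fun_apply:
  "(\<Sum>i\<in>A. f i :: 'a \<Rightarrow> 'b::comm_monoid_add) x = (\<Sum>i\<in>A. f i x)"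
  by (induction A rule: infinite_finite_induct) auto

lemma sum_binomial_Suc:
  fixes f :: "nat \<Rightarrow> nat \<Rightarrow> 'b::comm_ring_1"
  shows "(\<Sum>j\<le>Suc n. of_nat (Suc n choose j) * f j (Suc n - j)) =
    (\<Sum>j\<le>n. of_nat (n choose j) * f (Suc j) (n - j)) + (\<Sum>j\<le>n. of_nat (n choose j) * f j (Suc (n - j)))"
proof -
  have "(\<Sum>j\<le>Suc n. of_nat (Suc n choose j) * f j (Suc n - j)) =
      f 0 (Suc n) + (\<Sum>j\<le>n. of_nat (n choose j) * f (Suc j) (n - j))
        + (\<Sum>j\<le>n. of_nat (n choose Suc j) * f (Suc j) (n - j))"
    by (simp only: sum.atMost_Suc_shift) (simp add: algebra_simps sum.distrib)
  moreover have "(\<Sum>j\<le>n. of_nat (n choose j) * f j (Suc (n - j))) =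
      (\<Sum>j\<le>Suc n. of_nat (n choose j) * f j (Suc n - j))"
    by (simp add: Suc_diff_le binomial_eq_0)
  moreover have "\<dots> = f 0 (Suc n) + (\<Sum>j\<le>n. of_nat (n choose Suc j) * f (Suc j) (n - j))"
    by (simp only: sum.atMost_Suc_shift) (simp add: binomial_eq_0 flip: sum.atMost_Suc)
  ultimately show ?thesis by simp
qed

lemma funpow_add_binomial:
  fixes P Q :: "'a::comm_ring_1 \<Rightarrow> 'a"
  assumes P: "Modules.additive P" and Q: "Modules.additive Q" and comm: "\<And>x. P (Q x) = Q (P x)"
  shows "((\<lambda>x. P x + Q x) ^^ n) x = (\<Sum>j\<le>n. of_nat (n choose j) * (P ^^ j) ((Q ^^ (n - j)) x))"
proof (induction n arbitrary: x)
  case (Suc n)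
  have add: "Modules.additive ((\<lambda>x. P x + Q x) ^^ n)"
    by (rule additive_funpow) (use P Q in \<open>auto simp: Modules.additive_def\<close>)
  have PQ: "(Q ^^ k) (P x) = P ((Q ^^ k) x)" for k x
    by (induction k) (simp_all add: comm)
  have "((\<lambda>x. P x + Q x) ^^ Suc n) x = ((\<lambda>x. P x + Q x) ^^ n) (P x) + ((\<lambda>x. P x + Q x) ^^ n) (Q x)"
    by (simp only: funpow_Suc_right o_apply Modules.additive.add[OF add])
  also have "\<dots> = (\<Sum>j\<le>n. of_nat (n choose j) * (P ^^ Suc j) ((Q ^^ (n - j)) x))
      + (\<Sum>j\<le>n. of_nat (n choose j) * (P ^^ j) ((Q ^^ Suc (n - j)) x))"
    unfolding Suc.IH by (simp only: funpow_Suc_right o_apply PQ)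
  finally show ?case using sum_binomial_Suc[of n "\<lambda>j k. (P ^^ j) ((Q ^^ k) x)"] by simp
qed simp

section \<open>Shift operators\<close>

definition shift :: "nat \<Rightarrow> (nat \<Rightarrow> 'b) \<Rightarrow> nat \<Rightarrow> 'b" where
  "shift d h = (\<lambda>i. h (i + d))"

text \<open>The inverse system of \<open>B[X]\<close>: on sequences \<open>h\<close>, multiplication by \<open>X\<^sup>d + T\<close>, where \<open>X\<close> acts
  as the shift and \<open>T\<close> acts on the values.\<close>

definition lop :: "nat \<Rightarrow> ('b \<Rightarrow> 'b) \<Rightarrow> (nat \<Rightarrow> 'b::comm_ring_1) \<Rightarrow> nat \<Rightarrow> 'b" where
  "lop d T h = (\<lambda>i. h (i + d) + T (h i))"

text \<open>The inverse system of \<open>B[X]/(X^a)\<close> with \<open>B = V\<close>. It is a set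
  and not a type because \<open>a\<close> and \<open>V\<close> vary; nesting it gives the boxes in
  two and three variables.\<close>

definition boxed :: "nat \<Rightarrow> 'b::zero set \<Rightarrow> (nat \<Rightarrow> 'b) set" where
  "boxed a V = {h. (\<forall>i. h i \<in> V) \<and> (\<forall>i\<ge>a. h i = 0)}"

lemma additive_shift: "Modules.additive (shift d :: (nat \<Rightarrow> 'b::ab_group_add) \<Rightarrow> _)"
  by (auto simp: Modules.additive_def shift_def fun_eq_iff)

lemma additive_lop: "Modules.additive T \<Longrightarrow> Modules.additive (lop d T)"
  by (auto simp: Modules.additive_def lop_def fun_eq_iff)

lemma funpow_shift: "(shift d ^^ n) = shift (n * d)"
proof (induction n)
  case (Suc n)
  then show ?case by (auto simp: shift_def fun_eq_iff algebra_simps)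
qed (auto simp: shift_def fun_eq_iff)

lemma funpow_pointwise:
  fixes T :: "'b \<Rightarrow> 'b"
  shows "((\<lambda>h i. T (h i)) ^^ n) h = (\<lambda>i. (T ^^ n) (h i))"
  by (induction n) auto

lemma funpow_lop:
  assumes "Modules.additive T"
  shows "(lop d T ^^ n) h i = (\<Sum>j\<le>n. of_nat (n choose j) * (T ^^ (n - j)) (h (i + d * j)))"
proof -
  have eq: "lop d T = (\<lambda>h. shift d h + (\<lambda>i. T (h i)))"
    by (auto simp: lop_def shift_def fun_eq_iff)
  have "(lop d T ^^ n) h = (\<Sum>j\<le>n. of_nat (n choose j) * (shift d ^^ j) (((\<lambda>h i. T (h i)) ^^ (n - j)) h))"
    unfolding eq
    by (rule funpow_add_binomial[OF additive_shift])
       (use assms in \<open>auto simp: Modules.additive_def shift_def fun_eq_iff\<close>)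
  then show ?thesis
    by (simp add: sum_fun_apply funpow_shift funpow_pointwise) (simp add: shift_def mult.commute)
qed

text \<open>The splitting of \<open>k[X]\<close> over \<open>k[X^d]\<close>, seen on the dual side:
  \<open>X^d\<close> preserves each residue class of indices modulo \<open>d\<close> and acts there
  as a variable.\<close>

lemma funpow_lop_residue:
  "(lop d T ^^ n) h (d * u + i) = (lop 1 T ^^ n) (\<lambda>u. h (d * u + i)) u"
proof (induction n arbitrary: h)
  case (Suc n)
  have "(\<lambda>u. lop d T h (d * u + i)) = lop 1 T (\<lambda>u. h (d * u + i))"
    by (auto simp: lop_def fun_eq_iff algebra_simps)
  then show ?case using Suc[of "lop d T h"] by (simp only: funpow_Suc_right o_apply)
qed simp

lemma boxed_bij:
  "bij_betw (\<lambda>h. \<lambda>i\<in>{..<a}. h i) (boxed a V) ({..<a} \<rightarrow>\<^sub>E V)" if "0 \<in> V"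
  by (rule bij_betw_byWitness[where f' = "\<lambda>h i. if i < a then h i else 0"])
     (use that in \<open>auto simp: boxed_def fun_eq_iff PiE_def extensional_def Pi_def\<close>)

lemma
  assumes "0 \<in> V"
  shows card_boxed: "card (boxed a V) = card V ^ a"
    and finite_boxed: "finite V \<Longrightarrow> finite (boxed a V)"
  using bij_betw_same_card[OF boxed_bij[OF assms, of a]] bij_betw_finite[OF boxed_bij[OF assms, of a]]
  by (simp_all add: card_PiE finite_PiE)

lemma add_subgroup_boxed: "add_subgroup V \<Longrightarrow> add_subgroup (boxed a V)"
  by (auto simp: add_subgroup_def boxed_def)

lemma boxed_mono: "a \<le> b \<Longrightarrow> boxed a V \<subseteq> boxed b V"
  by (auto simp: boxed_def)

lemma shift_boxed: "h \<in> boxed a V \<Longrightarrow> shift d h \<in> boxed (a - d) V"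
  by (auto simp: boxed_def shift_def)

lemma lop_boxed:
  assumes "add_subgroup V" "Modules.additive T" "\<And>v. v \<in> V \<Longrightarrow> T v \<in> V" "h \<in> boxed a V"
  shows "lop d T h \<in> boxed a V"
  using assms by (auto simp: boxed_def lop_def Modules.additive.zero intro!: add_subgroup_add)

lemma funpow_closed:
  assumes "\<And>v. v \<in> V \<Longrightarrow> T v \<in> V" "v \<in> V"
  shows "(T ^^ n) v \<in> V"
  using assms by (induction n) auto

section \<open>Kernels of powers of \<open>X + T\<close>\<close>

text \<open>The coefficient of \<open>X^k\<close> in \<open>(1 + X)^(-m)\<close>, written as an
  integer so that it can act through \<open>of_int\<close> and be tested for divisibility by
  \<open>p\<close>. The truncated subtraction still gives the right value \<open>1\<close> at
  \<open>m = k = 0\<close>.\<close>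

definition neg_binom :: "nat \<Rightarrow> nat \<Rightarrow> int" where
  "neg_binom m k = (-1) ^ k * int ((m + k - 1) choose k)"

lemma of_int_neg_binom: "real_of_int (neg_binom m k) = (- real m) gchoose k"
proof (cases "m + k = 0")
  case False
  then have "real (m + k - 1) = real m + real k - 1" by (subst of_nat_diff) auto
  then show ?thesis
    by (simp add: neg_binom_def gbinomial_minus binomial_gbinomial)
qed (simp add: neg_binom_def)

lemma neg_binom_convolution:
  "(\<Sum>i\<le>s. neg_binom m i * int (m choose (s - i))) = (if s = 0 then 1 else 0)"
proof -
  have "real_of_int (\<Sum>i\<le>s. neg_binom m i * int (m choose (s - i))) =
    (\<Sum>i\<le>s. ((- real m) gchoose i) * (real m gchoose (s - i)))"
    by (simp add: of_int_neg_binom binomial_gbinomial)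
  also have "\<dots> = (- real m + real m) gchoose s" 
    using gbinomial_Vandermonde[of "- real m" "real m" s] by (simp add: atLeast0AtMost)
  also have "\<dots> = real_of_int (if s = 0 then 1 else 0)" by (cases s) auto
  finally show ?thesis by (simp only: of_int_eq_iff)
qed

text \<open>Up to sign this binomial coefficient divides \<open>(m + k - 1)!\<close>, all of whose
  factors are below \<open>p\<close>.\<close>

lemma prime_not_dvd_neg_binom:
  assumes "prime p" "m + k < p + 1" "m \<ge> 1"
  shows "\<not> int p dvd neg_binom m k"
proof
  assume "int p dvd neg_binom m k"
  then have "p dvd (m + k - 1) choose k"
    by (auto simp: neg_binom_def dvd_mult_unit_iff' minus_one_power_iff split: if_splits)
  then have "p dvd fact k * fact (m + k - 1 - k) * ((m + k - 1) choose k)" by simp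
  also have "\<dots> = fact (m + k - 1)" using assms by (intro binomial_fact_lemma) auto
  finally have "p \<le> m + k - 1" using prime_dvd_fact_iff assms(1) by blast
  then show False using assms by simp
qed

text \<open>A finite vector space over \<open>Z/p\<close> with an endomorphism, without a type for
  the field: \<open>V\<close> is a \<open>p\<close>-torsion subgroup, and scalars enter as integers
  through \<open>of_int\<close>. Functions into a commutative ring again form one, so sequences over
  such a space can serve as the next coefficient space.\<close>

locale torsion_space =
  fixes p :: nat and V :: "'b::comm_ring_1 set" and T :: "'b \<Rightarrow> 'b"
  assumes prime: "prime p" and sub: "add_subgroup V" and fin: "finite V"
    and torsion: "v \<in> V \<Longrightarrow> of_nat p * v = 0"
    and add: "Modules.additive T" and stable: "v \<in> V \<Longrightarrow> T v \<in> V"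
begin

section \<open>Integer scalars on a \<open>p\<close>-torsion group\<close>

lemma of_int_dvd_eq_0:
  assumes "int p dvd k" "v \<in> V" shows "of_int k * v = 0"
proof -
  obtain c where "k = c * int p" using assms(1) by (metis dvd_def mult.commute)
  then show ?thesis using torsion[OF assms(2)] by (simp add: mult.assoc)
qed

lemma of_nat_dvd_eq_0:
  assumes "p dvd k" "v \<in> V" shows "of_nat k * v = 0"
  using of_int_dvd_eq_0[of "int k" v] assms by simp

lemma inverse_exists:
  assumes "\<not> int p dvd k"
  obtains u where "\<And>v. v \<in> V \<Longrightarrow> of_int (u * k) * v = v"
proof -
  have "coprime (int p) k" using prime assms by (simp add: prime_imp_coprime)
  then obtain x y where xy: "x * int p + y * k = 1" using bezout_int[of "int p" k] by auto
  have "of_int (y * k) * v = v" if "v \<in> V" for v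
  proof -
    have "of_int (y * k) * v = of_int (1 - x * int p) * v"
      using xy by (intro arg_cong[where f = "\<lambda>c. of_int c * v"]) simp
    also have "\<dots> = v" using of_int_dvd_eq_0[of "x * int p" v] that by (simp add: algebra_simps)
    finally show ?thesis .
  qed
  then show ?thesis using that by blast
qed

lemma of_int_cancel:
  assumes "\<not> int p dvd k" "v \<in> V" "of_int k * v = 0" shows "v = 0"
proof -
  obtain u where u: "\<And>v. v \<in> V \<Longrightarrow> of_int (u * k) * v = v"
    using inverse_exists[OF assms(1)] by blast
  have "v = of_int u * (of_int k * v)" using u[OF assms(2)] by (simp add: mult.assoc)
  then show ?thesis using assms(3) by simp
qed

lemma funpow_stable: "v \<in> V \<Longrightarrow> (T ^^ n) v \<in> V"
  using funpow_closed[of V T] stable by blast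

lemma additive_T: "Modules.additive (T ^^ n)"
  by (rule additive_funpow[OF add])

lemma additive_L: "Modules.additive (lop d T ^^ n)"
  by (rule additive_funpow[OF additive_lop[OF add]])

lemma lop_in: "h \<in> boxed a V \<Longrightarrow> (lop d T ^^ n) h \<in> boxed a V"
  using funpow_closed[of "boxed a V" "lop d T"] lop_boxed[OF sub add stable] by blast

definition ker :: "nat \<Rightarrow> 'b set" where
  "ker n = {v \<in> V. (T ^^ n) v = 0}"

definition Ker :: "nat \<Rightarrow> nat \<Rightarrow> nat \<Rightarrow> (nat \<Rightarrow> 'b) set" where
  "Ker d a n = {h \<in> boxed a V. (lop d T ^^ n) h = 0}"

lemma boxed_space: "finite (boxed a V)" "add_subgroup (boxed a V)" "card (boxed a V) = card V ^ a"
  using add_subgroup_zero[OF sub] fin by (simp_all add: finite_boxed add_subgroup_boxed sub card_boxed)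

lemma sub_Ker: "add_subgroup (Ker d a n)"
  unfolding Ker_def by (rule add_subgroup_kernel[OF boxed_space(2) additive_L])

lemma fin_Ker: "finite (Ker d a n)"
  unfolding Ker_def using boxed_space(1) by simp

lemma card_Ker_pos: "card (Ker d a n) > 0"
  by (rule card_subgroup_pos[OF sub_Ker fin_Ker])

lemma sub_ker: "add_subgroup (ker n)"
  unfolding ker_def by (rule add_subgroup_kernel[OF sub additive_T])

lemma fin_ker: "finite (ker n)"
  unfolding ker_def using fin by simp

lemma card_ker_pos: "card (ker n) > 0"
  by (rule card_subgroup_pos[OF sub_ker fin_ker])

lemma L_beyond: "h \<in> boxed a V \<Longrightarrow> i \<ge> a \<Longrightarrow> (lop d T ^^ n) h i = 0"
  using lop_in[of h a n d] by (auto simp: boxed_def)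

lemma L_value: "h \<in> boxed a V \<Longrightarrow> (lop d T ^^ n) h i \<in> V"
  using lop_in[of h a n d] by (auto simp: boxed_def)

text \<open>The coefficients of \<open>(1 + X)\<^bsup>-m\<^esup>\<close> isolate the value at \<open>0\<close>.\<close>

lemma neg_binom_sum_L:
  assumes h: "\<And>i. i \<ge> a \<Longrightarrow> h i = 0" and a: "a \<ge> 1"
  shows "(\<Sum>i<a. of_int (neg_binom m i) * (T ^^ (a - 1 - i)) ((lop 1 T ^^ m) h i))
    = (T ^^ (a + m - 1)) (h 0)"
proof -
  define f where "f i j = of_int (neg_binom m i * int (m choose j)) *
    (T ^^ (a - 1 - i + (m - j))) (h (i + j))" for i j
  have T0: "(T ^^ n) 0 = 0" for n by (rule Modules.additive.zero[OF additive_T])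
  have f_beyond: "f i j = 0" if "m < j" for i j using that by (simp add: f_def binomial_eq_0)
  have "(\<Sum>i<a. of_int (neg_binom m i) * (T ^^ (a - 1 - i)) ((lop 1 T ^^ m) h i))
      = (\<Sum>i<a. \<Sum>j\<le>m. f i j)"
    unfolding funpow_lop[OF add] Modules.additive.sum[OF additive_T] additive_of_nat[OF additive_T] f_def
    by (simp add: sum_distrib_left funpow_add mult.assoc
        del: Nat.diff_diff_right Nat.add_diff_assoc Nat.add_diff_assoc2)
  also have "\<dots> = (\<Sum>(i,j)\<in>{..<a} \<times> {..m}. f i j)"
    by (simp add: sum.cartesian_product)
  also have "\<dots> = (\<Sum>(i,j)\<in>{(i,j). i + j < a}. f i j)"
  proof (rule sum.mono_neutral_cong)
    show "finite {(i,j). i + j < (a::nat)}"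
      by (rule finite_subset[of _ "{..<a} \<times> {..<a}"]) auto
    show "\<And>x. x \<in> {(i,j). i + j < a} - {..<a} \<times> {..m} \<Longrightarrow> (case x of (i,j) \<Rightarrow> f i j) = 0"
      by (auto, metis f_beyond not_le)
    show "\<And>x. x \<in> {..<a} \<times> {..m} - {(i,j). i + j < a} \<Longrightarrow> (case x of (i,j) \<Rightarrow> f i j) = 0"
      by (auto simp: f_def h T0)
  qed auto
  also have "\<dots> = (\<Sum>k<a. \<Sum>i\<le>k. f i (k - i))"
    by (rule sum.triangle_reindex)
  also have "\<dots> = (\<Sum>k<a. of_int (\<Sum>i\<le>k. neg_binom m i * int (m choose (k - i))) * (T ^^ (a + m - 1 - k)) (h k))"
  proof (rule sum.cong[OF refl])
    fix k assume k: "k \<in> {..<a}"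
    have "f i (k - i) = of_int (neg_binom m i * int (m choose (k - i))) * (T ^^ (a + m - 1 - k)) (h k)"
      if "i \<le> k" for i
    proof (cases "k - i \<le> m")
      case True
      then have "a - 1 - i + (m - (k - i)) = a + m - 1 - k" using k that by auto
      then show ?thesis using that by (simp add: f_def)
    qed (simp add: f_def binomial_eq_0)
    then show "(\<Sum>i\<le>k. f i (k - i)) =
        of_int (\<Sum>i\<le>k. neg_binom m i * int (m choose (k - i))) * (T ^^ (a + m - 1 - k)) (h k)"
      by (simp add: sum_distrib_right del: of_int_mult)
  qed
  also have "\<dots> = (\<Sum>k<a. if k = 0 then (T ^^ (a + m - 1)) (h 0) else 0)"
    by (rule sum.cong) (auto simp: neg_binom_convolution)
  also have "\<dots> = (T ^^ (a + m - 1)) (h 0)" using a by simp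
  finally show ?thesis .
qed

lemma eval_0_onto:
  assumes a: "a \<ge> 1" and m: "m \<ge> 1" and am: "a + m \<le> p + 1" and v: "v \<in> ker (a + m - 1)"
  obtains h where "h \<in> Ker 1 a m" "h 0 = v"
proof -
  have "\<not> int p dvd neg_binom m (a - 1)"
    by (rule prime_not_dvd_neg_binom[OF prime]) (use a m am in auto)
  then obtain u where u: "\<And>v. v \<in> V \<Longrightarrow> of_int (u * neg_binom m (a - 1)) * v = v"
    using inverse_exists by blast
  have vV: "v \<in> V" and v0: "(T ^^ (a + m - 1)) v = 0" using v by (auto simp: ker_def)
  \<comment> \<open>The coefficients of \<open>(1 + X)^(-m)\<close> in reversed order, so that
    applying \<open>(X + T)^m\<close> convolves them with those of \<open>(1 + X)^m\<close> and
    leaves only the degree \<open>0\<close> term. The factor \<open>u\<close> normalises the value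
    at \<open>0\<close> to \<open>v\<close>.\<close>
  define h where "h i = (if i < a then of_int (u * neg_binom m (a - 1 - i)) * (T ^^ i) v else 0)" for i
  have h0: "h 0 = v" using a u[OF vV] by (simp add: h_def)
  have box: "h \<in> boxed a V"
    using add_subgroup_zero[OF sub] add_subgroup_of_int[OF sub funpow_stable[OF vV]]
    by (auto simp: boxed_def h_def simp del: of_int_mult)
  have "(lop 1 T ^^ m) h i = 0" if i: "i < a" for i
  proof -
    define s where "s = a - 1 - i"
    have "(lop 1 T ^^ m) h i = (\<Sum>j\<le>m. of_nat (m choose j) * (T ^^ (m - j)) (h (i + j)))"
      by (simp add: funpow_lop[OF add])
    also have "\<dots> = (\<Sum>j\<le>s. of_nat (m choose j) * (T ^^ (m - j)) (h (i + j)))"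
      by (rule sum.mono_neutral_cong)
         (use i in \<open>auto simp: binomial_eq_0 h_def s_def Modules.additive.zero[OF additive_T]\<close>)
    also have "\<dots> = (\<Sum>j\<le>s. of_int (u * (neg_binom m (s - j) * int (m choose j))) * (T ^^ (m + i)) v)"
    proof (rule sum.cong[OF refl])
      fix j assume j: "j \<in> {..s}"
      show "of_nat (m choose j) * (T ^^ (m - j)) (h (i + j)) =
          of_int (u * (neg_binom m (s - j) * int (m choose j))) * (T ^^ (m + i)) v"
      proof (cases "j \<le> m")
        case True
        have "(T ^^ (m - j)) (h (i + j)) = of_int (u * neg_binom m (s - j)) * (T ^^ (m - j)) ((T ^^ (i + j)) v)"
          using j i by (simp add: h_def s_def additive_of_int[OF additive_T] mult.assoc)
        also have "(T ^^ (m - j)) ((T ^^ (i + j)) v) = (T ^^ (m + i)) v"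
          using True by (simp flip: funpow_add[unfolded fun_eq_iff o_apply, rule_format])
        finally show ?thesis by (simp add: algebra_simps)
      qed (simp add: binomial_eq_0)
    qed
    also have "\<dots> = of_int (u * (\<Sum>j\<le>s. neg_binom m (s - j) * int (m choose j))) * (T ^^ (m + i)) v"
      by (simp add: sum_distrib_right sum_distrib_left del: of_int_mult)
    also have "(\<Sum>j\<le>s. neg_binom m (s - j) * int (m choose j)) = (\<Sum>j\<le>s. neg_binom m j * int (m choose (s - j)))"
      by (rule sum.reindex_bij_witness[where i = "\<lambda>j. s - j" and j = "\<lambda>j. s - j"]) auto
    also have "\<dots> = (if s = 0 then 1 else 0)" by (rule neg_binom_convolution)
    also have "of_int (u * \<dots>) * (T ^^ (m + i)) v = 0"
    proof (cases "s = 0")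
      \<comment> \<open>The one surviving position is \<open>i = a - 1\<close>, and there the
        accumulated power of \<open>T\<close> is the one that kills \<open>v\<close>.\<close>
      case True
      then have "m + i = a + m - 1" using i by (simp add: s_def)
      then show ?thesis using v0 by simp
    qed simp
    finally show ?thesis .
  qed
  then have "(lop 1 T ^^ m) h = 0" using L_beyond[OF box] by (auto simp: fun_eq_iff) (meson not_le)
  then show ?thesis using that[of h] box h0 by (auto simp: Ker_def)
qed

text \<open>The map \<open>\<phi> = D L + (m - 1) X\<close>, where \<open>D\<close> is the weight operator and \<open>L = X + T\<close>,
  satisfies \<open>L\<^bsup>m-1\<^esup> \<phi> = D L\<^sup>m\<close>; it identifies the kernel of the evaluation at \<open>0\<close> with the
  corresponding space for \<open>a - 1\<close> and \<open>m - 1\<close>.\<close>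

lemma L_weight:
  fixes h :: "nat \<Rightarrow> 'b" and c :: int
  defines "D \<equiv> \<lambda>(g :: nat \<Rightarrow> 'b) i. of_int (c - int i) * g i"
  shows "(lop 1 T ^^ k) (\<lambda>i. of_int (c + int k - int i) * h (Suc i) + of_int (c - int i) * T (h i))
    = D ((lop 1 T ^^ Suc k) h)"
proof -
  have step: "D (lop 1 T g) = lop 1 T (D g) + shift 1 g" for g
  proof
    fix i
    have "T (of_int (c - int i) * g i) = of_int (c - int i) * T (g i)" by (rule additive_of_int[OF add])
    then show "D (lop 1 T g) i = (lop 1 T (D g) + shift 1 g) i"
      by (simp only: D_def lop_def shift_def plus_fun_apply) (simp add: algebra_simps)
  qed
  have shiftL: "shift 1 (lop 1 T g) = lop 1 T (shift 1 g)" for g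
    by (auto simp: lop_def shift_def fun_eq_iff)
  have L_add: "lop 1 T (x + y) = lop 1 T x + lop 1 T y" for x y
    by (rule Modules.additive.add[OF additive_lop[OF add]])
  have L_nat: "lop 1 T (of_nat n * x) = of_nat n * lop 1 T x" for n x
    by (rule additive_of_nat[OF additive_lop[OF add]])
  have "(lop 1 T ^^ k) (D (lop 1 T h) + of_nat k * shift 1 h) = D ((lop 1 T ^^ k) (lop 1 T h))"
  proof (induction k arbitrary: h)
    case (Suc k)
    have "D (lop 1 T (lop 1 T h)) + of_nat k * shift 1 (lop 1 T h)
        = lop 1 T (D (lop 1 T h) + of_nat (Suc k) * shift 1 h)"
      by (simp only: step[of "lop 1 T h"] L_add L_nat shiftL) (simp add: algebra_simps)
    then show ?case using Suc[of "lop 1 T h"] by (simp only: funpow_Suc_right o_apply)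
  qed simp
  moreover have "D (lop 1 T h) + of_nat k * shift 1 h =
      (\<lambda>i. of_int (c + int k - int i) * h (Suc i) + of_int (c - int i) * T (h i))"
    by (auto simp: D_def lop_def shift_def fun_eq_iff algebra_simps)
  ultimately show ?thesis by (simp only: funpow_Suc_right o_apply)
qed

lemma card_eval_0_kernel:
  assumes a: "a \<ge> 1" and m: "m \<ge> 1" and am: "a + m \<le> p + 1"
  shows "card {h \<in> Ker 1 a m. h 0 = 0} = card (Ker 1 (a - 1) (m - 1))"
proof -
  \<comment> \<open>With this choice the weight \<open>c - i\<close> vanishes exactly at the last
    position \<open>a - 1\<close>, so that \<open>\<phi>\<close> shortens the support by
    one.\<close>
  define c where "c = int (a - 1)"
  define \<phi> where "\<phi> h = (\<lambda>i. of_int (c + int (m - 1) - int i) * h (Suc i) + of_int (c - int i) * T (h i))"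
    for h :: "nat \<Rightarrow> 'b"
  define Z where "Z = {h \<in> Ker 1 a m. h 0 = 0}"
  \<comment> \<open>Both weights lie strictly between \<open>0\<close> and \<open>p\<close>; this is
    where \<open>a + m <= p + 1\<close> enters.\<close>
  have unit: "\<not> int p dvd (c + int (m - 1) - int i)" if "Suc i < a" for i
    using that am m by (intro zdvd_not_zless) (auto simp: c_def of_nat_diff)
  have unit': "\<not> int p dvd (c - int i)" if "Suc i < a" for i
    using that am m by (intro zdvd_not_zless) (auto simp: c_def)
  have \<phi>L: "(lop 1 T ^^ (m - 1)) (\<phi> h) = (\<lambda>i. of_int (c - int i) * (lop 1 T ^^ m) h i)" for h
    using L_weight[of "m - 1" c h] m by (simp add: \<phi>_def)
  have zero_iff: "h = 0" if h: "h \<in> boxed a V" "h 0 = 0" "\<phi> h = 0" for h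
  proof -
    have "h i = 0" for i
    proof (induction i)
      case (Suc i)
      show ?case
      proof (cases "Suc i < a")
        case True
        have "\<phi> h i = 0" using h(3) by simp
        then have "of_int (c + int (m - 1) - int i) * h (Suc i) = 0"
          using Suc.IH by (simp add: \<phi>_def Modules.additive.zero[OF add])
        then show ?thesis using of_int_cancel[OF unit[OF True]] h(1) by (auto simp: boxed_def)
      qed (use h in \<open>auto simp: boxed_def\<close>)
    qed (use h in simp)
    then show ?thesis by auto
  qed
  have \<phi>_diff: "\<phi> (g - h) = \<phi> g - \<phi> h" for g h
    by (auto simp: \<phi>_def fun_eq_iff Modules.additive.diff[OF add] algebra_simps)
  have "inj_on \<phi> Z"
  proof (rule inj_onI)
    fix g h assume gh: "g \<in> Z" "h \<in> Z" "\<phi> g = \<phi> h"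
    have "g - h \<in> boxed a V"
      using gh by (intro add_subgroup_diff[OF boxed_space(2)]) (auto simp: Z_def Ker_def)
    then have "g - h = 0" using gh zero_iff[of "g - h"] \<phi>_diff[of g h] by (auto simp: Z_def)
    then show "g = h" by simp
  qed
  moreover have "\<phi> h \<in> Ker 1 (a - 1) (m - 1)" if "h \<in> Z" for h
  proof -
    have h: "h \<in> boxed a V" "(lop 1 T ^^ m) h = 0" using that by (auto simp: Z_def Ker_def)
    have "\<phi> h i = 0" if "i \<ge> a - 1" for i
      using that h(1) by (cases "i = a - 1") (auto simp: \<phi>_def c_def boxed_def Modules.additive.zero[OF add])
    moreover have "\<phi> h i \<in> V" for i
      using h(1) unfolding \<phi>_def boxed_def
      by (intro add_subgroup_add[OF sub] add_subgroup_of_int[OF sub] stable) auto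
    ultimately show ?thesis using \<phi>L[of h] h(2) by (auto simp: Ker_def boxed_def fun_eq_iff)
  qed
  moreover have "k \<in> \<phi> ` Z" if "k \<in> Ker 1 (a - 1) (m - 1)" for k
  proof -
    have k: "k \<in> boxed (a - 1) V" "(lop 1 T ^^ (m - 1)) k = 0" using that by (auto simp: Ker_def)
    have "\<forall>i. \<exists>u. Suc i < a \<longrightarrow> (\<forall>v\<in>V. of_int ((c + int (m - 1) - int i) * u) * v = v)"
      using inverse_exists[OF unit] by (metis mult.commute)
    then obtain u where u: "\<And>i v. Suc i < a \<Longrightarrow> v \<in> V \<Longrightarrow>
        of_int ((c + int (m - 1) - int i) * u i) * v = v" by metis
    \<comment> \<open>The equation \<open>\<phi> h = k\<close> is a first-order recursion for
      \<open>h\<close>, solvable because the coefficient of \<open>h (Suc i)\<close> is invertible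
      with inverse \<open>u i\<close>.\<close>
    define h where "h = rec_nat 0 (\<lambda>i b. if Suc i < a then of_int (u i) * (k i - of_int (c - int i) * T b) else 0)"
    have h0: "h 0 = 0" by (simp add: h_def)
    have hSuc: "h (Suc i) = (if Suc i < a then of_int (u i) * (k i - of_int (c - int i) * T (h i)) else 0)" for i
      by (simp add: h_def)
    have hV: "h i \<in> V" for i
    proof (induction i)
      case 0
      show ?case using h0 add_subgroup_zero[OF sub] by simp
    next
      case (Suc i)
      have "k i \<in> V" using k(1) by (auto simp: boxed_def)
      then have "of_int (u i) * (k i - of_int (c - int i) * T (h i)) \<in> V"
        using Suc by (intro add_subgroup_of_int[OF sub] add_subgroup_diff[OF sub] stable)
      then show ?case using add_subgroup_zero[OF sub] unfolding hSuc by simp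
    qed
    have hbox: "h \<in> boxed a V"
    proof -
      have "h i = 0" if "i \<ge> a" for i using that a by (cases i) (auto simp: hSuc)
      then show ?thesis using hV by (auto simp: boxed_def)
    qed
    have \<phi>h: "\<phi> h = k"
    proof
      fix i
      show "\<phi> h i = k i"
      proof (cases "Suc i < a")
        case True
        have "of_int (c + int (m - 1) - int i) * h (Suc i) =
            of_int ((c + int (m - 1) - int i) * u i) * (k i - of_int (c - int i) * T (h i))"
          using True by (simp add: hSuc mult.assoc)
        also have "\<dots> = k i - of_int (c - int i) * T (h i)"
          using k(1) hV
          by (intro u[OF True] add_subgroup_diff[OF sub] add_subgroup_of_int[OF sub] stable) (auto simp: boxed_def)
        finally show ?thesis by (simp add: \<phi>_def)
      next
        case False
        then have "k i = 0" using k(1) by (auto simp: boxed_def)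
        moreover have "\<phi> h i = 0"
          using False hbox
          by (cases "i = a - 1") (auto simp: \<phi>_def c_def boxed_def Modules.additive.zero[OF add])
        ultimately show ?thesis by simp
      qed
    qed
    \<comment> \<open>From \<open>L^(m-1) k = 0\<close> one gets \<open>D L^m h = 0\<close>. The
      weight can be cancelled everywhere inside the support except at \<open>a - 1\<close>, where it
      is \<open>0\<close> and gives no information.\<close>
    have L0: "(lop 1 T ^^ m) h i = 0" if "i \<noteq> a - 1" for i
    proof (cases "Suc i < a")
      case True
      have "of_int (c - int i) * (lop 1 T ^^ m) h i = 0"
        using \<phi>L[of h] k(2) \<phi>h by (simp add: fun_eq_iff)
      then show ?thesis by (rule of_int_cancel[OF unit'[OF True] L_value[OF hbox]])
    next
      case False
      then show ?thesis using that by (intro L_beyond[OF hbox]) auto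
    qed
    \<comment> \<open>The remaining value is settled by the linear relation
      \<open>neg_binom_sum_L\<close>: its right side vanishes with \<open>h 0\<close>, and on its
      left side only the last term is left.\<close>
    have "of_int (neg_binom m (a - 1)) * (lop 1 T ^^ m) h (a - 1) = 0"
    proof -
      have "(\<Sum>i<a. of_int (neg_binom m i) * (T ^^ (a - 1 - i)) ((lop 1 T ^^ m) h i)) = 0"
        using neg_binom_sum_L[of a h m] hbox a h0
        by (simp add: boxed_def Modules.additive.zero[OF additive_T])
      also have "(\<Sum>i<a. of_int (neg_binom m i) * (T ^^ (a - 1 - i)) ((lop 1 T ^^ m) h i)) =
          (\<Sum>i\<in>{a - 1}. of_int (neg_binom m i) * (T ^^ (a - 1 - i)) ((lop 1 T ^^ m) h i))"
        by (rule sum.mono_neutral_right)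
           (use a in \<open>auto simp: L0 Modules.additive.zero[OF additive_T] simp del: One_nat_def\<close>)
      finally show ?thesis by simp
    qed
    then have "(lop 1 T ^^ m) h (a - 1) = 0"
      by (rule of_int_cancel[rotated 2])
         (use prime_not_dvd_neg_binom[OF prime, of m "a - 1"] a m am L_value[OF hbox] in auto)
    then have "(lop 1 T ^^ m) h = 0" using L0 by (auto simp: fun_eq_iff) metis
    then show ?thesis using hbox h0 \<phi>h by (auto simp: Z_def Ker_def)
  qed
  ultimately have "bij_betw \<phi> Z (Ker 1 (a - 1) (m - 1))" by (auto simp: bij_betw_def)
  then show ?thesis unfolding Z_def by (rule bij_betw_same_card)
qed

text \<open>Rank-nullity for the evaluation at \<open>0\<close>: \<open>neg_binom_sum_L\<close>
  confines the values to \<open>ker (a + m - 1)\<close>, \<open>eval_0_onto\<close> attains all of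
  them, and \<open>\<phi>\<close> identifies the sequences with value \<open>0\<close>.\<close>

lemma card_Ker_Suc:
  assumes a: "a \<ge> 1" and m: "m \<ge> 1" and am: "a + m \<le> p + 1"
  shows "card (Ker 1 a m) = card (ker (a + m - 1)) * card (Ker 1 (a - 1) (m - 1))"
proof -
  have ev: "Modules.additive (\<lambda>h :: nat \<Rightarrow> 'b. h 0)" by (simp add: Modules.additive_def)
  have "(\<lambda>h. h 0) ` Ker 1 a m = ker (a + m - 1)"
  proof (intro equalityI subsetI)
    fix v assume "v \<in> ker (a + m - 1)"
    then show "v \<in> (\<lambda>h. h 0) ` Ker 1 a m" using eval_0_onto[OF a m am] by (metis imageI)
  next
    fix v assume "v \<in> (\<lambda>h. h 0) ` Ker 1 a m"
    then obtain h where h: "h \<in> Ker 1 a m" "v = h 0" by auto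
    then show "v \<in> ker (a + m - 1)"
      using neg_binom_sum_L[of a h m] a
      by (auto simp: Ker_def ker_def boxed_def Modules.additive.zero[OF additive_T])
  qed
  then show ?thesis
    using card_kernel_image[OF sub_Ker fin_Ker ev, of 1 a m] card_eval_0_kernel[OF assms] by simp
qed

lemma Ker_trivial: "a = 0 \<or> m = 0 \<Longrightarrow> Ker d a m = {0}"
  using add_subgroup_zero[OF sub] Modules.additive.zero[OF additive_L]
  by (auto simp: Ker_def boxed_def fun_eq_iff)

theorem log_card_Ker:
  assumes "a + m \<le> p + 1"
  shows "log p (card (Ker 1 a m)) = (\<Sum>j<min a m. log p (card (ker (a + m - 1 - 2 * j))))"
  using assms
proof (induction a arbitrary: m)
  case 0
  then show ?case by (simp add: Ker_trivial)
next
  case (Suc a)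
  show ?case
  proof (cases m)
    case 0
    then show ?thesis by (simp add: Ker_trivial)
  next
    case (Suc m')
    have "log p (card (Ker 1 (Suc a) m)) = log p (card (ker (a + m))) + log p (card (Ker 1 a m'))"
      using card_Ker_Suc[of "Suc a" m] Suc Suc.prems card_ker_pos[of "a + m"] card_Ker_pos[of 1 a m']
      by (simp add: log_mult)
    also have "log p (card (Ker 1 a m')) = (\<Sum>j<min a m'. log p (card (ker (a + m' - 1 - 2 * j))))"
      by (rule Suc.IH) (use Suc Suc.prems in auto)
    also have "log p (card (ker (a + m))) + \<dots> = (\<Sum>j<Suc (min a m'). log p (card (ker (Suc a + m - 1 - 2 * j))))"
      unfolding sum.lessThan_Suc_shift using Suc by (intro arg_cong2[where f = "(+)"] sum.cong) auto
    finally show ?thesis using Suc by simp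
  qed
qed

text \<open>In the kernel \<open>h (i + d) = - T (h i)\<close>, so the first \<open>d\<close> values
  determine the whole sequence.\<close>

lemma card_Ker_one_le:
  assumes "d \<ge> 1" shows "card (Ker d a 1) \<le> card V ^ d"
proof -
  have "inj_on (\<lambda>h. \<lambda>i\<in>{..<d}. h i) (Ker d a 1)"
  proof (rule inj_onI)
    fix g h assume gh: "g \<in> Ker d a 1" "h \<in> Ker d a 1"
      "(\<lambda>i\<in>{..<d}. g i) = (\<lambda>i\<in>{..<d}. h i)"
    have rec: "k (i + d) = - T (k i)" if "k \<in> Ker d a 1" for k i
      using that by (auto simp: Ker_def lop_def fun_eq_iff eq_neg_iff_add_eq_0)
    have "g i = h i" for i
    proof (induction i rule: less_induct)
      case (less i)
      show ?case
      proof (cases "i < d")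
        case True
        then show ?thesis using fun_cong[OF gh(3), of i] by simp
      next
        case False
        then show ?thesis
          using rec[OF gh(1), of "i - d"] rec[OF gh(2), of "i - d"] less[of "i - d"] assms by simp
      qed
    qed
    then show "g = h" by auto
  qed
  moreover have "(\<lambda>h. \<lambda>i\<in>{..<d}. h i) ` Ker d a 1 \<subseteq> {..<d} \<rightarrow>\<^sub>E V"
    by (auto simp: Ker_def boxed_def split: if_splits)
  ultimately have "card (Ker d a 1) \<le> card ({..<d} \<rightarrow>\<^sub>E V)"
    using fin by (intro card_inj_on_le) (auto intro: finite_PiE)
  then show ?thesis by (simp add: card_PiE)
qed

text \<open>\<open>L^m\<close> maps the kernel of \<open>L^(m+n)\<close> into that of
  \<open>L^n\<close>, and what it kills lies in the kernel of \<open>L^m\<close>.\<close>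

lemma card_Ker_add_le: "card (Ker d a (m + n)) \<le> card (Ker d a m) * card (Ker d a n)"
proof -
  have "card (Ker d a (m + n)) =
      card {h \<in> Ker d a (m + n). (lop d T ^^ m) h = 0} * card ((lop d T ^^ m) ` Ker d a (m + n))"
    by (rule card_kernel_image[OF sub_Ker fin_Ker additive_L])
  also have "\<dots> \<le> card (Ker d a m) * card (Ker d a n)"
  proof (intro mult_le_mono card_mono fin_Ker)
    show "(lop d T ^^ m) ` Ker d a (m + n) \<subseteq> Ker d a n"
    proof
      fix x assume "x \<in> (lop d T ^^ m) ` Ker d a (m + n)"
      then obtain h where h: "h \<in> boxed a V" "(lop d T ^^ (m + n)) h = 0" "x = (lop d T ^^ m) h"
        by (auto simp: Ker_def)
      have "(lop d T ^^ n) x = (lop d T ^^ (n + m)) h" by (simp add: h(3) funpow_add)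
      then show "x \<in> Ker d a n" using h lop_in[OF h(1)] by (simp add: Ker_def add.commute)
    qed
  qed (auto simp: Ker_def)
  finally show ?thesis .
qed

lemma Ker_mono: "m \<le> n \<Longrightarrow> Ker d a m \<subseteq> Ker d a n"
proof
  fix h assume mn: "m \<le> n" and h: "h \<in> Ker d a m"
  have "(lop d T ^^ n) h = (lop d T ^^ (n - m)) ((lop d T ^^ m) h)"
    using mn by (simp flip: funpow_add[unfolded fun_eq_iff o_apply, rule_format])
  then show "h \<in> Ker d a n" using h by (simp add: Ker_def Modules.additive.zero[OF additive_L])
qed

lemma card_Ker_le_power:
  assumes "d \<ge> 1" shows "card (Ker d a n) \<le> card (Ker d a 1) ^ n"
proof (induction n)
  case 0
  then show ?case by (simp add: Ker_trivial)
next
  case (Suc n)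
  have "card (Ker d a (Suc n)) \<le> card (Ker d a 1) * card (Ker d a n)"
    using card_Ker_add_le[of d a 1 n] by simp
  also have "\<dots> \<le> card (Ker d a 1) * card (Ker d a 1) ^ n" using Suc by simp
  finally show ?case by simp
qed

text \<open>The middle binomial coefficients are divisible by \<open>p\<close>, and the values are
  \<open>p\<close>-torsion: this is \<open>(X^d + T)^p = X^(d p) + T^p\<close>.\<close>

lemma funpow_p_lop:
  assumes "h \<in> boxed a V"
  shows "(lop d T ^^ p) h = lop (d * p) (T ^^ p) h"
proof
  fix i
  have p: "p \<ge> 2" by (rule prime_ge_2_nat[OF prime])
  have "(lop d T ^^ p) h i = (\<Sum>j\<le>p. of_nat (p choose j) * (T ^^ (p - j)) (h (i + d * j)))"
    by (rule funpow_lop[OF add])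
  also have "\<dots> = (\<Sum>j\<in>{0, p}. of_nat (p choose j) * (T ^^ (p - j)) (h (i + d * j)))"
  proof (rule sum.mono_neutral_right)
    show "\<forall>j\<in>{..p} - {0, p}. of_nat (p choose j) * (T ^^ (p - j)) (h (i + d * j)) = 0"
    proof
      fix j assume "j \<in> {..p} - {0, p}"
      then have "p dvd p choose j" using prime by (intro dvd_choose_prime) auto
      moreover have "(T ^^ (p - j)) (h (i + d * j)) \<in> V"
        using assms by (intro funpow_stable) (auto simp: boxed_def)
      ultimately show "of_nat (p choose j) * (T ^^ (p - j)) (h (i + d * j)) = 0"
        by (rule of_nat_dvd_eq_0)
    qed
  qed auto
  also have "\<dots> = lop (d * p) (T ^^ p) h i" using p by (simp add: lop_def add.commute)
  finally show "(lop d T ^^ p) h i = lop (d * p) (T ^^ p) h i" .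
qed

lemma shift_L: "shift s ((lop d T ^^ m) h) = (lop d T ^^ m) (shift s h)"
proof (induction m arbitrary: h)
  case (Suc m)
  have "shift s (lop d T h) = lop d T (shift s h)"
    by (auto simp: lop_def shift_def fun_eq_iff algebra_simps)
  then show ?case using Suc[of "lop d T h"] by (simp only: funpow_Suc_right o_apply)
qed simp

text \<open>If \<open>T\<^sup>p = 0\<close> then \<open>L\<^sup>p = X\<^sup>p + T\<^sup>p = 0\<close> on \<open>B[X]/(X\<^sup>p)\<close>, which is then free over \<open>k[L]/(L\<^sup>p)\<close>.\<close>

context
  assumes T_pow_p: "\<And>v. v \<in> V \<Longrightarrow> (T ^^ p) v = 0"
begin

lemma Ker_p_p: "Ker 1 p p = boxed p V"
  using funpow_p_lop[of _ p 1] T_pow_p by (auto simp: Ker_def lop_def boxed_def fun_eq_iff)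

text \<open>The upper bounds for the exponents \<open>m\<close> and \<open>p - m\<close> multiply to
  the order of the whole space, which in turn is at most the product of the two kernel orders; hence
  both bounds are attained.\<close>

lemma card_Ker_p:
  assumes "m \<le> p" shows "card (Ker 1 p m) = card V ^ m"
proof (rule antisym)
  have le: "card (Ker 1 p n) \<le> card V ^ n" for n
    using card_Ker_le_power[of 1 p n] power_mono[OF card_Ker_one_le[of 1 p], of n] by simp
  show "card (Ker 1 p m) \<le> card V ^ m" by (rule le)
  have "card V ^ p = card (Ker 1 p (m + (p - m)))"
    using boxed_space(3)[of p] assms by (simp add: Ker_p_p del: One_nat_def)
  also have "\<dots> \<le> card (Ker 1 p m) * card (Ker 1 p (p - m))" by (rule card_Ker_add_le)
  also have "\<dots> \<le> card (Ker 1 p m) * card V ^ (p - m)" by (rule mult_le_mono2[OF le])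
  finally have "card V ^ m * card V ^ (p - m) \<le> card (Ker 1 p m) * card V ^ (p - m)"
    using assms by (simp flip: power_add)
  then show "card V ^ m \<le> card (Ker 1 p m)"
    using card_subgroup_pos[OF sub fin] by simp
qed

lemma image_L_p:
  assumes "m \<le> p" shows "(lop 1 T ^^ m) ` boxed p V = Ker 1 p (p - m)"
proof (rule card_subset_eq[OF fin_Ker])
  show "(lop 1 T ^^ m) ` boxed p V \<subseteq> Ker 1 p (p - m)"
  proof
    fix x assume "x \<in> (lop 1 T ^^ m) ` boxed p V"
    then obtain h where h: "h \<in> boxed p V" "x = (lop 1 T ^^ m) h" by auto
    have "(lop 1 T ^^ (p - m)) x = (lop 1 T ^^ p) h"
      using assms by (simp add: h(2) flip: funpow_add[unfolded fun_eq_iff o_apply, rule_format])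
    also have "\<dots> = 0" using h(1) Ker_p_p by (auto simp: Ker_def)
    finally show "x \<in> Ker 1 p (p - m)" using lop_in[OF h(1)] h(2) by (simp add: Ker_def)
  qed
  have "card V ^ m * card V ^ (p - m) = card V ^ m * card ((lop 1 T ^^ m) ` boxed p V)"
    using card_kernel_image[OF boxed_space(2,1) additive_L, of p m 1] card_Ker_p[OF assms] assms
      boxed_space(3)[of p]
    by (simp add: Ker_def flip: power_add)
  then show "card ((lop 1 T ^^ m) ` boxed p V) = card (Ker 1 p (p - m))"
    using card_subgroup_pos[OF sub fin] card_Ker_p[of "p - m"] by simp
qed

text \<open>Both sides are the order of the set \<open>P\<close> of those \<open>c\<close> for which
  \<open>L^m c\<close> is supported below \<open>p - a\<close>. Projecting \<open>P\<close> along
  \<open>L^m\<close> exhibits \<open>Ker 1 (p - a) (p - m)\<close> as the image; projecting along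
  the shift by \<open>p - a\<close> exhibits \<open>Ker 1 a m\<close>.\<close>

theorem card_Ker_reflect:
  assumes "a \<le> p" "m \<le> p"
  shows "card V ^ m * card (Ker 1 (p - a) (p - m)) = card V ^ (p - a) * card (Ker 1 a m)"
proof -
  define P where "P = {c \<in> boxed p V. shift (p - a) ((lop 1 T ^^ m) c) = 0}"
  have adds: "Modules.additive (shift (p - a) :: (nat \<Rightarrow> 'b) \<Rightarrow> _)" by (rule additive_shift)
  have sub_P: "add_subgroup P"
    unfolding P_def
    using add_subgroup_kernel[OF boxed_space(2) additive_comp[OF adds additive_L]]
    by (simp add: o_def)
  have fin_P: "finite P" unfolding P_def using boxed_space(1) by simp
  have shift_0: "shift s h = 0 \<longleftrightarrow> (\<forall>i\<ge>s. h i = 0)" for s and h :: "nat \<Rightarrow> 'b"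
    by (auto simp: shift_def fun_eq_iff) (metis le_add_diff_inverse2)
  have "card P = card {c \<in> P. (lop 1 T ^^ m) c = 0} * card ((lop 1 T ^^ m) ` P)"
    by (rule card_kernel_image[OF sub_P fin_P additive_L])
  also have "{c \<in> P. (lop 1 T ^^ m) c = 0} = Ker 1 p m"
    by (auto simp: P_def Ker_def Modules.additive.zero[OF adds])
  also have "(lop 1 T ^^ m) ` P = {c \<in> (lop 1 T ^^ m) ` boxed p V. shift (p - a) c = 0}"
    by (auto simp: P_def)
  also have "\<dots> = Ker 1 (p - a) (p - m)"
    unfolding image_L_p[OF assms(2)] by (auto simp: Ker_def boxed_def shift_0)
  finally have 1: "card P = card V ^ m * card (Ker 1 (p - a) (p - m))"
    by (simp only: card_Ker_p[OF assms(2)])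
  have "card P = card {c \<in> P. shift (p - a) c = 0} * card (shift (p - a) ` P)"
    by (rule card_kernel_image[OF sub_P fin_P adds])
  also have "{c \<in> P. shift (p - a) c = 0} = boxed (p - a) V"
  proof -
    have "c \<in> P" if "c \<in> boxed (p - a) V" for c
    proof -
      have "shift (p - a) c = 0" using that by (auto simp: shift_0 boxed_def)
      then show ?thesis using that
        by (auto simp: P_def shift_L boxed_def Modules.additive.zero[OF additive_L])
    qed
    then show ?thesis by (auto simp: P_def shift_0 boxed_def)
  qed
  also have "shift (p - a) ` P = Ker 1 a m"
  proof (intro equalityI subsetI)
    fix x assume "x \<in> shift (p - a) ` P"
    then show "x \<in> Ker 1 a m"
      using shift_boxed[of _ p V "p - a"] assms by (auto simp: P_def Ker_def shift_L)
  next
    fix x assume x: "x \<in> Ker 1 a m"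
    define c where "c i = (if i < p - a then 0 else x (i - (p - a)))" for i
    have "shift (p - a) c = x" by (auto simp: shift_def c_def)
    moreover have "c \<in> boxed p V"
      using x assms add_subgroup_zero[OF sub] by (auto simp: Ker_def boxed_def c_def)
    ultimately show "x \<in> shift (p - a) ` P"
      using x by (intro image_eqI[where x = c]) (auto simp: P_def shift_L Ker_def)
  qed
  finally show ?thesis using 1 boxed_space(3) by simp
qed

end

lemma card_Ker_split:
  assumes d: "d \<ge> 1"
  shows "card (Ker d a n) = (\<Prod>i<d. card (Ker 1 ((a + d - 1 - i) div d) n))"
proof -
  \<comment> \<open>The quotient is \<open>(a - i)/d\<close> rounded up: the number of positions
    below \<open>a\<close> that are congruent to \<open>i\<close> modulo \<open>d\<close>.\<close>
  have ceil: "u < (a + d - 1 - i) div d \<longleftrightarrow> d * u + i < a" if "i < d" for u i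
  proof -
    have "u < (a + d - 1 - i) div d \<longleftrightarrow> Suc u * d \<le> a + d - 1 - i"
      using d by (simp add: less_eq_div_iff_mult_less_eq flip: Suc_le_eq)
    then show ?thesis using that d by (auto simp: algebra_simps)
  qed
  have "bij_betw (\<lambda>h. \<lambda>i\<in>{..<d}. \<lambda>u. h (d * u + i)) (Ker d a n)
      (\<Pi>\<^sub>E i\<in>{..<d}. Ker 1 ((a + d - 1 - i) div d) n)"
  proof (rule bij_betw_byWitness[where f' = "\<lambda>g x. g (x mod d) (x div d)"])
    show "\<forall>h\<in>Ker d a n. (\<lambda>x. (\<lambda>i\<in>{..<d}. \<lambda>u. h (d * u + i)) (x mod d) (x div d)) = h"
      using d by auto
    show "\<forall>g\<in>\<Pi>\<^sub>E i\<in>{..<d}. Ker 1 ((a + d - 1 - i) div d) n.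
        (\<lambda>i\<in>{..<d}. \<lambda>u. g ((d * u + i) mod d) ((d * u + i) div d)) = g"
      by (auto simp: fun_eq_iff PiE_def extensional_def)
    show "(\<lambda>h. \<lambda>i\<in>{..<d}. \<lambda>u. h (d * u + i)) ` Ker d a n \<subseteq>
        (\<Pi>\<^sub>E i\<in>{..<d}. Ker 1 ((a + d - 1 - i) div d) n)"
    proof (intro image_subsetI PiE_I)
      fix h i assume h: "h \<in> Ker d a n" and i: "i \<in> {..<d}"
      have "(lop 1 T ^^ n) (\<lambda>u. h (d * u + i)) = 0"
        using h by (auto simp: Ker_def fun_eq_iff simp flip: funpow_lop_residue simp del: One_nat_def)
      moreover have "(\<lambda>u. h (d * u + i)) \<in> boxed ((a + d - 1 - i) div d) V"
        using h i ceil[of i] by (auto simp: Ker_def boxed_def simp flip: not_less)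
      ultimately show "(\<lambda>i\<in>{..<d}. \<lambda>u. h (d * u + i)) i \<in> Ker 1 ((a + d - 1 - i) div d) n"
        using i by (simp add: Ker_def)
    qed auto
    show "(\<lambda>g x. g (x mod d) (x div d)) ` (\<Pi>\<^sub>E i\<in>{..<d}. Ker 1 ((a + d - 1 - i) div d) n) \<subseteq> Ker d a n"
    proof (rule image_subsetI)
      fix g assume g: "g \<in> (\<Pi>\<^sub>E i\<in>{..<d}. Ker 1 ((a + d - 1 - i) div d) n)"
      define h where "h x = g (x mod d) (x div d)" for x
      have gi: "g i \<in> Ker 1 ((a + d - 1 - i) div d) n" if "i < d" for i using g that by auto
      have "h x \<in> V" for x using gi[of "x mod d"] d by (auto simp: h_def Ker_def boxed_def)
      moreover have "h x = 0" if "x \<ge> a" for x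
        using gi[of "x mod d"] d ceil[of "x mod d" "x div d"] that
        by (auto simp: h_def Ker_def boxed_def)
      moreover have "(lop d T ^^ n) h x = 0" for x
      proof -
        have "(\<lambda>u. h (d * u + x mod d)) = g (x mod d)" using d by (auto simp: h_def)
        then show ?thesis
          using funpow_lop_residue[of n d T h "x div d" "x mod d"] gi[of "x mod d"] d
          by (auto simp: Ker_def)
      qed
      ultimately show "(\<lambda>x. g (x mod d) (x div d)) \<in> Ker d a n"
        unfolding h_def[abs_def, symmetric] by (auto simp: Ker_def boxed_def fun_eq_iff)
    qed
  qed
  then show ?thesis using bij_betw_same_card by (fastforce simp: card_PiE)
qed

end

section \<open>The inverse system of \<open>x\<^sup>2 + y\<^sup>3 + y z\<^sup>3\<close> over all prime fields\<close>

text \<open>A prime field \<open>\<int>/p\<close> with variable \<open>p\<close> is not a type; the product of all \<open>\<int>/n\<close> is a commutative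
  ring that contains all of them as additive subgroups.\<close>

quotient_type residue_product = "nat \<Rightarrow> int" / "\<lambda>f g. \<forall>n. [f n = g n] (mod int n)"
  by (rule equivpI) (auto simp: reflp_def symp_def transp_def cong_def)

instantiation residue_product :: comm_ring_1
begin

lift_definition zero_residue_product :: residue_product is "\<lambda>_. 0" .
lift_definition one_residue_product :: residue_product is "\<lambda>_. 1" .
lift_definition plus_residue_product :: "residue_product \<Rightarrow> residue_product \<Rightarrow> residue_product"
  is "\<lambda>f g n. f n + g n" by (auto intro: cong_add)
lift_definition minus_residue_product :: "residue_product \<Rightarrow> residue_product \<Rightarrow> residue_product"
  is "\<lambda>f g n. f n - g n" by (auto intro: cong_diff)
lift_definition uminus_residue_product :: "residue_product \<Rightarrow> residue_product"
  is "\<lambda>f n. - f n" by (auto simp: cong_minus_minus_iff)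
lift_definition times_residue_product :: "residue_product \<Rightarrow> residue_product \<Rightarrow> residue_product"
  is "\<lambda>f g n. f n * g n" by (auto intro: cong_mult)

instance
proof
  show "(0::residue_product) \<noteq> 1"
    by transfer (auto simp: cong_def intro!: exI[of _ 2])
qed (transfer; simp add: algebra_simps)+

end

text \<open>The inclusion of the factor \<open>Z/p\<close> into the product. It does not preserve
  \<open>1\<close>, but additivity is enough because all scalars are integers.\<close>

lift_definition residue_at :: "nat \<Rightarrow> int \<Rightarrow> residue_product"
  is "\<lambda>p k n. if n = p then k else 0" .

lemma additive_residue_at: "Modules.additive (residue_at p)"
proof
  show "residue_at p (x + y) = residue_at p x + residue_at p y" for x y
    by transfer auto
qed

lemma residue_at_eq_0_iff: "residue_at p k = 0 \<longleftrightarrow> int p dvd k"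
  by transfer (auto simp: cong_0_iff)

lemma residue_at_eq_iff: "residue_at p j = residue_at p k \<longleftrightarrow> [j = k] (mod int p)"
  using residue_at_eq_0_iff[of p "j - k"] Modules.additive.diff[OF additive_residue_at, of p j k]
  by (simp add: cong_iff_dvd_diff)

definition prime_field :: "nat \<Rightarrow> residue_product set" where
  "prime_field p = range (residue_at p)"

lemma prime_field_eq: "p > 0 \<Longrightarrow> prime_field p = residue_at p ` {0..<int p}"
proof -
  assume "p > 0"
  moreover have "residue_at p k = residue_at p (k mod int p)" for k
    by (simp add: residue_at_eq_iff cong_def)
  ultimately show ?thesis by (force simp: prime_field_def)
qed

lemma card_prime_field: "p > 0 \<Longrightarrow> card (prime_field p) = p"
proof -
  assume p: "p > 0"
  have "inj_on (residue_at p) {0..<int p}"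
    by (auto simp: inj_on_def residue_at_eq_iff intro: cong_less_imp_eq_int)
  then show ?thesis by (simp add: prime_field_eq[OF p] card_image)
qed

lemma finite_prime_field: "p > 0 \<Longrightarrow> finite (prime_field p)"
  by (simp add: prime_field_eq)

lemma add_subgroup_prime_field: "add_subgroup (prime_field p)"
  using add_subgroup_image[OF _ additive_residue_at, of UNIV]
  by (simp add: prime_field_def add_subgroup_def)

lemma torsion_prime_field: "v \<in> prime_field p \<Longrightarrow> of_nat p * v = 0"
  by (auto simp: prime_field_def residue_at_eq_0_iff additive_of_nat[OF additive_residue_at, symmetric])

definition box1 :: "nat \<Rightarrow> nat \<Rightarrow> (nat \<Rightarrow> residue_product) set" where
  "box1 p q = boxed q (prime_field p)"

definition box2 :: "nat \<Rightarrow> nat \<Rightarrow> (nat \<Rightarrow> nat \<Rightarrow> residue_product) set" where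
  "box2 p q = boxed q (box1 p q)"

definition box3 :: "nat \<Rightarrow> nat \<Rightarrow> (nat \<Rightarrow> nat \<Rightarrow> nat \<Rightarrow> residue_product) set" where
  "box3 p q = boxed q (box2 p q)"

text \<open>Multiplication by \<open>y\<^sup>3 + y z\<^sup>3 = y (y\<^sup>2 + z\<^sup>3)\<close>; multiplication by \<open>x\<^sup>2 + y\<^sup>3 + y z\<^sup>3\<close> is then
  \<open>lop 2 mult_yz\<close>.\<close>

definition mult_yz :: "(nat \<Rightarrow> nat \<Rightarrow> residue_product) \<Rightarrow> nat \<Rightarrow> nat \<Rightarrow> residue_product" where
  "mult_yz b = shift 1 (lop 2 (shift 3) b)"

lemma additive_mult_yz: "Modules.additive mult_yz"
  using additive_comp[OF additive_shift additive_lop[OF additive_shift]]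
  unfolding mult_yz_def[abs_def] o_def .

lemma torsion_boxed:
  assumes "\<And>v. v \<in> V \<Longrightarrow> of_nat p * v = (0::'b::comm_ring_1)" "v \<in> boxed a V"
  shows "of_nat p * v = 0"
  using assms by (auto simp: boxed_def fun_eq_iff)

context
  fixes p :: nat
  assumes prime: "prime p"
begin

lemma p_pos: "p > 0"
  using prime prime_gt_0_nat by blast

lemma boxes:
  shows sub1: "add_subgroup (box1 p q)" and sub2: "add_subgroup (box2 p q)" and sub3: "add_subgroup (box3 p q)"
    and fin1: "finite (box1 p q)" and fin2: "finite (box2 p q)" and fin3: "finite (box3 p q)"
    and card1: "card (box1 p q) = p ^ q" and card2: "card (box2 p q) = p ^ (q * q)"
    and card3: "card (box3 p q) = p ^ (q * q * q)"
proof -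
  show s1: "add_subgroup (box1 p q)"
    unfolding box1_def by (rule add_subgroup_boxed[OF add_subgroup_prime_field])
  show s2: "add_subgroup (box2 p q)" unfolding box2_def by (rule add_subgroup_boxed[OF s1])
  show s3: "add_subgroup (box3 p q)" unfolding box3_def by (rule add_subgroup_boxed[OF s2])
  show f1: "finite (box1 p q)" unfolding box1_def
    by (rule finite_boxed[OF add_subgroup_zero[OF add_subgroup_prime_field] finite_prime_field[OF p_pos]])
  show f2: "finite (box2 p q)" unfolding box2_def by (rule finite_boxed[OF add_subgroup_zero[OF s1] f1])
  show "finite (box3 p q)" unfolding box3_def by (rule finite_boxed[OF add_subgroup_zero[OF s2] f2])
  show c1: "card (box1 p q) = p ^ q" unfolding box1_def
    by (simp add: card_boxed[OF add_subgroup_zero[OF add_subgroup_prime_field]] card_prime_field[OF p_pos])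
  show c2: "card (box2 p q) = p ^ (q * q)" unfolding box2_def
    by (simp add: card_boxed[OF add_subgroup_zero[OF s1]] c1 power_mult)
  show "card (box3 p q) = p ^ (q * q * q)" unfolding box3_def
    by (simp add: card_boxed[OF add_subgroup_zero[OF s2]] c2 power_mult)
qed

lemma tors1: "v \<in> box1 p q \<Longrightarrow> of_nat p * v = 0"
  unfolding box1_def by (rule torsion_boxed[OF torsion_prime_field])

lemma tors2: "v \<in> box2 p q \<Longrightarrow> of_nat p * v = 0"
  unfolding box2_def by (rule torsion_boxed[OF tors1])

lemma shift_box1: "v \<in> box1 p q \<Longrightarrow> shift d v \<in> box1 p q"
  unfolding box1_def using shift_boxed[of v q "prime_field p" d] boxed_mono[of "q - d" q "prime_field p"] by auto

lemma mult_yz_box2: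
  assumes "b \<in> box2 p q" shows "mult_yz b \<in> box2 p q"
proof -
  have "lop 2 (shift 3) b \<in> boxed q (box1 p q)"
    by (rule lop_boxed[OF sub1 additive_shift shift_box1]) (use assms in \<open>auto simp: box2_def\<close>)
  then have "shift 1 (lop 2 (shift 3) b) \<in> boxed (q - 1) (box1 p q)" by (rule shift_boxed)
  then show ?thesis
    unfolding mult_yz_def box2_def using boxed_mono[of "q - 1" q "box1 p q"] by auto
qed

lemma torsion_space1: "torsion_space p (box1 p q) (shift d)"
  by unfold_locales (use prime in \<open>auto simp: sub1 fin1 tors1 shift_box1 Modules.additive.add[OF additive_shift]\<close>)

lemma torsion_space2: "torsion_space p (box2 p q) mult_yz"
  by unfold_locales (use prime in \<open>auto simp: sub2 fin2 tors2 mult_yz_box2 Modules.additive.add[OF additive_mult_yz]\<close>)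

end

section \<open>The kernel of \<open>f^n\<close> on the box and its growth in
  \<open>n\<close>\<close>

definition K :: "nat \<Rightarrow> nat \<Rightarrow> nat \<Rightarrow> (nat \<Rightarrow> nat \<Rightarrow> nat \<Rightarrow> residue_product) set" where
  "K p q n = {g \<in> box3 p q. (lop 2 mult_yz ^^ n) g = 0}"

definition klen :: "nat \<Rightarrow> nat \<Rightarrow> nat \<Rightarrow> real" where
  "klen p q n = log p (card (K p q n))"

lemma K_eq_Ker: "prime p \<Longrightarrow> K p q n = torsion_space.Ker (box2 p q) mult_yz 2 q n"
  by (simp add: K_def torsion_space.Ker_def[OF torsion_space2] box3_def)

lemma card_K_pos: "prime p \<Longrightarrow> card (K p q n) > 0"
  unfolding K_eq_Ker by (rule torsion_space.card_Ker_pos[OF torsion_space2])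

lemma klen_mono:
  assumes "prime p" "m \<le> n" shows "klen p q m \<le> klen p q n"
proof -
  interpret B: torsion_space p "box2 p q" mult_yz by (rule torsion_space2[OF assms(1)])
  have "card (K p q m) \<le> card (K p q n)"
    unfolding K_eq_Ker[OF assms(1)] using B.Ker_mono[OF assms(2)] B.fin_Ker by (intro card_mono)
  then show ?thesis
    unfolding klen_def using card_K_pos[OF assms(1), of q m] prime_gt_1_nat[OF assms(1)]
    by simp
qed

lemma klen_nonneg: "prime p \<Longrightarrow> 0 \<le> klen p q n"
  unfolding klen_def using card_K_pos[of p q n] prime_gt_1_nat[of p] by simp

text \<open>Each further factor \<open>f\<close> enlarges the kernel by at most the dimension of the
  kernel of \<open>f\<close> itself. As \<open>f\<close> is monic quadratic in \<open>x\<close>,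
  that kernel is determined by two \<open>x\<close>-layers of \<open>q^2\<close> coefficients
  each.\<close>

lemma klen_add_le:
  assumes "prime p"
  shows "klen p q (m + n) \<le> klen p q m + real n * (2 * real q ^ 2)"
proof -
  interpret B: torsion_space p "box2 p q" mult_yz by (rule torsion_space2[OF assms])
  have "card (K p q (m + n)) \<le> card (K p q m) * card (K p q n)"
    unfolding K_eq_Ker[OF assms] by (rule B.card_Ker_add_le)
  also have "card (K p q n) \<le> card (K p q 1) ^ n"
    unfolding K_eq_Ker[OF assms] by (rule B.card_Ker_le_power) simp
  also have "\<dots> \<le> (card (box2 p q) ^ 2) ^ n"
    unfolding K_eq_Ker[OF assms] by (intro power_mono B.card_Ker_one_le) simp_all
  also have "\<dots> = p ^ (n * (2 * q\<^sup>2))"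
    unfolding card2[OF assms] power_mult[symmetric] by (simp add: power2_eq_square mult_ac)
  finally have "card (K p q (m + n)) \<le> card (K p q m) * p ^ (n * (2 * q\<^sup>2))" by simp
  then have "real (card (K p q (m + n))) \<le> real (card (K p q m)) * real p ^ (n * (2 * q\<^sup>2))"
    by (metis of_nat_le_iff of_nat_mult of_nat_power)
  then have "klen p q (m + n) \<le> log p (real (card (K p q m)) * real p ^ (n * (2 * q\<^sup>2)))"
    unfolding klen_def using card_K_pos[OF assms, of q "m + n"] prime_gt_1_nat[OF assms] by simp
  also have "\<dots> = klen p q m + real n * (2 * real q ^ 2)"
    unfolding klen_def using card_K_pos[OF assms, of q m] prime_gt_1_nat[OF assms]
    by (simp add: log_mult log_nat_power)
  finally show ?thesis .
qed

subsection \<open>Frobenius\<close>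

lemma mult_yz_apply: "mult_yz b j k = b (j + 3) k + b (j + 1) (k + 3)"
  by (simp add: mult_yz_def shift_def lop_def numeral_3_eq_3)

lemma funpow_mult_yz: "(mult_yz ^^ n) b = shift n ((lop 2 (shift 3) ^^ n) b)"
proof (induction n arbitrary: b)
  case (Suc n)
  have comm: "(lop 2 (shift 3) ^^ n) (shift 1 c) = shift 1 ((lop 2 (shift 3) ^^ n) c)"
    for c :: "nat \<Rightarrow> nat \<Rightarrow> residue_product"
  proof (induction n arbitrary: c)
    case (Suc n)
    have "lop 2 (shift 3) (shift 1 c) = shift 1 (lop 2 (shift 3) c)"
      by (auto simp: lop_def shift_def fun_eq_iff)
    then show ?case using Suc by (simp only: funpow_Suc_right o_apply)
  qed simp
  have "(mult_yz ^^ Suc n) b = shift n (shift 1 ((lop 2 (shift 3) ^^ Suc n) b))"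
    by (simp only: funpow_Suc_right o_apply Suc.IH mult_yz_def comm)
  also have "\<dots> = shift (Suc n) ((lop 2 (shift 3) ^^ Suc n) b)" 
    by (simp add: shift_def[of n] shift_def[of "Suc 0"] shift_def[of "Suc n"])
  finally show ?case .
qed (simp add: shift_def)

lemma funpow_p_mult_yz:
  assumes "prime p" "b \<in> box2 p q"
  shows "(mult_yz ^^ p) b j k = b (j + 3 * p) k + b (j + p) (k + 3 * p)"
proof -
  interpret B1: torsion_space p "box1 p q" "shift 3" by (rule torsion_space1[OF assms(1)])
  show ?thesis
    using B1.funpow_p_lop[of b q 2] assms(2) unfolding funpow_mult_yz
    by (simp add: box2_def lop_def funpow_shift shift_def algebra_simps)
qed

lemma funpow_p_mult:
  assumes "prime p" "g \<in> box3 p q"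
  shows "(lop 2 mult_yz ^^ p) g i j k =
    g (i + 2 * p) j k + (g i (j + 3 * p) k + g i (j + p) (k + 3 * p))"
proof -
  interpret B2: torsion_space p "box2 p q" mult_yz by (rule torsion_space2[OF assms(1)])
  have "g i \<in> box2 p q" using assms(2) by (auto simp: box3_def boxed_def)
  then show ?thesis
    using B2.funpow_p_lop[of g q 2] assms(2) funpow_p_mult_yz[OF assms(1), of "g i" q]
    by (simp add: box3_def lop_def)
qed

lemma mem_box3_iff:
  "g \<in> box3 p q \<longleftrightarrow> (\<forall>i j k. g i j k \<in> prime_field p \<and> (i \<ge> q \<or> j \<ge> q \<or> k \<ge> q \<longrightarrow> g i j k = 0))"
  (is "?l = ?r")
proof
  assume ?l
  then show ?r by (auto simp: box3_def box2_def box1_def boxed_def)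
next
  assume ?r
  then show ?l by (auto simp: box3_def box2_def box1_def boxed_def fun_eq_iff)
qed

text \<open>The freeness of Frobenius in coordinates: the \<open>p^3\<close> residues of an exponent
  vector modulo \<open>p\<close> index a basis over the \<open>p\<close>-th powers, and each residue
  carries a function on a box smaller by the factor \<open>p\<close>.\<close>

definition dissect :: "nat \<Rightarrow> (nat \<Rightarrow> nat \<Rightarrow> nat \<Rightarrow> 'a) \<Rightarrow> nat \<times> nat \<times> nat \<Rightarrow> nat \<Rightarrow> nat \<Rightarrow> nat \<Rightarrow> 'a" where
  "dissect p g = (\<lambda>(a, b, c) i j k. g (p * i + a) (p * j + b) (p * k + c))"

lemma funpow_mult_box3:
  assumes "prime p" "g \<in> box3 p q" shows "(lop 2 mult_yz ^^ n) g \<in> box3 p q"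
  using torsion_space.lop_in[OF torsion_space2[OF assms(1)], of g q q n 2] assms(2)
  by (simp add: box3_def)

text \<open>\<open>f^p\<close> is \<open>f\<close> evaluated at \<open>x^p\<close>,
  \<open>y^p\<close>, \<open>z^p\<close>, and on a residue class modulo \<open>p\<close> these
  powers act as the variables.\<close>

lemma dissect_funpow_mult:
  assumes "prime p" "g \<in> box3 p q"
  shows "dissect p ((lop 2 mult_yz ^^ (p * n)) g) t = (lop 2 mult_yz ^^ n) (dissect p g t)"
  using assms(2)
proof (induction n arbitrary: g)
  case (Suc n)
  obtain a b c where t: "t = (a, b, c)" by (cases t) auto
  have "dissect p ((lop 2 mult_yz ^^ p) g) t = lop 2 mult_yz (dissect p g t)"
    by (auto simp: t fun_eq_iff dissect_def funpow_p_mult[OF assms(1) Suc.prems] lop_def mult_yz_apply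
        algebra_simps mult_2_right)
  moreover have "(lop 2 mult_yz ^^ (p * Suc n)) g = (lop 2 mult_yz ^^ (p * n)) ((lop 2 mult_yz ^^ p) g)"
    by (simp add: funpow_add add.commute[of p])
  ultimately show ?case
    using Suc.IH[OF funpow_mult_box3[OF assms(1) Suc.prems, of p]] by (simp only: funpow_Suc_right o_apply)
qed simp

lemma card_K_Frobenius:
  assumes "prime p" shows "card (K p (p * q) (p * n)) = card (K p q n) ^ (p ^ 3)"
proof -
  have p: "p > 0" using assms by (rule prime_gt_0_nat)
  define D where "D = {..<p} \<times> {..<p} \<times> {..<p}"
  have box: "g \<in> box3 p (p * q) \<longleftrightarrow> (\<forall>t\<in>D. dissect p g t \<in> box3 p q)" for g
  proof
    assume "g \<in> box3 p (p * q)"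
    moreover have "p * q \<le> p * i + a" if "q \<le> i" for i a using that by (simp add: trans_le_add1)
    ultimately show "\<forall>t\<in>D. dissect p g t \<in> box3 p q"
      by (auto simp: mem_box3_iff dissect_def)
  next
    assume R: "\<forall>t\<in>D. dissect p g t \<in> box3 p q"
    have "g i j k \<in> prime_field p \<and> (i \<ge> p * q \<or> j \<ge> p * q \<or> k \<ge> p * q \<longrightarrow> g i j k = 0)" for i j k
    proof -
      have "dissect p g (i mod p, j mod p, k mod p) \<in> box3 p q" using R p by (auto simp: D_def)
      moreover have "q \<le> i div p" if "p * q \<le> i" for i
        using that p by (simp add: less_eq_div_iff_mult_less_eq mult.commute)
      moreover have "dissect p g (i mod p, j mod p, k mod p) (i div p) (j div p) (k div p) = g i j k"
        by (simp add: dissect_def)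
      ultimately show ?thesis by (metis mem_box3_iff)
    qed
    then show "g \<in> box3 p (p * q)" by (simp add: mem_box3_iff)
  qed
  have zero: "g = 0 \<longleftrightarrow> (\<forall>t\<in>D. dissect p g t = 0)" for g :: "nat \<Rightarrow> nat \<Rightarrow> nat \<Rightarrow> residue_product"
  proof
    assume R: "\<forall>t\<in>D. dissect p g t = 0"
    have "g i j k = 0" for i j k
    proof -
      have "dissect p g (i mod p, j mod p, k mod p) = 0" using R p by (auto simp: D_def)
      then have "dissect p g (i mod p, j mod p, k mod p) (i div p) (j div p) (k div p) = 0" by simp
      then show ?thesis by (simp add: dissect_def)
    qed
    then show "g = 0" by (auto simp: fun_eq_iff)
  qed (auto simp: dissect_def fun_eq_iff)
  have mem: "g \<in> K p (p * q) (p * n) \<longleftrightarrow> (\<forall>t\<in>D. dissect p g t \<in> K p q n)" for g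
  proof (cases "g \<in> box3 p (p * q)")
    case True
    then show ?thesis
      using box[of g] zero[of "(lop 2 mult_yz ^^ (p * n)) g"] dissect_funpow_mult[OF assms True]
      by (simp add: K_def)
  qed (use box[of g] in \<open>auto simp: K_def\<close>)
  have "bij_betw (\<lambda>g. restrict (dissect p g) D) (K p (p * q) (p * n)) (D \<rightarrow>\<^sub>E K p q n)"
  proof (rule bij_betw_byWitness[where f' = "\<lambda>c i j k. c (i mod p, j mod p, k mod p) (i div p) (j div p) (k div p)"])
    show "\<forall>g\<in>K p (p * q) (p * n). (\<lambda>i j k. restrict (dissect p g) D (i mod p, j mod p, k mod p)
        (i div p) (j div p) (k div p)) = g"
      using p by (auto simp: D_def dissect_def)
    have eq: "dissect p (\<lambda>i j k. c (i mod p, j mod p, k mod p) (i div p) (j div p) (k div p)) t = c t"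
      if "t \<in> D" for c t using that p by (auto simp: D_def dissect_def fun_eq_iff)
    show "\<forall>c\<in>D \<rightarrow>\<^sub>E K p q n. restrict (dissect p (\<lambda>i j k. c (i mod p, j mod p, k mod p)
        (i div p) (j div p) (k div p))) D = c"
      by (auto simp: eq fun_eq_iff PiE_def extensional_def restrict_def)
    show "(\<lambda>g. restrict (dissect p g) D) ` K p (p * q) (p * n) \<subseteq> D \<rightarrow>\<^sub>E K p q n"
      using mem by (auto split: if_splits)
    show "(\<lambda>c i j k. c (i mod p, j mod p, k mod p) (i div p) (j div p) (k div p)) ` (D \<rightarrow>\<^sub>E K p q n)
        \<subseteq> K p (p * q) (p * n)"
      by (auto simp: mem eq)
  qed
  moreover have "finite D" "card D = p ^ 3" by (auto simp: D_def card_cartesian_product power3_eq_cube)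
  ultimately show ?thesis using bij_betw_same_card by (fastforce simp: card_PiE)
qed

lemma klen_Frobenius:
  assumes "prime p" shows "klen p (p * q) (p * n) = real p ^ 3 * klen p q n"
  unfolding klen_def card_K_Frobenius[OF assms]
  using card_K_pos[OF assms, of q n] by (simp add: log_nat_power)

subsection \<open>The first Frobenius level\<close>

text \<open>The dimension of the kernel of \<open>g^n\<close> at level \<open>p\<close>. The term
  \<open>n * p\<close> is due to the factor \<open>y^n\<close>; \<open>i\<close> is the parity class
  of the \<open>y\<close>-exponent among the remaining \<open>p - n\<close> layers, and
  \<open>min p (3 * s)\<close> is the dimension of the kernel of \<open>z^(3 s)\<close> on
  \<open>k[z]/(z^p)\<close>.\<close>

definition len_yz :: "nat \<Rightarrow> nat \<Rightarrow> real" where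
  "len_yz p n = real (n * p) + (\<Sum>i<2. \<Sum>l<min ((p - n + 1 - i) div 2) n.
     real (min p (3 * ((p - n + 1 - i) div 2 + n - 1 - 2 * l))))"

lemma log_card_ker_mult_yz:
  assumes "prime p" "n \<le> p"
  shows "log p (card (torsion_space.ker (box2 p p) mult_yz n)) = len_yz p n"
proof -
  interpret B1: torsion_space p "box1 p p" "shift 3" by (rule torsion_space1[OF assms(1)])
  interpret B2: torsion_space p "box2 p p" mult_yz by (rule torsion_space2[OF assms(1)])
  have p: "p > 1" using assms(1) by (rule prime_gt_1_nat)
  have shift_0: "shift s h = 0 \<longleftrightarrow> (\<forall>i\<ge>s. h i = 0)" for s and h :: "nat \<Rightarrow> 'c::zero"
    by (auto simp: shift_def fun_eq_iff) (metis le_add_diff_inverse2)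
  have ker1: "log p (card (B1.ker s)) = real (min p (3 * s))" for s
  proof -
    have "B1.ker s = boxed (min p (3 * s)) (prime_field p)"
      unfolding B1.ker_def funpow_shift by (auto simp: box1_def boxed_def shift_0 mult.commute min_le_iff_disj)
    then have "card (B1.ker s) = p ^ min p (3 * s)"
      using p by (simp add: card_boxed add_subgroup_zero[OF add_subgroup_prime_field] card_prime_field)
    then show ?thesis using p by (simp add: log_nat_power)
  qed
  have "card (B2.ker n) = card {b \<in> B2.ker n. shift n b = 0} * card (shift n ` B2.ker n)"
    by (rule card_kernel_image[OF B2.sub_ker B2.fin_ker additive_shift])
  \<comment> \<open>The lowest \<open>n\<close> layers in \<open>y\<close> are killed already by the
    factor \<open>y^n\<close>.\<close>
  also have "{b \<in> B2.ker n. shift n b = 0} = boxed n (box1 p p)"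
  proof -
    have "b \<in> B2.ker n" if "b \<in> boxed n (box1 p p)" for b
    proof -
      have "shift n b = 0" using that by (simp add: shift_0 boxed_def)
      moreover have "b \<in> box2 p p"
        unfolding box2_def using that boxed_mono[OF assms(2), of "box1 p p"] by auto
      ultimately show ?thesis
        by (simp add: B2.ker_def funpow_mult_yz B1.shift_L Modules.additive.zero[OF B1.additive_L])
    qed
    moreover have "b \<in> boxed n (box1 p p)" if "b \<in> B2.ker n" "shift n b = 0" for b
      using that by (simp add: B2.ker_def) (simp add: box2_def boxed_def shift_0)
    moreover have "shift n b = 0" if "b \<in> boxed n (box1 p p)" for b
      using that by (simp add: shift_0 boxed_def)
    ultimately show ?thesis by auto
  qed
  \<comment> \<open>After the shift by \<open>y^n\<close> only \<open>p - n\<close> layers are left,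
    and on them the condition is \<open>(y^2 + z^3)^n = 0\<close>.\<close>
  also have "shift n ` B2.ker n = B1.Ker 2 (p - n) n"
  proof (intro equalityI subsetI)
    fix x assume "x \<in> shift n ` B2.ker n"
    then show "x \<in> B1.Ker 2 (p - n) n"
      using shift_boxed[of _ p "box1 p p" n]
      unfolding B2.ker_def by (auto simp: B1.Ker_def box2_def funpow_mult_yz B1.shift_L)
  next
    fix x assume x: "x \<in> B1.Ker 2 (p - n) n"
    define c where "c i = (if i < n then 0 else x (i - n))" for i
    have "shift n c = x" by (auto simp: shift_def c_def)
    moreover have "c \<in> boxed p (box1 p p)"
      using x assms add_subgroup_zero[OF B1.sub] by (auto simp: B1.Ker_def boxed_def c_def)
    ultimately show "x \<in> shift n ` B2.ker n"
      using x unfolding B2.ker_def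
      by (intro image_eqI[where x = c]) (auto simp: box2_def funpow_mult_yz B1.shift_L B1.Ker_def)
  qed
  also have "card (boxed n (box1 p p)) = p ^ (n * p)"
    by (simp add: B1.boxed_space(3) card1[OF assms(1)] mult.commute flip: power_mult)
  finally have "log p (card (B2.ker n)) = real (n * p) + log p (card (B1.Ker 2 (p - n) n))"
    using B1.card_Ker_pos[of 2 "p - n" n] p by (simp add: log_mult log_nat_power)
  also have "card (B1.Ker 2 (p - n) n) = (\<Prod>i<2. card (B1.Ker 1 ((p - n + 1 - i) div 2) n))"
    using B1.card_Ker_split[of 2 "p - n" n] by simp
  also have "log p (real \<dots>) = (\<Sum>i<2. log p (card (B1.Ker 1 ((p - n + 1 - i) div 2) n)))"
    using B1.card_Ker_pos by (simp add: numeral_2_eq_2 log_mult)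
  also have "\<dots> = (\<Sum>i<2. \<Sum>l<min ((p - n + 1 - i) div 2) n.
     real (min p (3 * ((p - n + 1 - i) div 2 + n - 1 - 2 * l))))"
  proof (rule sum.cong[OF refl])
    fix i :: nat
    have "(p - n + 1 - i) div 2 + n \<le> p + 1" using assms(2) by linarith
    then show "log p (card (B1.Ker 1 ((p - n + 1 - i) div 2) n)) =
      (\<Sum>l<min ((p - n + 1 - i) div 2) n. real (min p (3 * ((p - n + 1 - i) div 2 + n - 1 - 2 * l))))"
      by (simp only: B1.log_card_Ker ker1)
  qed
  finally show ?thesis by (simp add: len_yz_def)
qed

lemma klen_split:
  assumes "prime p"
  shows "klen p p m = (\<Sum>i<2. log p (card (torsion_space.Ker (box2 p p) mult_yz 1 ((p + 1 - i) div 2) m)))"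
proof -
  interpret B2: torsion_space p "box2 p p" mult_yz by (rule torsion_space2[OF assms(1)])
  show ?thesis
    unfolding klen_def K_eq_Ker[OF assms] using B2.card_Ker_split[of 2 p m] B2.card_Ker_pos
    by (simp add: numeral_2_eq_2 log_mult)
qed

text \<open>Each parity class in \<open>x\<close> has size at most \<open>(p + 1) div 2\<close>, so
  the bound on \<open>m\<close> brings both classes within the range of
  \<open>log_card_Ker\<close>.\<close>

lemma klen_level_one:
  assumes "prime p" "m \<le> (p + 1) div 2"
  shows "klen p p m = (\<Sum>i<2. \<Sum>j<min ((p + 1 - i) div 2) m. len_yz p ((p + 1 - i) div 2 + m - 1 - 2 * j))"
  unfolding klen_split[OF assms(1)]
proof (rule sum.cong[OF refl])
  fix i :: nat
  interpret B2: torsion_space p "box2 p p" mult_yz by (rule torsion_space2[OF assms(1)])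
  have le: "(p + 1 - i) div 2 + m \<le> p + 1" using assms(2) by linarith
  have "log p (card (B2.Ker 1 ((p + 1 - i) div 2) m)) =
      (\<Sum>j<min ((p + 1 - i) div 2) m. log p (card (B2.ker ((p + 1 - i) div 2 + m - 1 - 2 * j))))"
    by (rule B2.log_card_Ker[OF le])
  also have "\<dots> = (\<Sum>j<min ((p + 1 - i) div 2) m. len_yz p ((p + 1 - i) div 2 + m - 1 - 2 * j))"
    using le by (intro sum.cong log_card_ker_mult_yz[OF assms(1)]) auto
  finally show "log p (card (B2.Ker 1 ((p + 1 - i) div 2) m)) = \<dots>" .
qed

lemma klen_level_one_reflect:
  assumes "prime p" "odd p" "m \<le> p"
  shows "klen p p m = (2 * real m - real p) * real p ^ 2 + klen p p (p - m)"
proof -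
  interpret B2: torsion_space p "box2 p p" mult_yz by (rule torsion_space2[OF assms(1)])
  have p: "p > 1" using assms(1) by (rule prime_gt_1_nat)
  have nil: "(mult_yz ^^ p) b = 0" if "b \<in> box2 p p" for b
  proof -
    have b: "b j k = 0" if "j \<ge> p \<or> k \<ge> p" for j k
      using that \<open>b \<in> box2 p p\<close> by (auto simp: box2_def box1_def boxed_def)
    show ?thesis by (auto simp: fun_eq_iff funpow_p_mult_yz[OF assms(1) that] b)
  qed
  have reflect: "real m * real p ^ 2 + log p (card (B2.Ker 1 (p - a) (p - m))) =
      real (p - a) * real p ^ 2 + log p (card (B2.Ker 1 a m))" if "a \<le> p" for a
  proof -
    have "real (card (box2 p p) ^ m * card (B2.Ker 1 (p - a) (p - m))) =
        real (card (box2 p p) ^ (p - a) * card (B2.Ker 1 a m))"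
      using B2.card_Ker_reflect[OF nil that assms(3)] by simp
    then have "log p (real p ^ (p * p * m) * card (B2.Ker 1 (p - a) (p - m))) =
        log p (real p ^ (p * p * (p - a)) * card (B2.Ker 1 a m))"
      by (simp add: card2[OF assms(1)] flip: power_mult)
    then show ?thesis
      using p B2.card_Ker_pos by (simp add: log_mult log_nat_power power2_eq_square mult_ac del: One_nat_def)
  qed
  \<comment> \<open>The two parity classes in \<open>x\<close> have sizes \<open>r + 1\<close> and
    \<open>r\<close>; since they add up to \<open>p\<close>, the reflection
    \<open>a \<mapsto> p - a\<close> interchanges them.\<close>
  obtain r where r: "p = 2 * r + 1" using assms(2) by (auto elim: oddE)
  have "real m * real p ^ 2 + log p (card (B2.Ker 1 r (p - m))) = real r * real p ^ 2 + log p (card (B2.Ker 1 (r + 1) m))"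
    using reflect[of "r + 1"] r by (simp del: One_nat_def)
  moreover have "real m * real p ^ 2 + log p (card (B2.Ker 1 (r + 1) (p - m))) =
      real (r + 1) * real p ^ 2 + log p (card (B2.Ker 1 r m))"
    using reflect[of r] r by (simp del: One_nat_def)
  moreover have "klen p p m = log p (card (B2.Ker 1 (r + 1) m)) + log p (card (B2.Ker 1 r m))" for m
  proof -
    have "(p + 1 - 0) div 2 = r + 1" "(p + 1 - 1) div 2 = r" using r by auto
    moreover have "{..<2} = {0, 1::nat}" by auto
    ultimately show ?thesis unfolding klen_split[OF assms(1)] by (simp del: One_nat_def)
  qed
  ultimately show ?thesis using r by (simp add: algebra_simps)
qed

text \<open>Reflecting the trivial kernel of exponent \<open>0\<close> shows that \<open>f^p\<close>
  kills the whole box at level \<open>p\<close>; larger exponents cannot exceed the box.\<close>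

lemma klen_level_one_full:
  assumes "prime p" "odd p" "m \<ge> p" shows "klen p p m = real p ^ 3"
proof (rule antisym)
  have p: "p > 1" using assms(1) by (rule prime_gt_1_nat)
  have "klen p p 0 = 0"
    using torsion_space.Ker_trivial[OF torsion_space2[OF assms(1)]] by (simp add: klen_def K_eq_Ker[OF assms(1)])
  then have "klen p p p = real p ^ 3"
    using klen_level_one_reflect[OF assms(1,2) order_refl] by (simp add: power2_eq_square power3_eq_cube)
  then show "real p ^ 3 \<le> klen p p m" using klen_mono[OF assms(1,3), of p] by simp
  have "card (K p p m) \<le> card (box3 p p)"
    unfolding K_def by (intro card_mono fin3[OF assms(1)]) auto
  then have "log p (card (K p p m)) \<le> log p (p ^ (p * p * p))"
    using card_K_pos[OF assms(1), of p m] p by (simp add: card3[OF assms(1)] del: log_pow_cancel flip: of_nat_power)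
  then show "klen p p m \<le> real p ^ 3" using p by (simp add: klen_def log_nat_power power3_eq_cube)
qed

section \<open>Power series over \<open>\<int>\<close> and \<open>\<int>/p\<close>\<close>

lemma finite_vec_le: "finite {b :: nat ^ 'v. \<forall>v. b $ v \<le> a $ v}"
proof -
  have "{b :: nat ^ 'v. \<forall>v. b $ v \<le> a $ v} \<subseteq> vec_lambda ` (\<Pi>\<^sub>E v\<in>UNIV. {..a $ v})"
  proof
    fix b :: "nat ^ 'v" assume "b \<in> {b. \<forall>v. b $ v \<le> a $ v}"
    then show "b \<in> vec_lambda ` (\<Pi>\<^sub>E v\<in>UNIV. {..a $ v})"
      by (intro image_eqI[where x = "vec_nth b"]) auto
  qed
  then show ?thesis by (rule finite_subset) (auto intro!: finite_imageI finite_PiE)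
qed

lemma vec_add_eqD: "b + c = a \<Longrightarrow> b $ v \<le> a $ v \<and> c $ v \<le> (a :: nat ^ 'v) $ v"
  by auto

lemma finite_antidiagonal: "finite {(b, c). b + c = (a :: nat ^ 'v)}"
  by (rule finite_subset[OF _ finite_cartesian_product[OF finite_vec_le[of a] finite_vec_le[of a]]])
     (auto dest: vec_add_eqD)

text \<open>Products of power series over \<open>Z/p\<close> are reductions of this integer product,
  so the ring laws are verified once over the integers and then transported by
  \<open>reduce_mod\<close>.\<close>

definition conv :: "(nat ^ 'v \<Rightarrow> int) \<Rightarrow> (nat ^ 'v \<Rightarrow> int) \<Rightarrow> nat ^ 'v \<Rightarrow> int" where
  "conv f g a = (\<Sum>(b, c)\<in>{(b, c). b + c = a}. f b * g c)"

definition mvmono :: "nat ^ 'v \<Rightarrow> nat ^ 'v \<Rightarrow> int" where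
  "mvmono m = (\<lambda>a. if a = m then 1 else 0)"

lemma conv_commute: "conv f g = conv g f"
proof
  fix a
  show "conv f g a = conv g f a"
    unfolding conv_def
    by (rule sum.reindex_bij_witness[where i = prod.swap and j = prod.swap])
       (auto simp: mult.commute add.commute)
qed

lemma conv_assoc:
  fixes f g h :: "nat ^ 'v \<Rightarrow> int"
  shows "conv (conv f g) h = conv f (conv g h)"
proof
  fix a :: "nat ^ 'v"
  have "conv (conv f g) h a = (\<Sum>(x, y)\<in>{(b, c). b + c = a}. \<Sum>(b, c)\<in>{(b, c). b + c = x}. f b * g c * h y)"
    by (simp add: conv_def sum_distrib_right case_prod_beta)
  also have "\<dots> = (\<Sum>((x, y), (b, c))\<in>(SIGMA z:{(b, c). b + c = a}. {(b, c). b + c = fst z}). f b * g c * h y)"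
    by (subst sum.Sigma[symmetric]) (auto simp: finite_antidiagonal case_prod_beta)
  also have "\<dots> = (\<Sum>((x, y), (b, c))\<in>(SIGMA z:{(b, c). b + c = a}. {(b, c). b + c = snd z}). f x * (g b * h c))"
    by (rule sum.reindex_bij_witness[where i = "\<lambda>((x, y), (b, c)). ((x + b, c), (x, b))"
          and j = "\<lambda>((x, y), (b, c)). ((b, c + y), (c, y))"]) (auto simp: algebra_simps)
  also have "\<dots> = (\<Sum>(x, y)\<in>{(b, c). b + c = a}. \<Sum>(b, c)\<in>{(b, c). b + c = y}. f x * (g b * h c))"
    by (subst sum.Sigma[symmetric]) (auto simp: finite_antidiagonal case_prod_beta)
  also have "\<dots> = conv f (conv g h) a"
    by (simp add: conv_def sum_distrib_left case_prod_beta)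
  finally show "conv (conv f g) h a = conv f (conv g h) a" .
qed

lemma conv_add_left: "conv (\<lambda>a. f a + g a) h = (\<lambda>a. conv f h a + conv g h a)"
  by (simp add: conv_def fun_eq_iff case_prod_beta algebra_simps sum.distrib)

lemma conv_mono:
  fixes g :: "nat ^ 'v \<Rightarrow> int"
  shows "conv (mvmono m) g a = (if \<forall>v. m $ v \<le> a $ v then g (a - m) else 0)"
proof -
  have eq: "c = a - m" if "m + c = a" for c
    using that by (metis add_diff_cancel_left' vec_eq_iff vector_add_component vector_minus_component)
  have "conv (mvmono m) g a = (\<Sum>(b, c)\<in>{(b, c). b + c = a}. if b = m then g (a - m) else 0)"
    unfolding conv_def by (rule sum.cong) (auto simp: mvmono_def eq)
  also have "\<dots> = (\<Sum>x\<in>{(b, c). b + c = a}. if x = (m, a - m) then g (a - m) else 0)"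
  proof (rule sum.cong[OF refl])
    fix x assume "x \<in> {(b, c). b + c = a}"
    then obtain b c where x: "x = (b, c)" "b + c = a" by auto
    then show "(case x of (b, c) \<Rightarrow> if b = m then g (a - m) else 0) = (if x = (m, a - m) then g (a - m) else 0)"
      using eq[of c] by auto
  qed
  also have "\<dots> = (if m + (a - m) = a then g (a - m) else 0)"
    using finite_antidiagonal[of a] by (simp add: sum.delta)
  also have "m + (a - m) = a \<longleftrightarrow> (\<forall>v. m $ v \<le> a $ v)"
    by (auto simp: vec_eq_iff) (metis le_add1)
  finally show ?thesis .
qed

lemma mvmono_add: "conv (mvmono m) (mvmono n) = mvmono (m + n)"
  unfolding fun_eq_iff conv_mono by (auto simp: mvmono_def vec_eq_iff) (metis le_add_diff_inverse)

lemma conv_one: "conv (mvmono 0) g = g"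
  by (auto simp: conv_mono fun_eq_iff)

lemma reduce_conv_left: "reduce_mod p (conv (reduce_mod p f) g) = reduce_mod p (conv f g)"
  unfolding reduce_mod_def conv_def fun_eq_iff
  by (intro allI, subst (1 2) mod_sum_eq[symmetric]) (simp add: case_prod_beta mod_mult_left_eq)

lemma reduce_conv_right: "reduce_mod p (conv g (reduce_mod p f)) = reduce_mod p (conv g f)"
  using reduce_conv_left[of p f g] by (simp add: conv_commute)

context
  fixes p :: nat
  assumes p: "p > 1"
begin

abbreviation S_p :: "(nat ^ 'v \<Rightarrow> int) ring" where
  "S_p \<equiv> mpower_series (residue_ring (int p))"

lemma carrier_S_p: "f \<in> carrier S_p \<longleftrightarrow> (\<forall>a. 0 \<le> f a \<and> f a < int p)"
  by (auto simp: mpower_series_def residue_ring_def)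

lemma reduce_carrier: "reduce_mod p f \<in> carrier S_p"
  using p by (auto simp: carrier_S_p reduce_mod_def)

lemma reduce_id: "f \<in> carrier S_p \<Longrightarrow> reduce_mod p f = f"
  by (auto simp: carrier_S_p reduce_mod_def)

lemma add_S_p: "f \<oplus>\<^bsub>S_p\<^esub> g = reduce_mod p (\<lambda>a. f a + g a)"
  by (auto simp: mpower_series_def residue_ring_def reduce_mod_def)

lemma zero_S_p: "\<zero>\<^bsub>S_p\<^esub> = (\<lambda>a. 0)"
  by (auto simp: mpower_series_def residue_ring_def)

lemma one_S_p: "\<one>\<^bsub>S_p\<^esub> = mvmono 0"
  by (auto simp: mpower_series_def residue_ring_def mvmono_def)

lemma mvar_S_p: "mvar (residue_ring (int p)) v = mvmono (axis v 1)"
  by (auto simp: mvar_def residue_ring_def mvmono_def)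

lemma mult_S_p:
  fixes f g :: "nat ^ 'v \<Rightarrow> int"
  shows "f \<otimes>\<^bsub>S_p\<^esub> g = reduce_mod p (conv f g)"
proof -
  interpret R: residues "int p" "residue_ring (int p)" by unfold_locales (use p in auto)
  have fs: "(\<Oplus>\<^bsub>residue_ring (int p)\<^esub>i\<in>A. h i mod int p) = (\<Sum>i\<in>A. h i) mod int p"
    if "finite A" for A :: "((nat ^ 'v) \<times> (nat ^ 'v)) set" and h
    by (rule R.sum_cong[OF that])
  show ?thesis
  proof
    fix a :: "nat ^ 'v"
    show "(f \<otimes>\<^bsub>S_p\<^esub> g) a = reduce_mod p (conv f g) a"
      using fs[OF finite_antidiagonal[of a], of "\<lambda>bc. f (fst bc) * g (snd bc)"]
      by (simp add: mpower_series_def R.res_mult_eq reduce_mod_def conv_def case_prod_beta)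
  qed
qed

lemma mvmono_carrier: "mvmono m \<in> carrier S_p"
  using p by (auto simp: carrier_S_p mvmono_def)

lemma cring_S_p: "cring (S_p :: (nat ^ 'v \<Rightarrow> int) ring)"
proof (rule cringI)
  show "abelian_group (S_p :: (nat ^ 'v \<Rightarrow> int) ring)"
  proof (rule abelian_groupI)
    fix x :: "nat ^ 'v \<Rightarrow> int" assume x: "x \<in> carrier S_p"
    show "\<exists>y\<in>carrier S_p. y \<oplus>\<^bsub>S_p\<^esub> x = \<zero>\<^bsub>S_p\<^esub>"
      by (rule bexI[of _ "reduce_mod p (\<lambda>a. - x a)"])
         (auto simp: add_S_p zero_S_p reduce_mod_def mod_simps reduce_carrier[unfolded reduce_mod_def])
  qed (use p in \<open>auto simp: add_S_p zero_S_p reduce_carrier reduce_id, auto simp: carrier_S_p reduce_mod_def mod_simps algebra_simps\<close>)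
  show "comm_monoid (S_p :: (nat ^ 'v \<Rightarrow> int) ring)"
  proof (rule comm_monoidI)
    fix x y z :: "nat ^ 'v \<Rightarrow> int"
    show "(x \<otimes>\<^bsub>S_p\<^esub> y) \<otimes>\<^bsub>S_p\<^esub> z = x \<otimes>\<^bsub>S_p\<^esub> (y \<otimes>\<^bsub>S_p\<^esub> z)"
      by (simp add: mult_S_p reduce_conv_left reduce_conv_right conv_assoc)
    show "x \<otimes>\<^bsub>S_p\<^esub> y = y \<otimes>\<^bsub>S_p\<^esub> x" by (simp add: mult_S_p conv_commute)
  qed (auto simp: mult_S_p one_S_p reduce_carrier mvmono_carrier conv_one reduce_id)
  show "(x \<oplus>\<^bsub>S_p\<^esub> y) \<otimes>\<^bsub>S_p\<^esub> z = x \<otimes>\<^bsub>S_p\<^esub> z \<oplus>\<^bsub>S_p\<^esub> y \<otimes>\<^bsub>S_p\<^esub> z"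
    for x y z :: "nat ^ 'v \<Rightarrow> int"
    by (auto simp: mult_S_p add_S_p reduce_conv_left conv_add_left) (auto simp: reduce_mod_def mod_simps)
qed

lemma pow_mono: "mvmono m [^]\<^bsub>S_p\<^esub> (n::nat) = mvmono (\<chi> v. n * m $ v)"
proof (induction n)
  case 0
  then show ?case by (simp add: one_S_p flip: zero_vec_def)
next
  case (Suc n)
  have "(\<chi> v. n * m $ v) + m = (\<chi> v. Suc n * m $ v)" by (auto simp: vec_eq_iff)
  then show ?case
    using Suc by (simp add: mult_S_p mvmono_add reduce_id[OF mvmono_carrier])
qed

end

section \<open>Length of a finite quotient\<close>

lemma subgroup_quot_module_iff:
  "subgroup H (add_monoid (quot_module S J)) \<longleftrightarrow> subgroup H (add_monoid (S Quot J))"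
  by (simp add: subgroup_def quot_module_def m_inv_def)

lemma submodule_quot_image:
  assumes "cring S" "ideal J S" "ideal I S"
  shows "submodule ((\<lambda>g. J +>\<^bsub>S\<^esub> g) ` I) S (quot_module S J)"
proof -
  interpret S: cring S by fact
  interpret J: ideal J S by fact
  interpret I: ideal I S by fact
  interpret h: ring_hom_ring S "S Quot J" "(+>\<^bsub>S\<^esub>) J" by (rule J.rcos_ring_hom_ring)
  have "subgroup ((+>\<^bsub>S\<^esub>) J ` I) (add_monoid (S Quot J))"
    using group_hom.subgroup_img_is_subgroup[OF h.a_group_hom I.a_subgroup] .
  then have "subgroup ((+>\<^bsub>S\<^esub>) J ` I) (add_monoid (quot_module S J))"
    by (simp only: subgroup_quot_module_iff)
  moreover have "r \<odot>\<^bsub>quot_module S J\<^esub> x \<in> (+>\<^bsub>S\<^esub>) J ` I" if "r \<in> carrier S" "x \<in> (+>\<^bsub>S\<^esub>) J ` I" for r x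
  proof -
    from that(2) obtain g where g: "g \<in> I" "x = J +>\<^bsub>S\<^esub> g" by auto
    have "r \<odot>\<^bsub>quot_module S J\<^esub> x = J +>\<^bsub>S\<^esub> (r \<otimes>\<^bsub>S\<^esub> g)"
      using g that(1) I.a_Hcarr[of g] by (simp add: quot_module_def)
    then show ?thesis using I.I_l_closed[OF g(1) that(1)] by blast
  qed
  ultimately show ?thesis by (simp add: submodule_def submodule_axioms_def)
qed

text \<open>By Lagrange every submodule has order a power of \<open>p\<close>, and along a strict
  chain the exponents increase strictly from at least \<open>0\<close> to at most
  \<open>L\<close>.\<close>

lemma strict_chain_length_le:
  assumes "cring S" "ideal J S" "prime p" "card (carrier (S Quot J)) = p ^ L"
    and N: "\<forall>i\<le>n. submodule (N i) S (quot_module S J)" "\<forall>i<n. N i \<subset> N (Suc i)"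
  shows "n \<le> L"
proof -
  interpret S: cring S by fact
  interpret J: ideal J S by fact
  interpret Q: ring "S Quot J" by (rule J.quotient_is_ring)
  have fin: "finite (carrier (S Quot J))"
    using assms(3,4) by (intro card_ge_0_finite) (simp add: prime_gt_0_nat)
  have sg: "subgroup (N i) (add_monoid (S Quot J))" if "i \<le> n" for i
    using N(1) that by (auto simp: submodule_def subgroup_quot_module_iff)
  have finN: "finite (N i)" if "i \<le> n" for i
    using subgroup.subset[OF sg[OF that]] fin by (auto intro: finite_subset)
  have "\<exists>k. card (N i) = p ^ k" if "i \<le> n" for i
  proof -
    have "card (N i) dvd p ^ L"
    proof -
      have "order (add_monoid (S Quot J)) = p ^ L" by (simp add: order_def assms(4))
      moreover have "card (rcosets\<^bsub>add_monoid (S Quot J)\<^esub> N i) * card (N i) = order (add_monoid (S Quot J))"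
        by (rule group.lagrange_finite[OF Q.a_group _ sg[OF that]]) (simp add: fin)
      ultimately have "p ^ L = card (N i) * card (rcosets\<^bsub>add_monoid (S Quot J)\<^esub> N i)"
        by (simp only: mult.commute)
      then show ?thesis by (rule dvdI)
    qed
    then show ?thesis unfolding divides_primepow_nat[OF assms(3)] by auto
  qed
  then obtain k where k: "\<And>i. i \<le> n \<Longrightarrow> card (N i) = p ^ k i" by metis
  have "i \<le> k i" if "i \<le> n" for i
    using that
  proof (induction i)
    case (Suc i)
    have "card (N i) < card (N (Suc i))"
      using N(2) Suc.prems finN by (intro psubset_card_mono) auto
    then have "k i < k (Suc i)"
      using k[of i] k[of "Suc i"] Suc.prems power_less_imp_less_exp[OF prime_gt_1_nat[OF assms(3)], of "k i" "k (Suc i)"]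
      by simp
    then show ?case using Suc by simp
  qed simp
  then have "n \<le> k n" by simp
  moreover have "p ^ k n \<le> p ^ L"
  proof -
    have "card (N n) \<le> card (carrier (S Quot J))"
      using subgroup.subset[OF sg[OF order_refl]] fin by (intro card_mono) auto
    then show ?thesis using k[of n] assms(4) by simp
  qed
  ultimately show ?thesis
    using power_le_imp_le_exp[OF prime_gt_1_nat[OF assms(3)], of "k n" L] by simp
qed

text \<open>The order of a quotient bounds lengths only from above: a long chain has to be
  exhibited. It comes from a filtration by ideals whose successive images grow by a factor of at
  most \<open>p\<close>.\<close>

lemma module_length_quot_eq:
  assumes S: "cring S" and J: "ideal J S" and p: "prime p" and card: "card (carrier (S Quot J)) = p ^ L"
    and I: "\<And>c. ideal (I c) S" and I0: "I 0 \<subseteq> J" and IN: "I N = carrier S"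
    and mono: "\<And>c. I c \<subseteq> I (Suc c)"
    and step: "\<And>c. c < N \<Longrightarrow> \<exists>X. finite X \<and> card X \<le> p \<and> X \<subseteq> carrier S \<and>
      (\<forall>g\<in>I (Suc c). \<exists>s\<in>X. \<exists>g'\<in>I c. g = s \<oplus>\<^bsub>S\<^esub> g')"
  shows "module_length S (quot_module S J) = enat L"
proof -
  interpret S: cring S by fact
  interpret J: ideal J S by fact
  define D where "D c = (\<lambda>g. J +>\<^bsub>S\<^esub> g) ` I c" for c
  have subm: "submodule (D c) S (quot_module S J)" for c
    unfolding D_def by (rule submodule_quot_image[OF S J I])
  have fin: "finite (carrier (S Quot J))"
    using p card by (intro card_ge_0_finite) (simp add: prime_gt_0_nat)
  have Icarr: "g \<in> carrier S" if "g \<in> I c" for g c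
    using I[of c] that by (simp add: ideal.Icarr)
  have finD: "finite (D c)" for c
    unfolding D_def by (rule finite_subset[OF _ fin])
      (auto simp: FactRing_simps intro!: Icarr)
  have cardD: "card (D (Suc c)) \<le> p * card (D c)" if c: "c < N" for c
  proof -
    obtain X where X: "finite X" "card X \<le> p" "X \<subseteq> carrier S"
      "\<forall>g\<in>I (Suc c). \<exists>s\<in>X. \<exists>g'\<in>I c. g = s \<oplus>\<^bsub>S\<^esub> g'" using step[OF c] by auto
    have "D (Suc c) \<subseteq> (\<lambda>(s, B). (J +>\<^bsub>S\<^esub> s) <+>\<^bsub>S\<^esub> B) ` (X \<times> D c)"
    proof
      fix A assume "A \<in> D (Suc c)"
      then obtain g where g: "g \<in> I (Suc c)" "A = J +>\<^bsub>S\<^esub> g" by (auto simp: D_def)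
      then obtain s g' where sg: "s \<in> X" "g' \<in> I c" "g = s \<oplus>\<^bsub>S\<^esub> g'" using X(4) by blast
      then have "A = (J +>\<^bsub>S\<^esub> s) <+>\<^bsub>S\<^esub> (J +>\<^bsub>S\<^esub> g')"
        using g(2) X(3) Icarr[of g' c] J.a_rcos_sum[of s g'] by auto
      then show "A \<in> (\<lambda>(s, B). (J +>\<^bsub>S\<^esub> s) <+>\<^bsub>S\<^esub> B) ` (X \<times> D c)"
        using sg by (auto simp: D_def)
    qed
    then have "card (D (Suc c)) \<le> card ((\<lambda>(s, B). (J +>\<^bsub>S\<^esub> s) <+>\<^bsub>S\<^esub> B) ` (X \<times> D c))"
      by (rule card_mono[rotated]) (use X(1) finD in simp)
    also have "\<dots> \<le> card (X \<times> D c)" by (rule card_image_le) (use X(1) finD in simp)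
    also have "\<dots> \<le> p * card (D c)" using X(2) by (simp add: card_cartesian_product)
    finally show ?thesis .
  qed
  \<comment> \<open>Neighbouring images may coincide. Repetitions are dropped, and \<open>n\<close>
    counts the strict inclusions, each of which accounts for one factor \<open>p\<close>.\<close>
  have "\<exists>n M. M n = D c \<and> (\<forall>i\<le>n. submodule (M i) S (quot_module S J)) \<and> (\<forall>i<n. M i \<subset> M (Suc i))
      \<and> card (D c) \<le> p ^ n" if "c \<le> N" for c
    using that
  proof (induction c)
    case 0
    have "D 0 = {J}"
    proof -
      have "J +>\<^bsub>S\<^esub> g = J" if "g \<in> I 0" for g
        using that I0 by (intro J.a_rcos_const) auto
      moreover have "I 0 \<noteq> {}" using additive_subgroup.zero_closed ideal.axioms(1)[OF I[of 0]] by fastforce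
      ultimately show ?thesis by (auto simp: D_def)
    qed
    then show ?case using subm[of 0] by (intro exI[of _ 0] exI[of _ "\<lambda>_. D 0"]) simp
  next
    case (Suc c)
    then obtain n M where M: "M n = D c" "\<forall>i\<le>n. submodule (M i) S (quot_module S J)"
      "\<forall>i<n. M i \<subset> M (Suc i)" "card (D c) \<le> p ^ n" by auto
    show ?case
    proof (cases "D (Suc c) = D c")
      case True
      then show ?thesis using M by auto
    next
      case False
      moreover have "D c \<subseteq> D (Suc c)" using mono by (auto simp: D_def)
      ultimately have "D c \<subset> D (Suc c)" by auto
      moreover have "card (D (Suc c)) \<le> p ^ Suc n"
        using le_trans[OF cardD[of c] mult_le_mono2[OF M(4)]] Suc.prems by simp
      ultimately show ?thesis
        using M subm[of "Suc c"]
        by (intro exI[of _ "Suc n"] exI[of _ "\<lambda>i. if i \<le> n then M i else D (Suc c)"])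
           (auto simp: le_Suc_eq less_Suc_eq)
    qed
  qed
  from this[OF order_refl] obtain n M where M: "M n = D N"
    "\<forall>i\<le>n. submodule (M i) S (quot_module S J)" "\<forall>i<n. M i \<subset> M (Suc i)" "card (D N) \<le> p ^ n" by auto
  have "D N = carrier (S Quot J)" by (auto simp: D_def IN FactRing_simps)
  then have "p ^ L \<le> p ^ n" using M(4) card by simp
  then have Ln: "L \<le> n" by (rule power_le_imp_le_exp[OF prime_gt_1_nat[OF p]])
  have le: "m \<le> L" if "\<forall>i\<le>m. submodule (M' i) S (quot_module S J)" "\<forall>i<m. M' i \<subset> M' (Suc i)" for m M'
    using strict_chain_length_le[OF S J p card that] .
  have "n = L" using le[OF M(2,3)] Ln by simp
  show ?thesis
    unfolding module_length_def
  proof (rule antisym)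
    show "Sup {enat n |n. \<exists>N. (\<forall>i\<le>n. submodule (N i) S (quot_module S J)) \<and> (\<forall>i<n. N i \<subset> N (Suc i))} \<le> enat L"
      by (rule Sup_least) (use le in auto)
    show "enat L \<le> Sup {enat n |n. \<exists>N. (\<forall>i\<le>n. submodule (N i) S (quot_module S J)) \<and> (\<forall>i<n. N i \<subset> N (Suc i))}"
      by (rule Sup_upper) (use M \<open>n = L\<close> in auto)
  qed
qed

section \<open>From the quotient ring to the inverse system\<close>

abbreviation vec3 :: "nat \<Rightarrow> nat \<Rightarrow> nat \<Rightarrow> nat ^ 3" where
  "vec3 i j k \<equiv> vector [i, j, k]"

lemma vec3_eta: "vec3 (a $ 1) (a $ 2) (a $ 3) = a"
  by (simp add: vec_eq_iff forall_3)

text \<open>The surface singularity of type \<open>E_7\<close>, as a sum of monomials over the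
  integers.\<close>

definition e7 :: "nat ^ 3 \<Rightarrow> int" where
  "e7 a = mvmono (vec3 2 0 0) a + (mvmono (vec3 0 3 0) a + mvmono (vec3 0 1 3) a)"

lemma carrier_quot: "carrier (R Quot J) = (\<lambda>g. J +>\<^bsub>R\<^esub> g) ` carrier R"
  by (auto simp: FactRing_simps)

text \<open>The box part of a power series, with reversed exponents: this identifies
  \<open>k[x,y,z]/(x\<^sup>q, y\<^sup>q, z\<^sup>q)\<close> with its inverse system.\<close>

definition rev_box :: "nat \<Rightarrow> nat \<Rightarrow> (nat ^ 3 \<Rightarrow> int) \<Rightarrow> nat \<Rightarrow> nat \<Rightarrow> nat \<Rightarrow> residue_product" where
  "rev_box p q g = (\<lambda>i j k. if i < q \<and> j < q \<and> k < q
     then residue_at p (g (vec3 (q - 1 - i) (q - 1 - j) (q - 1 - k))) else 0)"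

lemma rev_box_add: "rev_box p q (\<lambda>a. f a + g a) = rev_box p q f + rev_box p q g"
  by (auto simp: rev_box_def fun_eq_iff Modules.additive.add[OF additive_residue_at])

lemma rev_box_reduce: "rev_box p q (reduce_mod p g) = rev_box p q g"
  by (auto simp: rev_box_def fun_eq_iff reduce_mod_def residue_at_eq_iff cong_def)

text \<open>With reversed exponents, multiplying by a monomial means reading at a larger index;
  indices beyond the box read \<open>0\<close>, in accordance with
  \<open>x^q = y^q = z^q = 0\<close>.\<close>

lemma rev_box_conv_mono:
  "rev_box p q (conv (mvmono (vec3 a b c)) g) i j k = rev_box p q g (i + a) (j + b) (k + c)"
proof (cases "i + a < q \<and> j + b < q \<and> k + c < q")
  case True
  have "vec3 (q - 1 - i) (q - 1 - j) (q - 1 - k) - vec3 a b c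
      = vec3 (q - 1 - (i + a)) (q - 1 - (j + b)) (q - 1 - (k + c))"
    by (simp add: vec_eq_iff forall_3)
  moreover have "i < q" "j < q" "k < q" "a \<le> q - 1 - i" "b \<le> q - 1 - j" "c \<le> q - 1 - k"
    using True by auto
  ultimately show ?thesis using True by (simp add: rev_box_def conv_mono forall_3 del: diff_diff_left)
next
  case False
  then have "\<not> (i < q \<and> j < q \<and> k < q \<and> a \<le> q - 1 - i \<and> b \<le> q - 1 - j \<and> c \<le> q - 1 - k)" by linarith
  then show ?thesis using False
    by (auto simp: rev_box_def conv_mono forall_3 Modules.additive.zero[OF additive_residue_at])
qed

lemma rev_box_conv_e7: "rev_box p q (conv e7 g) = lop 2 mult_yz (rev_box p q g)"
  unfolding e7_def[abs_def] conv_add_left rev_box_add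
  by (simp add: fun_eq_iff rev_box_conv_mono lop_def mult_yz_apply)

lemma rev_box_mem: "rev_box p q g \<in> box3 p q"
  using add_subgroup_zero[OF add_subgroup_prime_field] by (auto simp: mem_box3_iff rev_box_def prime_field_def)

lemma rev_box_eq_0_iff:
  "rev_box p q g = 0 \<longleftrightarrow> (\<forall>a. (\<forall>v. a $ v < q) \<longrightarrow> int p dvd g a)"
proof
  assume R: "rev_box p q g = 0"
  show "\<forall>a. (\<forall>v. a $ v < q) \<longrightarrow> int p dvd g a"
  proof (intro allI impI)
    fix a :: "nat ^ 3" assume a: "\<forall>v. a $ v < q"
    have "rev_box p q g (q - 1 - a $ 1) (q - 1 - a $ 2) (q - 1 - a $ 3) = 0" using R by simp
    moreover have "q - 1 - (q - 1 - a $ v) = a $ v" "q - 1 - a $ v < q" for v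
      using a[rule_format, of v] by auto
    ultimately show "int p dvd g a"
      by (simp add: rev_box_def residue_at_eq_0_iff vec3_eta del: diff_diff_left)
  qed
qed (auto simp: rev_box_def fun_eq_iff residue_at_eq_0_iff forall_3)

context
  fixes p q :: nat
  assumes prime: "prime p"
begin

private abbreviation S :: "(nat ^ 3 \<Rightarrow> int) ring" where
  "S \<equiv> mpower_series (residue_ring (int p))"

private lemma p1: "p > 1" using prime by (rule prime_gt_1_nat)

interpretation S: cring S by (rule cring_S_p[OF p1])

lemma e7_carrier: "reduce_mod p e7 \<in> carrier S"
  by (rule reduce_carrier[OF p1])

lemma rev_box_mult_e7:
  "rev_box p q (reduce_mod p e7 \<otimes>\<^bsub>S\<^esub> g) = lop 2 mult_yz (rev_box p q g)"
  by (simp add: mult_S_p[OF p1] rev_box_reduce reduce_conv_left rev_box_conv_e7)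

lemma rev_box_pow_e7:
  assumes "g \<in> carrier S"
  shows "rev_box p q (reduce_mod p e7 [^]\<^bsub>S\<^esub> (n::nat) \<otimes>\<^bsub>S\<^esub> g) = (lop 2 mult_yz ^^ n) (rev_box p q g)"
  using assms
proof (induction n arbitrary: g)
  case (Suc n)
  have "reduce_mod p e7 [^]\<^bsub>S\<^esub> Suc n \<otimes>\<^bsub>S\<^esub> g = reduce_mod p e7 [^]\<^bsub>S\<^esub> n \<otimes>\<^bsub>S\<^esub> (reduce_mod p e7 \<otimes>\<^bsub>S\<^esub> g)"
    using Suc.prems e7_carrier by (simp add: S.m_assoc)
  then show ?case
    using Suc.IH[of "reduce_mod p e7 \<otimes>\<^bsub>S\<^esub> g"] Suc.prems e7_carrier
    by (simp only: S.m_closed rev_box_mult_e7 funpow_Suc_right o_apply)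
qed simp

lemma rev_box_S_add: "rev_box p q (g \<oplus>\<^bsub>S\<^esub> h) = rev_box p q g + rev_box p q h"
  by (simp add: add_S_p[OF p1] rev_box_reduce rev_box_add)

lemma rev_box_S_zero: "rev_box p q \<zero>\<^bsub>S\<^esub> = 0"
  by (auto simp: zero_S_p[OF p1] rev_box_eq_0_iff)

lemma rev_box_S_minus:
  assumes "g \<in> carrier S" "h \<in> carrier S"
  shows "rev_box p q (g \<ominus>\<^bsub>S\<^esub> h) = rev_box p q g - rev_box p q h"
proof -
  have "rev_box p q ((g \<ominus>\<^bsub>S\<^esub> h) \<oplus>\<^bsub>S\<^esub> h) = rev_box p q g"
    using assms by (simp add: S.minus_eq S.a_assoc S.l_neg)
  then show ?thesis unfolding rev_box_S_add by (simp add: eq_diff_eq)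
qed

text \<open>The exponents in the box are closed under passing to smaller ones, so the box part of a
  product involves only box coefficients of each factor.\<close>

lemma rev_box_mult_0:
  assumes "rev_box p q g = 0" shows "rev_box p q (r \<otimes>\<^bsub>S\<^esub> g) = 0"
proof -
  have "int p dvd conv r g a" if "\<forall>v. a $ v < q" for a
    unfolding conv_def
  proof (rule dvd_sum)
    fix x assume "x \<in> {(b, c). b + c = a}"
    then obtain b c where x: "x = (b, c)" "b + c = a" by auto
    then have "\<forall>v. c $ v < q" using that vec_add_eqD le_less_trans by metis
    then have "int p dvd g c" using assms by (auto simp: rev_box_eq_0_iff)
    then show "int p dvd (case x of (b, c) \<Rightarrow> r b * g c)" by (simp add: x)
  qed
  then show ?thesis by (simp add: mult_S_p[OF p1] rev_box_reduce) (simp add: rev_box_eq_0_iff)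
qed

lemma rev_box_onto:
  assumes "e \<in> box3 p q" obtains g where "g \<in> carrier S" "rev_box p q g = e"
proof -
  have "\<forall>v\<in>prime_field p. \<exists>k. 0 \<le> k \<and> k < int p \<and> residue_at p k = v"
    unfolding prime_field_eq[OF p_pos[OF prime]] by auto
  then obtain d where d: "\<And>v. v \<in> prime_field p \<Longrightarrow> 0 \<le> d v \<and> d v < int p \<and> residue_at p (d v) = v" by metis
  define g where "g a = d (e (q - 1 - a $ 1) (q - 1 - a $ 2) (q - 1 - a $ 3))" for a :: "nat ^ 3"
  have e: "e i j k \<in> prime_field p" for i j k using assms by (simp add: mem_box3_iff)
  have "g \<in> carrier S" using d[OF e] by (simp add: carrier_S_p[OF p1] g_def)
  moreover have "rev_box p q g = e"
  proof (intro ext)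
    fix i j k
    show "rev_box p q g i j k = e i j k"
    proof (cases "i < q \<and> j < q \<and> k < q")
      case True
      then have "q - 1 - (q - 1 - i) = i" "q - 1 - (q - 1 - j) = j" "q - 1 - (q - 1 - k) = k" by auto
      then show ?thesis using True d[OF e] by (simp add: rev_box_def g_def del: diff_diff_left)
    next
      case False
      then show ?thesis using assms by (auto simp: rev_box_def mem_box3_iff)
    qed
  qed
  ultimately show ?thesis using that by blast
qed

lemma h_ideal_e7:
  assumes q: "q \<ge> 1"
  shows "h_ideal (residue_ring (int p)) (reduce_mod p e7) t q =
      {g \<in> carrier S. rev_box p q g \<in> (lop 2 mult_yz ^^ nat \<lceil>t * real q\<rceil>) ` box3 p q}" (is "?J = ?I")
    and "ideal (h_ideal (residue_ring (int p)) (reduce_mod p e7) t q) S"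
proof -
  define n where "n = nat \<lceil>t * real q\<rceil>"
  define F where "F = (lop 2 mult_yz ^^ n)"
  have addF: "Modules.additive F" unfolding F_def by (rule torsion_space.additive_L[OF torsion_space2[OF prime]])
  have subW: "add_subgroup (F ` box3 p q)" by (rule add_subgroup_image[OF sub3[OF prime] addF])
  define fn where "fn = reduce_mod p e7 [^]\<^bsub>S\<^esub> n"
  have fn: "fn \<in> carrier S" unfolding fn_def using e7_carrier by simp
  define xq where "xq v = mvar (residue_ring (int p)) v [^]\<^bsub>S\<^esub> q" for v :: 3
  have xq: "xq v = mvmono (\<chi> w. if w = v then q else 0)" for v
    by (simp add: xq_def mvar_S_p[OF p1] pow_mono[OF p1] axis_def if_distrib cong: if_cong)
  have xqc: "xq v \<in> carrier S" for v unfolding xq by (rule mvmono_carrier[OF p1])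
  have J: "?J = Idl\<^bsub>S\<^esub> (insert fn (range xq))"
    by (simp add: h_ideal_def Let_def fn_def n_def xq_def[abs_def])
  have gens: "insert fn (range xq) \<subseteq> carrier S" using fn xqc by auto
  show idJ: "ideal ?J S" unfolding J by (rule S.genideal_ideal[OF gens])
  interpret J: ideal ?J S by (rule idJ)
  have genJ: "insert fn (range xq) \<subseteq> ?J" unfolding J by (rule S.genideal_self[OF gens])
  have I: "?I = {g \<in> carrier S. rev_box p q g \<in> F ` box3 p q}" by (simp add: F_def n_def)
  have memI: "g \<in> ?I \<longleftrightarrow> g \<in> carrier S \<and> (\<exists>r\<in>carrier S. rev_box p q g = rev_box p q (fn \<otimes>\<^bsub>S\<^esub> r))" for g
  proof -
    have "rev_box p q g \<in> F ` box3 p q \<longleftrightarrow> (\<exists>r\<in>carrier S. rev_box p q g = F (rev_box p q r))"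
    proof
      assume "rev_box p q g \<in> F ` box3 p q"
      then obtain e where e: "e \<in> box3 p q" "rev_box p q g = F e" by auto
      obtain r where "r \<in> carrier S" "rev_box p q r = e" using rev_box_onto[OF e(1)] .
      then show "\<exists>r\<in>carrier S. rev_box p q g = F (rev_box p q r)" using e(2) by auto
    qed (auto intro: rev_box_mem)
    then show ?thesis unfolding I fn_def F_def using rev_box_pow_e7 by auto
  qed
  have idI: "ideal ?I S"
  proof (rule idealI[OF S.ring_axioms])
    show "subgroup ?I (add_monoid S)"
      unfolding I
    proof (rule S.add.subgroupI)
      show "{g \<in> carrier S. rev_box p q g \<in> F ` box3 p q} \<noteq> {}"
        using add_subgroup_zero[OF subW] rev_box_S_zero S.zero_closed by (intro notI) auto
    next
      fix a assume a: "a \<in> {g \<in> carrier S. rev_box p q g \<in> F ` box3 p q}"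
      have "rev_box p q (\<ominus>\<^bsub>S\<^esub> a) = - rev_box p q a"
        using a rev_box_S_minus[of "\<zero>\<^bsub>S\<^esub>" a] by (simp add: S.minus_eq rev_box_S_zero)
      then show "\<ominus>\<^bsub>S\<^esub> a \<in> {g \<in> carrier S. rev_box p q g \<in> F ` box3 p q}"
        using a add_subgroup_minus[OF subW] by auto
    qed (use add_subgroup_add[OF subW] in \<open>auto simp: rev_box_S_add\<close>)
    show l: "x \<otimes>\<^bsub>S\<^esub> a \<in> ?I" if "a \<in> ?I" "x \<in> carrier S" for a x
    proof -
      from that(1) obtain r where r: "a \<in> carrier S" "r \<in> carrier S"
        "rev_box p q a = rev_box p q (fn \<otimes>\<^bsub>S\<^esub> r)" using memI by auto
      have "rev_box p q (a \<ominus>\<^bsub>S\<^esub> fn \<otimes>\<^bsub>S\<^esub> r) = 0" using r fn by (simp add: rev_box_S_minus)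
      then have "rev_box p q (x \<otimes>\<^bsub>S\<^esub> (a \<ominus>\<^bsub>S\<^esub> fn \<otimes>\<^bsub>S\<^esub> r)) = 0" by (rule rev_box_mult_0)
      \<comment> \<open>Thus \<open>x a\<close> and the multiple \<open>f^n (x r)\<close> have the
        same box part.\<close>
      moreover have "x \<otimes>\<^bsub>S\<^esub> (a \<ominus>\<^bsub>S\<^esub> fn \<otimes>\<^bsub>S\<^esub> r) = x \<otimes>\<^bsub>S\<^esub> a \<ominus>\<^bsub>S\<^esub> fn \<otimes>\<^bsub>S\<^esub> (x \<otimes>\<^bsub>S\<^esub> r)"
        using r fn that(2) by algebra
      ultimately have "rev_box p q (x \<otimes>\<^bsub>S\<^esub> a) = rev_box p q (fn \<otimes>\<^bsub>S\<^esub> (x \<otimes>\<^bsub>S\<^esub> r))"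
        using r fn that(2) by (simp add: rev_box_S_minus)
      then show ?thesis using r that(2) memI by auto
    qed
    show "a \<otimes>\<^bsub>S\<^esub> x \<in> ?I" if "a \<in> ?I" "x \<in> carrier S" for a x
    proof -
      have "a \<in> carrier S" using that(1) by simp
      then show ?thesis using l[OF that] that(2) by (simp add: S.m_comm)
    qed
  qed
  show "?J = ?I"
  proof
    have "rev_box p q fn = rev_box p q (fn \<otimes>\<^bsub>S\<^esub> \<one>\<^bsub>S\<^esub>)" using fn by simp
    then have "fn \<in> ?I" unfolding memI using fn S.one_closed by blast
    moreover have "xq v \<in> ?I" for v
    proof -
      have "rev_box p q (xq v) = 0"
        unfolding rev_box_eq_0_iff xq mvmono_def by auto
      then show ?thesis unfolding I using xqc add_subgroup_zero[OF subW] by simp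
    qed
    ultimately show "?J \<subseteq> ?I" unfolding J by (intro S.genideal_minimal[OF idI]) auto
  next
    show "?I \<subseteq> ?J"
    proof
      fix g assume "g \<in> ?I"
      then obtain r where r: "g \<in> carrier S" "r \<in> carrier S" "rev_box p q g = rev_box p q (fn \<otimes>\<^bsub>S\<^esub> r)"
        using memI by auto
      define d where "d = g \<ominus>\<^bsub>S\<^esub> fn \<otimes>\<^bsub>S\<^esub> r"
      have d: "d \<in> carrier S" using r fn by (simp add: d_def)
      have "rev_box p q d = 0" using r fn by (simp add: d_def rev_box_S_minus)
      then have d0: "d a = 0" if "\<forall>v. a $ v < q" for a
        using d that by (auto simp: rev_box_eq_0_iff carrier_S_p[OF p1] dest: zdvd_not_zless intro: ccontr)
          (metis order_le_less zdvd_not_zless)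
      define e where "e v = (\<chi> w. if w = v then q else 0)" for v :: 3
      \<comment> \<open>A series without box part is a combination of the \<open>q\<close>-th powers
        of the variables: every term is charged to the first variable whose exponent reaches
        \<open>q\<close>.\<close>
      define d1 where "d1 a = d (a + e 1)" for a
      define d2 where "d2 a = (if a $ 1 < q then d (a + e 2) else 0)" for a
      define d3 where "d3 a = (if a $ 1 < q \<and> a $ 2 < q then d (a + e 3) else 0)" for a
      have dc: "d1 \<in> carrier S" "d2 \<in> carrier S" "d3 \<in> carrier S"
        using d p1 by (auto simp: carrier_S_p[OF p1] d1_def d2_def d3_def)
      have "d = reduce_mod p (\<lambda>a. conv (xq 1) d1 a + (conv (xq 2) d2 a + conv (xq 3) d3 a))"
      proof
        fix a
        have ge: "(\<forall>w. e v $ w \<le> a $ w) \<longleftrightarrow> q \<le> a $ v" for v by (auto simp: e_def)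
        have sub_add: "a - e v + e v = a" if "q \<le> a $ v" for v using that by (auto simp: vec_eq_iff e_def)
        have comp: "(a - e 2) $ 1 = a $ 1" "(a - e 3) $ 1 = a $ 1" "(a - e 3) $ 2 = a $ 2"
          by (simp_all add: e_def)
        have "conv (xq 1) d1 a + (conv (xq 2) d2 a + conv (xq 3) d3 a) = d a"
          using d0[of a] unfolding xq e_def[symmetric] conv_mono ge d1_def d2_def d3_def comp
          by (auto simp: sub_add forall_3 not_less)
        moreover have "d a mod int p = d a" using d by (simp add: carrier_S_p[OF p1])
        ultimately show "d a = reduce_mod p (\<lambda>a. conv (xq 1) d1 a + (conv (xq 2) d2 a + conv (xq 3) d3 a)) a"
          by (simp add: reduce_mod_def)
      qed
      also have "\<dots> = xq 1 \<otimes>\<^bsub>S\<^esub> d1 \<oplus>\<^bsub>S\<^esub> (xq 2 \<otimes>\<^bsub>S\<^esub> d2 \<oplus>\<^bsub>S\<^esub> xq 3 \<otimes>\<^bsub>S\<^esub> d3)"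
        unfolding add_S_p[OF p1] mult_S_p[OF p1] by (simp add: reduce_mod_def mod_simps)
      finally have "d \<in> ?J" using genJ dc by (auto intro!: J.a_closed J.I_r_closed)
      moreover have "fn \<otimes>\<^bsub>S\<^esub> r \<in> ?J" using genJ r by (auto intro!: J.I_r_closed)
      moreover have "g = d \<oplus>\<^bsub>S\<^esub> fn \<otimes>\<^bsub>S\<^esub> r" using r fn unfolding d_def by algebra
      ultimately show "g \<in> ?J" using J.a_closed by metis
    qed
  qed
qed

text \<open>The order of the box factors in two ways over the image of \<open>f^n\<close>: with the
  cosets of the ideal, which are the cokernel, and with the kernel. Cancelling the image equates the
  two.\<close>

lemma card_quot_e7:
  fixes t :: real
  assumes q: "q \<ge> 1"
  defines "J \<equiv> h_ideal (residue_ring (int p)) (reduce_mod p e7) t q"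
  shows "card (carrier (S Quot J)) = card (K p q (nat \<lceil>t * real q\<rceil>))"
proof -
  define n where "n = nat \<lceil>t * real q\<rceil>"
  define F where "F = (lop 2 mult_yz ^^ n)"
  have addF: "Modules.additive F" unfolding F_def by (rule torsion_space.additive_L[OF torsion_space2[OF prime]])
  have subW: "add_subgroup (F ` box3 p q)" by (rule add_subgroup_image[OF sub3[OF prime] addF])
  have J: "J = {g \<in> carrier S. rev_box p q g \<in> F ` box3 p q}"
    unfolding J_def F_def n_def by (rule h_ideal_e7(1)[OF q])
  interpret J: ideal J S unfolding J_def by (rule h_ideal_e7(2)[OF q])
  have "\<forall>e\<in>box3 p q. \<exists>g. g \<in> carrier S \<and> rev_box p q g = e"
    using rev_box_onto by blast
  then obtain \<sigma> where "\<forall>e\<in>box3 p q. \<sigma> e \<in> carrier S \<and> rev_box p q (\<sigma> e) = e"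
    using bchoice[of "box3 p q" "\<lambda>e g. g \<in> carrier S \<and> rev_box p q g = e"] by blast
  then have \<sigma>: "\<And>e. e \<in> box3 p q \<Longrightarrow> \<sigma> e \<in> carrier S \<and> rev_box p q (\<sigma> e) = e" by blast
  have same: "J +>\<^bsub>S\<^esub> g = J +>\<^bsub>S\<^esub> h \<longleftrightarrow> rev_box p q g - rev_box p q h \<in> F ` box3 p q"
    if "g \<in> carrier S" "h \<in> carrier S" for g h
  proof -
    have "J +>\<^bsub>S\<^esub> g = J +>\<^bsub>S\<^esub> h \<longleftrightarrow> g \<in> J +>\<^bsub>S\<^esub> h"
    proof
      assume "J +>\<^bsub>S\<^esub> g = J +>\<^bsub>S\<^esub> h"
      then show "g \<in> J +>\<^bsub>S\<^esub> h" using J.a_rcos_self[OF that(1)] by simp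
    next
      assume "g \<in> J +>\<^bsub>S\<^esub> h"
      then show "J +>\<^bsub>S\<^esub> g = J +>\<^bsub>S\<^esub> h" using J.a_repr_independence'[of g h] that by simp
    qed
    also have "\<dots> \<longleftrightarrow> g \<ominus>\<^bsub>S\<^esub> h \<in> J" by (rule J.a_rcos_module_minus[OF S.ring_axioms that(2,1)])
    also have "\<dots> \<longleftrightarrow> rev_box p q g - rev_box p q h \<in> F ` box3 p q"
    proof -
      have "g \<ominus>\<^bsub>S\<^esub> h \<in> carrier S" using that by (rule S.minus_closed)
      then show ?thesis unfolding J mem_Collect_eq rev_box_S_minus[OF that] by blast
    qed
    finally show ?thesis .
  qed
  define \<kappa> where "\<kappa> e = J +>\<^bsub>S\<^esub> \<sigma> e" for e
  have \<kappa>_eq: "\<kappa> e = \<kappa> e' \<longleftrightarrow> e - e' \<in> F ` box3 p q" if "e \<in> box3 p q" "e' \<in> box3 p q" for e e'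
  proof -
    have "\<sigma> e \<in> carrier S" "rev_box p q (\<sigma> e) = e" "\<sigma> e' \<in> carrier S" "rev_box p q (\<sigma> e') = e'"
      using \<sigma> that by blast+
    then show ?thesis unfolding \<kappa>_def using same[of "\<sigma> e" "\<sigma> e'"] by simp
  qed
  have onto: "\<kappa> ` box3 p q = carrier (S Quot J)"
  proof (intro equalityI subsetI)
    fix A assume "A \<in> carrier (S Quot J)"
    then obtain g where g: "g \<in> carrier S" "A = J +>\<^bsub>S\<^esub> g" unfolding carrier_quot by blast
    define e where "e = rev_box p q g"
    have e: "\<sigma> e \<in> carrier S" "rev_box p q (\<sigma> e) = e" using \<sigma> rev_box_mem unfolding e_def by blast+
    have "A = \<kappa> e"
      unfolding \<kappa>_def g(2) same[OF g(1) e(1)] e(2) using add_subgroup_zero[OF subW] by (simp add: e_def)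
    then show "A \<in> \<kappa> ` box3 p q" using rev_box_mem unfolding e_def by blast
  next
    fix A assume "A \<in> \<kappa> ` box3 p q"
    then obtain e where "e \<in> box3 p q" "A = J +>\<^bsub>S\<^esub> \<sigma> e" unfolding \<kappa>_def by blast
    moreover from this have "\<sigma> e \<in> carrier S" using \<sigma> by blast
    ultimately show "A \<in> carrier (S Quot J)" unfolding carrier_quot by blast
  qed
  have FW: "F ` box3 p q \<subseteq> box3 p q" unfolding F_def using funpow_mult_box3[OF prime] by auto
  have "card (box3 p q) = card (F ` box3 p q) * card (\<kappa> ` box3 p q)"
  proof (rule card_fibres_const[OF fin3[OF prime]])
    fix A assume "A \<in> \<kappa> ` box3 p q"
    then obtain e where e: "e \<in> box3 p q" "A = \<kappa> e" by auto
    have "bij_betw (\<lambda>w. w + e) (F ` box3 p q) {x \<in> box3 p q. \<kappa> x = A}"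
    proof (rule bij_betw_byWitness[where f' = "\<lambda>x. x - e"])
      show "(\<lambda>w. w + e) ` (F ` box3 p q) \<subseteq> {x \<in> box3 p q. \<kappa> x = A}"
      proof
        fix x assume "x \<in> (\<lambda>w. w + e) ` (F ` box3 p q)"
        then obtain w where w: "w \<in> F ` box3 p q" "x = w + e" by blast
        have "x \<in> box3 p q" unfolding w(2) using w(1) FW e(1) add_subgroup_add[OF sub3[OF prime]] by blast
        then show "x \<in> {x \<in> box3 p q. \<kappa> x = A}" using \<kappa>_eq[OF _ e(1), of x] w e(2) by simp
      qed
      show "(\<lambda>x. x - e) ` {x \<in> box3 p q. \<kappa> x = A} \<subseteq> F ` box3 p q"
        using \<kappa>_eq[OF _ e(1)] e(2) by blast
    qed simp_all
    then show "card {x \<in> box3 p q. \<kappa> x = A} = card (F ` box3 p q)" by (rule bij_betw_same_card[symmetric])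
  qed
  moreover have "card (box3 p q) = card (K p q n) * card (F ` box3 p q)"
    using card_kernel_image[OF sub3[OF prime] fin3[OF prime] addF] by (simp add: K_def F_def)
  moreover have "card (F ` box3 p q) > 0"
    using card_subgroup_pos[OF subW] fin3[OF prime] by simp
  ultimately show ?thesis unfolding onto n_def by simp
qed

lemma card_K_power: obtains L where "card (K p q n) = p ^ L"
proof -
  have "card (box3 p q) = card (K p q n) * card ((lop 2 mult_yz ^^ n) ` box3 p q)"
    using card_kernel_image[OF sub3[OF prime] fin3[OF prime] torsion_space.additive_L[OF torsion_space2[OF prime]]]
    by (simp add: K_def)
  then have "card (K p q n) dvd p ^ (q * q * q)" using card3[OF prime, of q] by (metis dvd_triv_left)
  then show ?thesis using that unfolding divides_primepow_nat[OF prime] by auto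
qed

text \<open>Vanishing below a position of the box, in an ordering of the monomials that is compatible with
  multiplication, is an ideal condition; consecutive ideals have quotient of order at most \<open>p\<close>.\<close>

private definition code :: "nat ^ 3 \<Rightarrow> nat" where
  "code a = a $ 1 + q * (a $ 2 + q * a $ 3)"

private definition low :: "nat \<Rightarrow> (nat ^ 3 \<Rightarrow> int) set" where
  "low c = {g \<in> carrier S. \<forall>a. (\<forall>v. a $ v < q) \<and> code a + c < q * q * q \<longrightarrow> g a = 0}"

private lemma code_inj:
  assumes "\<forall>v. a $ v < q" "\<forall>v. b $ v < q" "code a = code b" shows "a = b"
proof -
  have digits: "x mod q = x" "(x + q * y) mod q = x" "(x + q * y) div q = y" if "x < q" for x y
    using that by auto
  have 1: "code c mod q = c $ 1" and 2: "code c div q mod q = c $ 2" and 3: "code c div q div q = c $ 3"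
    if "\<forall>v. c $ v < q" for c
    using that by (auto simp: code_def digits)
  show ?thesis
    using 1[OF assms(1)] 1[OF assms(2)] 2[OF assms(1)] 2[OF assms(2)] 3[OF assms(1)] 3[OF assms(2)] assms(3)
    by (simp add: vec_eq_iff forall_3)
qed

private lemma code_less:
  assumes "\<forall>v. a $ v < q" shows "code a < q * q * q"
proof -
  have "a $ 2 + q * a $ 3 < q * q"
  proof -
    have "a $ 2 + q * a $ 3 < q * Suc (a $ 3)" using assms by simp
    also have "\<dots> \<le> q * q" using assms by (intro mult_le_mono2) (simp add: Suc_leI)
    finally show ?thesis .
  qed
  then have "q * Suc (a $ 2 + q * a $ 3) \<le> q * (q * q)" by (intro mult_le_mono2) simp
  moreover have "code a < q * Suc (a $ 2 + q * a $ 3)" using assms by (simp add: code_def)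
  ultimately show ?thesis by (simp add: mult.assoc)
qed

private lemma ideal_low: "ideal (low c) S"
proof (rule idealI[OF S.ring_axioms])
  show "subgroup (low c) (add_monoid S)"
  proof (rule S.add.subgroupI)
    show "low c \<noteq> {}" using S.zero_closed by (auto simp: low_def zero_S_p[OF p1])
  next
    fix a assume a: "a \<in> low c"
    then have "a \<oplus>\<^bsub>S\<^esub> (\<ominus>\<^bsub>S\<^esub> a) = \<zero>\<^bsub>S\<^esub>" by (simp add: low_def S.r_neg)
    then have "(a x + (\<ominus>\<^bsub>S\<^esub> a) x) mod int p = 0" for x
      unfolding add_S_p[OF p1] zero_S_p[OF p1] reduce_mod_def by meson
    moreover have c: "\<ominus>\<^bsub>S\<^esub> a \<in> carrier S" using a by (simp add: low_def)
    ultimately have "a x = 0 \<Longrightarrow> (\<ominus>\<^bsub>S\<^esub> a) x = 0" for x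
      by (metis add.left_neutral carrier_S_p[OF p1] mod_pos_pos_trivial)
    then show "\<ominus>\<^bsub>S\<^esub> a \<in> low c" using a c by (auto simp: low_def)
  qed (auto simp: low_def add_S_p[OF p1] reduce_carrier[OF p1], auto simp: reduce_mod_def)
  show l: "x \<otimes>\<^bsub>S\<^esub> a \<in> low c" if "a \<in> low c" "x \<in> carrier S" for a x
  proof -
    have "conv x a m = 0" if m: "\<forall>v. m $ v < q" "code m + c < q * q * q" for m
      unfolding conv_def
    proof (rule sum.neutral, rule ballI)
      fix z assume "z \<in> {(b, c). b + c = m}"
      then obtain b d where z: "z = (b, d)" "b + d = m" by auto
      have le: "d $ v \<le> m $ v" for v using vec_add_eqD[OF z(2)] by simp
      \<comment> \<open>The base-\<open>q\<close> code is monotone in each exponent, so a factor of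
        a monomial never has a larger code.\<close>
      have "code d \<le> code m" unfolding code_def by (intro add_mono mult_mono le) auto
      moreover have "\<forall>v. d $ v < q" using le m(1) le_less_trans by blast
      ultimately have "a d = 0" using \<open>a \<in> low c\<close> m(2) by (auto simp: low_def)
      then show "(case z of (b, c) \<Rightarrow> x b * a c) = 0" by (simp add: z)
    qed
    then show ?thesis
      using that by (auto simp: low_def mult_S_p[OF p1] reduce_carrier[OF p1]) (simp add: reduce_mod_def)
  qed
  show "a \<otimes>\<^bsub>S\<^esub> x \<in> low c" if "a \<in> low c" "x \<in> carrier S" for a x
  proof -
    have "a \<in> carrier S" using that(1) by (simp add: low_def)
    then show ?thesis using l[OF that] that(2) by (simp add: S.m_comm)
  qed
qed

text \<open>Codes are injective on the box, so at most one coefficient, with \<open>p\<close>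
  possible values, separates the two ideals.\<close>

private lemma low_step:
  "\<exists>X. finite X \<and> card X \<le> p \<and> X \<subseteq> carrier S \<and>
      (\<forall>g\<in>low (Suc c). \<exists>s\<in>X. \<exists>g'\<in>low c. g = s \<oplus>\<^bsub>S\<^esub> g')"
proof -
  define P where "P a \<longleftrightarrow> (\<forall>v. a $ v < q) \<and> code a + Suc c = q * q * q" for a
  define X where "X = (\<lambda>k a. if P a then k else (0::int)) ` {0..<int p}"
  have "card X \<le> p" unfolding X_def using card_image_le[of "{0..<int p}"] by fastforce
  moreover have "X \<subseteq> carrier S" using p1 by (auto simp: X_def carrier_S_p[OF p1])
  moreover have "\<exists>s\<in>X. \<exists>g'\<in>low c. g = s \<oplus>\<^bsub>S\<^esub> g'" if g: "g \<in> low (Suc c)" for g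
  proof -
    have gc: "0 \<le> g a \<and> g a < int p" for a using g by (simp add: low_def carrier_S_p[OF p1])
    obtain k where k: "k \<in> {0..<int p}" "\<And>a. P a \<Longrightarrow> g a = k"
    proof (cases "\<exists>b. P b")
      case True
      then obtain b where b: "P b" by auto
      have "a = b" if "P a" for a using that b by (intro code_inj) (auto simp: P_def)
      then show ?thesis using that[of "g b"] gc[of b] by auto
    next
      case False
      then show ?thesis using that[of 0] p1 by auto
    qed
    define g' where "g' a = (if P a then 0 else g a)" for a
    have "g' \<in> carrier S" using gc p1 by (auto simp: g'_def carrier_S_p[OF p1])
    moreover have "g' a = 0" if "\<forall>v. a $ v < q" "code a + c < q * q * q" for a
    proof (cases "P a")
      case False
      then have "code a + Suc c < q * q * q" using that by (simp add: P_def)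
      then show ?thesis using g that(1) by (auto simp: low_def g'_def)
    qed (simp add: g'_def)
    ultimately have "g' \<in> low c" by (simp add: low_def)
    moreover have "g = (\<lambda>a. if P a then k else 0) \<oplus>\<^bsub>S\<^esub> g'"
      using gc k by (auto simp: add_S_p[OF p1] reduce_mod_def g'_def)
    ultimately show ?thesis using k(1) unfolding X_def by blast
  qed
  ultimately show ?thesis unfolding X_def by blast
qed

theorem h_seq_length:
  assumes q: "q \<ge> 1"
  shows "real (the_enat (module_length S (quot_module S (h_ideal (residue_ring (int p)) (reduce_mod p e7) t q))))
    = klen p q (nat \<lceil>t * real q\<rceil>)"
proof -
  obtain L where L: "card (K p q (nat \<lceil>t * real q\<rceil>)) = p ^ L" using card_K_power .
  have "module_length S (quot_module S (h_ideal (residue_ring (int p)) (reduce_mod p e7) t q)) = enat L"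
  proof (rule module_length_quot_eq[OF S.cring_axioms h_ideal_e7(2)[OF q] prime, where I = low and N = "q * q * q"])
    show "card (carrier (S Quot h_ideal (residue_ring (int p)) (reduce_mod p e7) t q)) = p ^ L"
      using card_quot_e7[OF q] L by simp
    show "low 0 \<subseteq> h_ideal (residue_ring (int p)) (reduce_mod p e7) t q"
    proof
      fix g assume g: "g \<in> low 0"
      then have "rev_box p q g = 0" using code_less by (auto simp: rev_box_eq_0_iff low_def)
      moreover have "0 \<in> (lop 2 mult_yz ^^ nat \<lceil>t * real q\<rceil>) ` box3 p q"
        by (intro add_subgroup_zero add_subgroup_image sub3[OF prime] torsion_space.additive_L[OF torsion_space2[OF prime]])
      ultimately show "g \<in> h_ideal (residue_ring (int p)) (reduce_mod p e7) t q"
        using g unfolding h_ideal_e7(1)[OF q] by (simp add: low_def)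
    qed
    show "low c \<subseteq> low (Suc c)" for c by (auto simp: low_def)
  qed (auto simp: ideal_low low_step, auto simp: low_def)
  moreover have "klen p q (nat \<lceil>t * real q\<rceil>) = L"
    using p1 by (simp add: klen_def L log_nat_power)
  ultimately show ?thesis by simp
qed

end

section \<open>Asymptotics of the first Frobenius level\<close>

lemma has_real_derivative_pos_part_power:
  fixes c x :: real
  shows "((\<lambda>x. max 0 (x - c) ^ Suc (Suc k)) has_real_derivative real (Suc (Suc k)) * max 0 (x - c) ^ Suc k) (at x)"
proof -
  consider "x < c" | "x > c" | "x = c" by linarith
  then show ?thesis
  proof cases
    case 1
    have "((\<lambda>_. 0) has_real_derivative real (Suc (Suc k)) * max 0 (x - c) ^ Suc k) (at x)"
      using 1 by simp
    then show ?thesis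
      by (rule has_field_derivative_transform_within_open[of _ _ _ "{..<c}"]) (use 1 in auto)
  next
    case 2
    have "((\<lambda>x. (x - c) ^ Suc (Suc k)) has_real_derivative real (Suc (Suc k)) * max 0 (x - c) ^ Suc k) (at x)"
      by (rule DERIV_cong[OF DERIV_fun_pow[where g = "\<lambda>x. x - c" and m = 1]])
         (use 2 in \<open>auto intro!: derivative_eq_intros simp del: power_Suc\<close>)
    then show ?thesis
      by (rule has_field_derivative_transform_within_open[of _ _ _ "{c<..}"]) (use 2 in auto)
  next
    case 3
    have "((\<lambda>h. (max 0 (c + h - c) ^ Suc (Suc k) - max 0 (c - c) ^ Suc (Suc k)) / h) \<longlongrightarrow> 0) (at 0)"
    proof (rule Lim_null_comparison)
      show "\<forall>\<^sub>F h in at 0. norm ((max 0 (c + h - c) ^ Suc (Suc k) - max 0 (c - c) ^ Suc (Suc k)) / h) \<le> \<bar>h\<bar> ^ Suc k"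
      proof (rule always_eventually, rule allI)
        fix h :: real
        show "norm ((max 0 (c + h - c) ^ Suc (Suc k) - max 0 (c - c) ^ Suc (Suc k)) / h) \<le> \<bar>h\<bar> ^ Suc k"
        proof (cases "h > 0")
          case False
          then have "max 0 (c + h - c) = 0" by simp
          then show ?thesis by (simp del: power_Suc)
        qed simp
      qed
      show "((\<lambda>h::real. \<bar>h\<bar> ^ Suc k) \<longlongrightarrow> 0) (at 0)"
        by (auto intro!: tendsto_eq_intros)
    qed
    then have "((\<lambda>x. max 0 (x - c) ^ Suc (Suc k)) has_real_derivative 0) (at c)" by (simp only: DERIV_def)
    then show ?thesis using 3 by (simp del: power_Suc)
  qed
qed

lemma has_real_derivative_pos_part_power2:
  fixes c x :: real
  shows "((\<lambda>x. (max 0 (x - c))\<^sup>2) has_real_derivative 2 * max 0 (x - c)) (at x)"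
  using has_real_derivative_pos_part_power[of c 0 x] by (simp add: numeral_2_eq_2)

lemma has_real_derivative_pos_part_power3:
  fixes c x :: real
  shows "((\<lambda>x. (max 0 (x - c)) ^ 3) has_real_derivative 3 * (max 0 (x - c))\<^sup>2) (at x)"
  using has_real_derivative_pos_part_power[of c 1 x] by (simp add: numeral_2_eq_2 numeral_3_eq_3)

lemma derivative_bound_imp_Lipschitz:
  fixes f :: "real \<Rightarrow> real"
  assumes "\<And>x. (f has_real_derivative f' x) (at x)" "\<And>x. a \<le> x \<Longrightarrow> x \<le> b \<Longrightarrow> \<bar>f' x\<bar> \<le> C"
    and "a \<le> x" "x \<le> b" "a \<le> y" "y \<le> b"
  shows "\<bar>f x - f y\<bar> \<le> C * \<bar>x - y\<bar>"
proof -
  have "norm (f x - f y) \<le> C * norm (x - y)"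
    by (rule field_differentiable_bound[of "{a..b}" f f'])
       (use assms in \<open>auto intro: has_field_derivative_at_within\<close>)
  then show ?thesis by simp
qed

text \<open>By the mean value theorem each strip contributes \<open>\<delta>\<close> times a value
  of \<open>\<phi>\<close> taken within distance \<open>\<delta>\<close> of the sample, hence an
  error of at most \<open>C * \<delta>^2\<close>.\<close>

lemma Riemann_sum_bound:
  fixes F \<phi> :: "real \<Rightarrow> real"
  assumes F: "\<And>x. (F has_real_derivative \<phi> x) (at x)" and \<phi>: "\<And>x y. \<bar>\<phi> x - \<phi> y\<bar> \<le> C * \<bar>x - y\<bar>"
    and \<delta>: "\<delta> > 0"
  shows "\<bar>(\<Sum>j<r. \<delta> * \<phi> (u - real j * \<delta>)) - (F u - F (u - real r * \<delta>))\<bar> \<le> real r * (C * \<delta>\<^sup>2)"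
proof (induction r)
  case (Suc r)
  define v where "v = u - real r * \<delta>"
  have v: "u - real (Suc r) * \<delta> = v - \<delta>" by (simp add: v_def algebra_simps)
  obtain z where z: "z > v - \<delta>" "z < v" "F v - F (v - \<delta>) = (v - (v - \<delta>)) * \<phi> z"
    using MVT2[of "v - \<delta>" v F \<phi>] \<delta> F by auto
  have C: "C \<ge> 0" using \<phi>[of 1 0] by simp
  have "\<bar>\<phi> v - \<phi> z\<bar> \<le> C * \<delta>"
    using \<phi>[of v z] z mult_left_mono[OF _ C, of "\<bar>v - z\<bar>" \<delta>] by simp
  then have "\<delta> * \<bar>\<phi> v - \<phi> z\<bar> \<le> \<delta> * (C * \<delta>)" using \<delta> by (intro mult_left_mono) auto
  then have "\<bar>\<delta> * \<phi> v - (F v - F (v - \<delta>))\<bar> \<le> C * \<delta>\<^sup>2"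
    unfolding z(3) using \<delta> by (simp add: abs_mult power2_eq_square mult_ac flip: right_diff_distrib)
  then show ?case using Suc unfolding v by (simp add: v_def algebra_simps abs_le_iff)
qed simp

text \<open>The samples are spaced by \<open>2/p\<close>, whence the factor \<open>1/2\<close>. For
  the doubled sum the discretisation costs \<open>12/p\<close> and each of the two endpoints
  \<open>9/p\<close>: an offset of \<open>3/p\<close> times the slope bound \<open>3\<close>. The
  interval from \<open>-1\<close> to \<open>2\<close> leaves room for endpoints that rounding pushes
  outside the unit interval.\<close>

lemma Riemann_sum_approx:
  fixes F \<phi> :: "real \<Rightarrow> real" and p r :: nat and N x y :: real
  assumes F: "\<And>x. (F has_real_derivative \<phi> x) (at x)" and \<phi>: "\<And>x y. \<bar>\<phi> x - \<phi> y\<bar> \<le> 3 * \<bar>x - y\<bar>"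
    and bound: "\<And>x. -1 \<le> x \<Longrightarrow> x \<le> 2 \<Longrightarrow> \<bar>\<phi> x\<bar> \<le> 3"
    and p: "p > 0" and r: "r \<le> p"
    and x: "\<bar>N - p * x\<bar> \<le> 3" "-1 \<le> N / p" "N / p \<le> 2" "-1 \<le> x" "x \<le> 2"
    and y: "\<bar>N - 2 * r - p * y\<bar> \<le> 3" "-1 \<le> (N - 2 * r) / p" "(N - 2 * r) / p \<le> 2" "-1 \<le> y" "y \<le> 2"
  shows "\<bar>(\<Sum>j<r. \<phi> ((N - 2 * j) / p)) / p - (F x - F y) / 2\<bar> \<le> 15 / p"
proof -
  have "\<bar>(\<Sum>j<r. (2 / p) * \<phi> (N / p - j * (2 / p))) - (F (N / p) - F (N / p - r * (2 / p)))\<bar> \<le> r * (3 * (2 / p)\<^sup>2)"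
    using p by (intro Riemann_sum_bound[OF F \<phi>]) simp
  also have "(\<Sum>j<r. (2 / p) * \<phi> (N / p - j * (2 / p))) = 2 * ((\<Sum>j<r. \<phi> ((N - 2 * j) / p)) / p)"
    by (simp add: sum_distrib_left sum_divide_distrib diff_divide_distrib mult_ac)
  also have "N / p - r * (2 / p) = (N - 2 * r) / p" by (simp add: diff_divide_distrib)
  also have "r * (3 * (2 / p)\<^sup>2) \<le> p * (3 * (2 / real p)\<^sup>2)" using r by (intro mult_right_mono) auto
  also have "\<dots> = 12 / p" using p by (simp add: power2_eq_square field_simps)
  finally have 1: "\<bar>2 * ((\<Sum>j<r. \<phi> ((N - 2 * j) / p)) / p) - (F (N / p) - F ((N - 2 * r) / p))\<bar> \<le> 12 / p" .
  have Lip: "\<bar>F z - F w\<bar> \<le> 3 * \<bar>z - w\<bar>" if "-1 \<le> z" "z \<le> 2" "-1 \<le> w" "w \<le> 2" for z w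
    by (rule derivative_bound_imp_Lipschitz[OF F bound that])
  have scale: "\<bar>M / p - z\<bar> \<le> 3 / p" if "\<bar>M - p * z\<bar> \<le> 3" for M z :: real
  proof -
    have "M / p - z = (M - p * z) / p" using p by (simp add: field_simps)
    then have "\<bar>M / p - z\<bar> = \<bar>M - p * z\<bar> / p" by simp
    then show ?thesis using that p by (simp add: divide_right_mono)
  qed
  have 2: "\<bar>F (N / p) - F x\<bar> \<le> 9 / p" using Lip[OF x(2-5)] scale[OF x(1)] by simp
  have 3: "\<bar>F ((N - 2 * r) / p) - F y\<bar> \<le> 9 / p" using Lip[OF y(2-5)] scale[OF y(1)] by simp
  show ?thesis using 1 2 3 by (simp add: abs_le_iff field_simps)
qed

text \<open>The scaled dimension of the kernel of \<open>z^(3 n)\<close> on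
  \<open>k[z]/(z^p)\<close>, with \<open>s = n/p\<close>.\<close>

definition psi :: "real \<Rightarrow> real" where "psi s = min 1 (3 * s)"

definition Psi :: "real \<Rightarrow> real" where "Psi s = 3/2 * s\<^sup>2 - 3/2 * (max 0 (s - 1/3))\<^sup>2"

text \<open>\<open>eta s\<close> is the limit of \<open>len_yz p (s p) / p\<^sup>2\<close>, the two-variable \<open>h\<close>-function of \<open>y\<^sup>3 + y z\<^sup>3\<close>.\<close>

definition eta :: "real \<Rightarrow> real" where
  "eta s = 3 * s - 27/8 * (max 0 (s - 1/9))\<^sup>2 + 27/8 * (max 0 (s - 5/9))\<^sup>2"

definition eta' :: "real \<Rightarrow> real" where
  "eta' s = 3 - 27/4 * max 0 (s - 1/9) + 27/4 * max 0 (s - 5/9)"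

definition Theta :: "real \<Rightarrow> real" where
  "Theta s = 3/2 * s\<^sup>2 - 9/8 * (max 0 (s - 1/9)) ^ 3 + 9/8 * (max 0 (s - 5/9)) ^ 3"

lemma Psi_deriv: "(Psi has_real_derivative psi s) (at s)"
  unfolding Psi_def[abs_def]
  by (rule DERIV_cong, (rule has_real_derivative_pos_part_power2 DERIV_diff DERIV_cmult DERIV_pow)+)
     (auto simp: psi_def max_def min_def)

lemma eta_deriv: "(eta has_real_derivative eta' s) (at s)"
  unfolding eta_def[abs_def]
  by (rule DERIV_cong, (rule has_real_derivative_pos_part_power2 DERIV_add DERIV_diff DERIV_cmult DERIV_ident)+)
     (auto simp: eta'_def)

lemma Theta_deriv: "(Theta has_real_derivative eta s) (at s)"
  unfolding Theta_def[abs_def]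
  by (rule DERIV_cong, (rule has_real_derivative_pos_part_power3 DERIV_add DERIV_diff DERIV_cmult DERIV_pow)+)
     (auto simp: eta_def)

lemma psi_Lipschitz: "\<bar>psi x - psi y\<bar> \<le> 3 * \<bar>x - y\<bar>"
  by (auto simp: psi_def min_def abs_if)

lemma psi_bound: "-1 \<le> x \<Longrightarrow> x \<le> 2 \<Longrightarrow> \<bar>psi x\<bar> \<le> 3"
  by (auto simp: psi_def min_def)

lemma eta'_bound: "\<bar>eta' x\<bar> \<le> 3"
  by (auto simp: eta'_def max_def abs_le_iff field_simps)

lemma eta_Lipschitz: "\<bar>eta x - eta y\<bar> \<le> 3 * \<bar>x - y\<bar>"
  by (rule derivative_bound_imp_Lipschitz[where a = "min x y" and b = "max x y", OF eta_deriv eta'_bound]) auto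

lemma eta'_nonneg: "0 \<le> eta' x"
  by (auto simp: eta'_def max_def field_simps)

lemma eta_mono: "x \<le> y \<Longrightarrow> eta x \<le> eta y"
  by (rule DERIV_nonneg_imp_nondecreasing[where f = eta]) (use eta_deriv eta'_nonneg in blast)+

lemma eta_bound: "-1 \<le> x \<Longrightarrow> x \<le> 2 \<Longrightarrow> \<bar>eta x\<bar> \<le> 3"
proof -
  assume "-1 \<le> x" "x \<le> 2"
  then have "eta (-1) \<le> eta x" "eta x \<le> eta 2" by (auto intro: eta_mono)
  moreover have "eta (-1) = -3" "eta 2 = 1" by (simp_all add: eta_def power2_eq_square)
  ultimately show ?thesis by linarith
qed

text \<open>The cases are cut where the lower end \<open>|1 - 3 s|/2\<close> equals
  \<open>1/3\<close> or \<open>0\<close>. The corner of the absolute value at \<open>s = 1/3\<close>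
  leaves no trace, because \<open>Psi\<close> is an even quadratic near \<open>0\<close>.\<close>

lemma eta_Psi:
  assumes "0 \<le> s" "s \<le> 1"
  shows "eta s = s + Psi ((1 + s) / 2) - Psi (\<bar>1 - 3 * s\<bar> / 2)"
proof -
  consider "s \<le> 1/9" | "1/9 \<le> s" "s \<le> 1/3" | "1/3 \<le> s" "s \<le> 5/9" | "5/9 \<le> s" by linarith
  then show ?thesis
    by cases (use assms in \<open>simp add: eta_def Psi_def max_def power2_eq_square field_simps\<close>)+
qed

lemma abs_diff_halves:
  fixes A B D e :: real
  shows "\<bar>A - D / 2\<bar> \<le> e \<Longrightarrow> \<bar>B - D / 2\<bar> \<le> e \<Longrightarrow> \<bar>A + B - D\<bar> \<le> 2 * e"
  by linarith

lemma len_yz_approx: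
  assumes p: "p \<ge> 3" and n: "n \<le> p"
  shows "\<bar>len_yz p n / p\<^sup>2 - eta (n / p)\<bar> \<le> 30 / p"
proof -
  define s where "s = real n / p"
  have s: "0 \<le> s" "s \<le> 1" "p * s = n" using p n by (auto simp: s_def)
  define T where "T i = (\<Sum>l<min ((p - n + 1 - i) div 2) n.
     real (min p (3 * ((p - n + 1 - i) div 2 + n - 1 - 2 * l))))" for i
  have *: "\<bar>T i / p\<^sup>2 - (Psi ((1 + s) / 2) - Psi (\<bar>1 - 3 * s\<bar> / 2)) / 2\<bar> \<le> 15 / p" if i: "i < 2" for i
  proof -
    define a where "a = (p - n + 1 - i) div 2"
    define r where "r = min a n"
    define N where "N = real a + real n - 1"
    have "2 * a \<le> p - n + 1" "p - n \<le> 2 * a + 1" using i unfolding a_def by linarith+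
    then have a: "2 * real a \<le> real p - n + 1" "real p - n \<le> 2 * real a + 1"
      using n by (simp_all add: of_nat_diff flip: of_nat_add of_nat_mult)
    \<comment> \<open>Whichever of \<open>a\<close> and \<open>n\<close> is smaller, the samples
      stop near \<open>|a - n|\<close>. As \<open>a\<close> is about \<open>(p - n)/2\<close>, this
      is the source of \<open>|1 - 3 s|/2\<close>.\<close>
    have Nr: "N - real (2 * r) = \<bar>real a - n\<bar> - 1" by (auto simp: N_def r_def min_def abs_if)
    have "T i = (\<Sum>l<r. p * psi ((N - 2 * l) / p))"
      unfolding T_def a_def[symmetric] r_def[symmetric]
    proof (rule sum.cong[OF refl])
      fix l assume "l \<in> {..<r}"
      then have "2 * l + 1 \<le> a + n" by (auto simp: r_def)
      then have "real (a + n - 1 - 2 * l) = N - 2 * l" by (simp add: N_def of_nat_diff)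
      then have "real (min p (3 * (a + n - 1 - 2 * l))) = min p (3 * (N - 2 * l))"
        by (simp only: of_nat_min of_nat_mult of_nat_numeral)
      also have "\<dots> = p * psi ((N - 2 * l) / p)"
        using p by (simp add: psi_def min_def field_simps)
      finally show "real (min p (3 * (a + n - 1 - 2 * l))) = p * psi ((N - 2 * l) / p)" .
    qed
    then have "T i / p\<^sup>2 = (\<Sum>l<r. psi ((N - 2 * l) / p)) / p"
      using p by (simp add: power2_eq_square flip: sum_distrib_left)
    moreover have "\<bar>(\<Sum>l<r. psi ((N - 2 * l) / p)) / p - (Psi ((1 + s) / 2) - Psi (\<bar>1 - 3 * s\<bar> / 2)) / 2\<bar> \<le> 15 / p"
    proof (rule Riemann_sum_approx[OF Psi_deriv psi_Lipschitz psi_bound])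
      show "r \<le> p" using n by (simp add: r_def)
      have "p * ((1 + s) / 2) = (p + n) / 2" using s by (simp add: algebra_simps)
      then show "\<bar>N - p * ((1 + s) / 2)\<bar> \<le> 3" using a by (simp add: N_def abs_le_iff field_simps)
      have e: "p * (\<bar>1 - 3 * s\<bar> / 2) = \<bar>(real p - 3 * real n) / 2\<bar>"
        using s p by (simp add: abs_mult_pos' algebra_simps flip: s(3))
      have "\<bar>real a - n - (real p - 3 * real n) / 2\<bar> \<le> 1 / 2"
        using a by (simp add: abs_le_iff field_simps)
      then have "\<bar>\<bar>real a - n\<bar> - \<bar>(real p - 3 * real n) / 2\<bar>\<bar> \<le> 1 / 2"
        using abs_triangle_ineq3 order_trans by blast
      then show "\<bar>N - 2 * r - p * (\<bar>1 - 3 * s\<bar> / 2)\<bar> \<le> 3"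
        unfolding Nr e by linarith
      show "-1 \<le> N / p" "N / p \<le> 2" using p n a by (simp_all add: N_def field_simps)
      have "\<bar>real a - n\<bar> \<le> p" using a n p by (simp add: abs_le_iff)
      then show "-1 \<le> (N - 2 * r) / p" "(N - 2 * r) / p \<le> 2" unfolding Nr using p by (simp_all add: field_simps)
    qed (use p s in auto)
    ultimately show ?thesis by simp
  qed
  have "len_yz p n / p\<^sup>2 = s + T 0 / p\<^sup>2 + T 1 / p\<^sup>2"
  proof -
    have "len_yz p n = real (n * p) + (\<Sum>i<2. T i)" by (simp only: len_yz_def T_def)
    also have "(\<Sum>i<2. T i) = T 0 + T 1" by (simp add: numeral_2_eq_2)
    finally show ?thesis using p by (simp add: s_def power2_eq_square add_divide_distrib)
  qed
  moreover have "\<bar>T 0 / p\<^sup>2 + T 1 / p\<^sup>2 - (Psi ((1 + s) / 2) - Psi (\<bar>1 - 3 * s\<bar> / 2))\<bar> \<le> 2 * (15 / p)"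
    by (intro abs_diff_halves *) simp_all
  ultimately show ?thesis
    unfolding s_def[symmetric] eta_Psi[OF s(1,2)] by (simp add: algebra_simps)
qed

definition H :: "real \<Rightarrow> real" where "H t = Theta (1/2 + t) - Theta (1/2 - t)"

lemma klen_level_one_approx:
  assumes p: "prime p" "odd p" and m: "m \<le> (p + 1) div 2" and t: "0 \<le> t" "t \<le> 1/2" and mt: "\<bar>real m - t * p\<bar> \<le> 1"
  shows "\<bar>klen p p m / real p ^ 3 - H t\<bar> \<le> 90 / p"
proof -
  have p3: "p \<ge> 3" using p prime_ge_2_nat[of p] by (cases "p = 2") auto
  define T where "T i = (\<Sum>j<min ((p + 1 - i) div 2) m. len_yz p ((p + 1 - i) div 2 + m - 1 - 2 * j))" for i
  have *: "\<bar>T i / p ^ 3 - (Theta (1/2 + t) - Theta (1/2 - t)) / 2\<bar> \<le> 45 / p" if i: "i < 2" for i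
  proof -
    define a where "a = (p + 1 - i) div 2"
    define r where "r = min a m"
    define N where "N = real a + real m - 1"
    have am: "a + m \<le> p + 1" using m unfolding a_def by linarith
    have "2 * a \<le> p + 1" "p \<le> 2 * a + 1" using i unfolding a_def by linarith+
    then have a: "2 * real a \<le> real p + 1" "real p \<le> 2 * real a + 1"
      by (simp_all flip: of_nat_add of_nat_mult)
    have mp: "2 * real m \<le> real p + 1"
    proof -
      have "2 * m \<le> p + 1" using m by linarith
      then show ?thesis by (simp flip: of_nat_add of_nat_mult)
    qed
    have Nr: "N - real (2 * r) = \<bar>real a - m\<bar> - 1" by (auto simp: N_def r_def min_def abs_if)
    have rp: "r \<le> p" using am p3 unfolding r_def by linarith
    have "T i / p ^ 3 = (\<Sum>j<r. len_yz p (a + m - 1 - 2 * j) / p\<^sup>2) / p"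
      unfolding T_def a_def[symmetric] r_def[symmetric]
      by (simp add: power3_eq_cube power2_eq_square flip: sum_divide_distrib)
    then have "T i / p ^ 3 - (\<Sum>j<r. eta ((N - 2 * j) / p)) / p =
        (\<Sum>j<r. len_yz p (a + m - 1 - 2 * j) / p\<^sup>2 - eta ((N - 2 * j) / p)) / p"
      by (simp only: sum_subtractf diff_divide_distrib)
    then have "\<bar>T i / p ^ 3 - (\<Sum>j<r. eta ((N - 2 * j) / p)) / p\<bar> =
        \<bar>\<Sum>j<r. len_yz p (a + m - 1 - 2 * j) / p\<^sup>2 - eta ((N - 2 * j) / p)\<bar> / p"
      by (simp only: abs_divide abs_of_nat)
    also have "\<dots> \<le> (\<Sum>j<r. 30 / p) / p"
    proof (intro divide_right_mono order_trans[OF sum_abs] sum_mono)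
      fix j assume "j \<in> {..<r}"
      then have j: "2 * j + 1 \<le> a + m" by (auto simp: r_def)
      then have "real (a + m - 1 - 2 * j) = N - 2 * j" by (simp add: N_def of_nat_diff)
      then show "\<bar>len_yz p (a + m - 1 - 2 * j) / p\<^sup>2 - eta ((N - 2 * j) / p)\<bar> \<le> 30 / p"
        using len_yz_approx[OF p3, of "a + m - 1 - 2 * j"] am by simp
    qed (use p3 in auto)
    also have "\<dots> \<le> 30 / p" using rp p3 by (simp add: field_simps)
    finally have 1: "\<bar>T i / p ^ 3 - (\<Sum>j<r. eta ((N - 2 * j) / p)) / p\<bar> \<le> 30 / p" .
    have 2: "\<bar>(\<Sum>j<r. eta ((N - 2 * j) / p)) / p - (Theta (1/2 + t) - Theta (1/2 - t)) / 2\<bar> \<le> 15 / p"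
    proof (rule Riemann_sum_approx[OF Theta_deriv eta_Lipschitz eta_bound _ rp])
      have e: "real p * (1/2 + t) = p / 2 + t * p" "real p * (1/2 - t) = p / 2 - t * p"
        by (simp_all add: distrib_left right_diff_distrib mult.commute)
      have tp: "t * p \<le> p / 2" using mult_right_mono[OF t(2), of "real p"] by simp
      show "\<bar>N - p * (1/2 + t)\<bar> \<le> 3" unfolding e N_def using a mt tp by linarith
      show "\<bar>N - 2 * r - p * (1/2 - t)\<bar> \<le> 3" unfolding e Nr using a mt tp by linarith
      show "-1 \<le> N / p" "N / p \<le> 2" using p3 am a mp by (simp_all add: N_def field_simps)
      have "\<bar>real a - m\<bar> \<le> p" using a mp p3 by linarith
      then show "-1 \<le> (N - 2 * r) / p" "(N - 2 * r) / p \<le> 2" unfolding Nr using p3 by (simp_all add: field_simps)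
    qed (use p3 t in auto)
    \<comment> \<open>The first part is the cost of replacing the inner lengths by
      \<open>eta\<close>, the second that of the outer Riemann sum.\<close>
    have "45 / real p = 30 / p + 15 / p" by (simp flip: add_divide_distrib)
    then show ?thesis using 1 2 by linarith
  qed
  have "klen p p m / real p ^ 3 = T 0 / p ^ 3 + T 1 / p ^ 3"
  proof -
    have "klen p p m = (\<Sum>i<2. T i)" by (simp only: klen_level_one[OF p(1) m] T_def)
    also have "\<dots> = T 0 + T 1" by (simp add: numeral_2_eq_2)
    finally show ?thesis by (simp add: add_divide_distrib)
  qed
  then show ?thesis
    unfolding H_def using abs_diff_halves[OF *[of 0] *[of 1]] by simp
qed

section \<open>The limit \<open>h\<close>-function\<close>

lemma e7_eq:
  defines "S \<equiv> (mpower_series \<Z> :: (nat ^ 3 \<Rightarrow> int) ring)"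
  shows "mvar \<Z> 1 [^]\<^bsub>S\<^esub> (2::nat) \<oplus>\<^bsub>S\<^esub> mvar \<Z> 2 [^]\<^bsub>S\<^esub> (3::nat)
    \<oplus>\<^bsub>S\<^esub> mvar \<Z> 2 \<otimes>\<^bsub>S\<^esub> mvar \<Z> 3 [^]\<^bsub>S\<^esub> (3::nat) = e7"
proof -
  have mult: "f \<otimes>\<^bsub>S\<^esub> g = conv f g" for f g
    by (auto simp: S_def mpower_series_def conv_def int_finsum_eq case_prod_beta)
  have add: "f \<oplus>\<^bsub>S\<^esub> g = (\<lambda>a. f a + g a)" for f g
    by (simp add: S_def mpower_series_def int_add_eq)
  have one: "\<one>\<^bsub>S\<^esub> = mvmono 0"
    by (auto simp: S_def mpower_series_def mvmono_def int_zero_eq)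
  have var: "mvar \<Z> v = mvmono (axis v 1)" for v :: 3
    by (auto simp: mvar_def mvmono_def int_zero_eq)
  have pow: "mvmono m [^]\<^bsub>S\<^esub> n = mvmono (\<chi> v. n * m $ v)" for m and n :: nat
  proof (induction n)
    case 0
    then show ?case by (simp add: one nat_pow_def flip: zero_vec_def)
  next
    case (Suc n)
    have "(\<chi> v. n * m $ v) + m = (\<chi> v. Suc n * m $ v)" by (auto simp: vec_eq_iff)
    then show ?case using Suc by (simp add: mult mvmono_add nat_pow_def)
  qed
  have "(\<chi> v. 2 * axis 1 1 $ v) = vec3 2 0 0" "(\<chi> v. 3 * axis 2 1 $ v) = vec3 0 3 0"
    "axis 2 1 + (\<chi> v. 3 * axis 3 1 $ v) = vec3 0 1 3"
    by (simp_all add: vec_eq_iff forall_3 axis_def)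
  then show ?thesis
    by (simp add: var pow mult add mvmono_add e7_def[abs_def] add.assoc)
qed

section \<open>The sequence in \<open>e\<close> for a fixed prime\<close>

lemma h_seq_e7:
  assumes "prime p"
  shows "h_seq p (residue_ring (int p)) (reduce_mod p e7) t e =
    klen p (p ^ e) (nat \<lceil>t * real (p ^ e)\<rceil>) / real p ^ (3 * e)"
  unfolding h_seq_def Let_def
  using h_seq_length[OF assms, of "p ^ e" t] prime_gt_0_nat[OF assms]
  by (simp add: mult.commute Suc_leI)

context
  fixes p :: nat and t :: real
  assumes prime: "prime p"
begin

private abbreviation s :: "nat \<Rightarrow> real" where
  "s \<equiv> h_seq p (residue_ring (int p)) (reduce_mod p e7) t"

text \<open>Frobenius rewrites \<open>s e\<close> as a kernel length at level \<open>p q\<close>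
  with exponent \<open>p * n\<close>. This exponent exceeds the one in \<open>s (Suc e)\<close> by
  at most \<open>p\<close>, each unit costs at most \<open>2 (p q)^2\<close>, and the normalisation
  divides by \<open>(p q)^3\<close>.\<close>

lemma h_seq_step: "s (Suc e) \<le> s e" "s e - s (Suc e) \<le> 2 / real p ^ e"
proof -
  have p: "p > 0" "real p > 0" using prime by (simp_all add: prime_gt_0_nat)
  define q where "q = p ^ e"
  define n where "n = nat \<lceil>t * real q\<rceil>"
  define n' where "n' = nat \<lceil>t * real (p * q)\<rceil>"
  have q: "real q > 0" "real p ^ (3 * e) = real q ^ 3" "real p ^ (3 * Suc e) = (real p * real q) ^ 3"
    using p by (simp_all add: q_def power_mult mult.commute[of 3] power_mult_distrib power_add)
  have n1: "n' \<le> p * n"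
  proof -
    have "t * real q \<le> n" unfolding n_def by linarith
    then have "p * (t * real q) \<le> p * n" using p by simp
    then show ?thesis unfolding n'_def by (simp add: nat_le_iff ceiling_le_iff mult_ac)
  qed
  have n2: "p * n \<le> n' + p"
  proof (cases "n = 0")
    case False
    then have "real n \<le> t * real q + 1" unfolding n_def by linarith
    then have "p * real n \<le> p * (t * real q + 1)" using p by simp
    also have "\<dots> = t * real (p * q) + p" by (simp add: algebra_simps)
    also have "\<dots> \<le> n' + p" unfolding n'_def by linarith
    finally show ?thesis by (simp flip: of_nat_mult of_nat_add)
  qed simp
  have se: "s e = klen p q n / real q ^ 3"
    by (simp add: h_seq_e7[OF prime] n_def q_def power_mult mult.commute[of 3])
  have se': "s (Suc e) = klen p (p * q) n' / (real p * real q) ^ 3"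
    unfolding h_seq_e7[OF prime] q(3) by (simp add: n'_def q_def)
  have frob: "s e = klen p (p * q) (p * n) / (real p * real q) ^ 3"
    unfolding se klen_Frobenius[OF prime] using p by (simp add: power_mult_distrib)
  show "s (Suc e) \<le> s e"
    unfolding frob se' using p q klen_mono[OF prime n1] by (intro divide_right_mono) auto
  have "klen p (p * q) (p * n) \<le> klen p (p * q) (n' + p)" by (rule klen_mono[OF prime n2])
  also have "\<dots> \<le> klen p (p * q) n' + real p * (2 * real (p * q) ^ 2)" by (rule klen_add_le[OF prime])
  finally have "s e - s (Suc e) \<le> (real p * (2 * real (p * q) ^ 2)) / (real p * real q) ^ 3"
    unfolding frob se' diff_divide_distrib[symmetric] using p q by (intro divide_right_mono) auto
  also have "\<dots> = 2 / real p ^ e" using p q(1) unfolding q_def by (simp add: power3_eq_cube power2_eq_square)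
  finally show "s e - s (Suc e) \<le> 2 / real p ^ e" .
qed

lemma h_seq_nonneg: "0 \<le> s e"
  unfolding h_seq_e7[OF prime] by (simp add: klen_nonneg[OF prime])

lemma h_seq_convergent: "convergent s"
proof -
  have "decseq s" by (rule decseq_SucI) (rule h_seq_step)
  then have "Bseq s" using decseq_bounded[of s 0] h_seq_nonneg by simp
  then show ?thesis using \<open>decseq s\<close> by (intro Bseq_monoseq_convergent decseq_imp_monoseq)
qed

lemma h_mod_e7_bound: "\<bar>h_mod e7 p t - s 1\<bar> \<le> 4 / p"
proof -
  have p: "real p \<ge> 2" using prime_ge_2_nat[OF prime] by simp
  have lim: "s \<longlonglongrightarrow> h_mod e7 p t"
    using h_seq_convergent by (simp add: h_mod_def h_function_def convergent_LIMSEQ_iff)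
  have dec: "decseq s" by (rule decseq_SucI) (rule h_seq_step)
  have upper: "h_mod e7 p t \<le> s 1" by (rule decseq_ge[OF dec lim])
  \<comment> \<open>The steps \<open>2 / p^i\<close> are summed from \<open>i = 1\<close>;
    subtracting \<open>4 / p^(e+1)\<close> makes the bound inductive, because
    \<open>p >= 2\<close>.\<close>
  have lower: "s 1 - s (Suc e) \<le> 4 / p - 4 / real p ^ Suc e" for e
  proof (induction e)
    case (Suc e)
    have "s 1 - s (Suc (Suc e)) \<le> 4 / p - 4 / real p ^ Suc e + 2 / real p ^ Suc e"
      using Suc h_seq_step(2)[of "Suc e"] by linarith
    also have "\<dots> \<le> 4 / p - 4 / real p ^ Suc (Suc e)"
    proof -
      have "4 / real p ^ Suc (Suc e) = 2 / real p ^ Suc e * (2 / p)" by simp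
      also have "\<dots> \<le> 2 / real p ^ Suc e * 1" using p by (intro mult_left_mono) auto
      finally show ?thesis by (simp add: field_simps)
    qed
    finally show ?case .
  qed simp
  have "s 1 - 4 / p \<le> s (Suc e)" for e
  proof -
    have "0 \<le> 4 / real p ^ Suc e" by simp
    then show ?thesis using lower[of e] by linarith
  qed
  then have "s 1 - 4 / p \<le> h_mod e7 p t"
    by (intro LIMSEQ_le_const[OF LIMSEQ_Suc[OF lim]]) auto
  then show ?thesis using upper by linarith
qed

end

text \<open>One expression for all real \<open>t\<close>: clamping gives the constants
  \<open>0\<close> and \<open>1\<close> outside the unit interval, and taking the smaller of
  \<open>c\<close> and \<open>1 - c\<close> folds the reflection in, so continuity on the whole line
  needs no gluing.\<close>

definition hlim :: "real \<Rightarrow> real" where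
  "hlim t = (let c = max 0 (min 1 t) in H (min c (1 - c)) + max 0 (2 * c - 1))"

lemma hlim_simps:
  "t \<le> 0 \<Longrightarrow> hlim t = 0"
  "0 \<le> t \<Longrightarrow> t \<le> 1/2 \<Longrightarrow> hlim t = H t"
  "1/2 \<le> t \<Longrightarrow> t \<le> 1 \<Longrightarrow> hlim t = H (1 - t) + 2 * t - 1"
  "1 \<le> t \<Longrightarrow> hlim t = 1"
proof -
  show "hlim t = 0" if "t \<le> 0" using that by (simp add: hlim_def H_def)
  show "hlim t = H t" if "0 \<le> t" "t \<le> 1/2" using that by (simp add: hlim_def)
  show "hlim t = H (1 - t) + 2 * t - 1" if "1/2 \<le> t" "t \<le> 1" using that by (simp add: hlim_def)
  show "hlim t = 1" if "1 \<le> t" using that by (simp add: hlim_def H_def)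
qed

lemma h_mod_e7_hlim:
  assumes "prime p" "odd p" shows "\<bar>h_mod e7 p t - hlim t\<bar> \<le> 100 / p"
proof -
  have p: "p \<ge> 3" using assms prime_ge_2_nat[of p] by (cases "p = 2") auto
  define m where "m = nat \<lceil>t * real p\<rceil>"
  have s1: "h_seq p (residue_ring (int p)) (reduce_mod p e7) t 1 = klen p p m / real p ^ 3"
    by (simp add: h_seq_e7[OF assms(1)] m_def)
  have "\<bar>klen p p m / real p ^ 3 - hlim t\<bar> \<le> 92 / p"
  proof -
    consider "t \<le> 0" | "0 < t" "t \<le> 1/2" | "1/2 < t" "t \<le> 1" | "1 < t" by linarith
    then show ?thesis
    proof cases
      case 1
      then have "m = 0" using mult_nonpos_nonneg[of t "real p"] by (simp add: m_def)
      then have "klen p p m = 0"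
        using torsion_space.Ker_trivial[OF torsion_space2[OF assms(1)]]
        by (simp add: klen_def K_eq_Ker[OF assms(1)])
      then show ?thesis using 1 by (simp add: hlim_simps)
    next
      case 2
      have tp: "0 < t * p" "t * p \<le> p / 2" using 2 p mult_right_mono[OF 2(2), of "real p"] by auto
      have "\<bar>real m - t * p\<bar> \<le> 1" unfolding m_def using tp by linarith
      moreover have "m \<le> (p + 1) div 2"
      proof -
        have "2 * real m < real p + 2" unfolding m_def using tp by linarith
        then have "2 * m < p + 2" by (simp flip: of_nat_add of_nat_mult)
        then show ?thesis by linarith
      qed
      ultimately have "\<bar>klen p p m / real p ^ 3 - H t\<bar> \<le> 90 / p"
        using 2 by (intro klen_level_one_approx[OF assms]) auto
      also have "\<dots> \<le> 92 / p" by (simp add: divide_right_mono)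
      finally show ?thesis using 2 by (simp add: hlim_simps)
    next
      case 3
      have tp: "p / 2 < t * p" "t * p \<le> p" using 3 p mult_right_mono[OF 3(2), of "real p"] mult_strict_right_mono[OF 3(1), of "real p"] by auto
      have mt: "\<bar>real m - t * p\<bar> \<le> 1" and mp: "m \<le> p" and m2: "p < 2 * real m"
        unfolding m_def using tp by linarith+
      have "\<bar>klen p p (p - m) / real p ^ 3 - H (1 - t)\<bar> \<le> 90 / p"
      proof (rule klen_level_one_approx[OF assms])
        have "p < 2 * m" using m2 by (simp flip: of_nat_mult)
        then show "p - m \<le> (p + 1) div 2" by linarith
        show "\<bar>real (p - m) - (1 - t) * p\<bar> \<le> 1" using mt mp by (simp add: of_nat_diff algebra_simps abs_le_iff)
      qed (use 3 in auto)
      moreover have "klen p p m / real p ^ 3 = (2 * real m - p) / p + klen p p (p - m) / real p ^ 3"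
        unfolding klen_level_one_reflect[OF assms mp] using p
        by (simp add: add_divide_distrib power3_eq_cube power2_eq_square)
      \<comment> \<open>Rounding \<open>t * p\<close> up to \<open>m\<close> in the linear term of
        the reflection accounts for the gap between \<open>90\<close> and \<open>92\<close>.\<close>
      moreover have "\<bar>(2 * real m - p) / p - (2 * t - 1)\<bar> \<le> 2 / p"
      proof -
        have "(2 * real m - p) / p - (2 * t - 1) = 2 * (real m - t * p) / p" using p by (simp add: field_simps)
        then have "\<bar>(2 * real m - p) / p - (2 * t - 1)\<bar> = 2 * \<bar>real m - t * p\<bar> / p"
          by (simp only: abs_divide abs_mult abs_numeral abs_of_nat)
        also have "\<dots> \<le> 2 / p" using mt by (intro divide_right_mono) auto
        finally show ?thesis .
      qed
      moreover have "92 / real p = 90 / p + 2 / p" by (simp flip: add_divide_distrib)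
      ultimately show ?thesis using hlim_simps(3)[of t] 3 by (simp add: abs_le_iff)
    next
      case 4
      then have "real p \<le> t * p" using p by simp
      then have "m \<ge> p" unfolding m_def by linarith
      then show ?thesis using 4 klen_level_one_full[OF assms] p by (simp add: hlim_simps)
    qed
  qed
  moreover have "\<bar>h_mod e7 p t - klen p p m / real p ^ 3\<bar> \<le> 4 / p"
    using h_mod_e7_bound[OF assms(1), of t] unfolding s1 .
  ultimately have "\<bar>h_mod e7 p t - hlim t\<bar> \<le> 4 / p + 92 / p" by linarith
  also have "\<dots> \<le> 100 / p" by (simp add: divide_right_mono flip: add_divide_distrib)
  finally show ?thesis .
qed

text \<open>The infinitude of primes, which makes limits along this filter unique and so determines
  \<open>limit_h\<close>.\<close>

lemma primes_at_top_neq_bot: "primes_at_top \<noteq> bot"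
proof
  assume "primes_at_top = bot"
  then have "eventually (\<lambda>p. \<not> prime p) (at_top :: nat filter)"
    by (simp add: primes_at_top_def trivial_limit_def eventually_inf_principal)
  then obtain N where "\<And>p. p \<ge> N \<Longrightarrow> \<not> prime (p::nat)" by (auto simp: eventually_at_top_linorder)
  then show False using bigger_prime[of N] by (meson less_imp_le)
qed

lemma h_mod_e7_tendsto: "((\<lambda>p. h_mod e7 p t) \<longlongrightarrow> hlim t) primes_at_top"
proof -
  have "((\<lambda>p. h_mod e7 p t - hlim t) \<longlongrightarrow> 0) primes_at_top"
  proof (rule Lim_null_comparison)
    have "eventually (\<lambda>p::nat. p > 2) at_top" by (rule eventually_gt_at_top)
    then show "\<forall>\<^sub>F p in primes_at_top. norm (h_mod e7 p t - hlim t) \<le> 100 / real p"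
      unfolding primes_at_top_def eventually_inf_principal
      by eventually_elim (use h_mod_e7_hlim prime_odd_nat in auto)
    have "((\<lambda>p. 100 / real p) \<longlongrightarrow> 0) at_top"
      by (rule tendsto_divide_0[OF tendsto_const filterlim_at_top_imp_at_infinity[OF filterlim_real_sequentially]])
    then show "((\<lambda>p. 100 / real p) \<longlongrightarrow> 0) primes_at_top"
      by (rule tendsto_mono[rotated]) (simp add: primes_at_top_def)
  qed
  then show ?thesis by (simp add: Lim_null[symmetric])
qed

lemma limit_h_e7: "limit_h e7 = hlim"
  unfolding limit_h_def using tendsto_Lim[OF primes_at_top_neq_bot h_mod_e7_tendsto] by auto

section \<open>Continuity and smoothness of the limit\<close>

lemma continuous_Theta: "continuous_on UNIV Theta"
  using Theta_deriv by (meson DERIV_isCont continuous_at_imp_continuous_on)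

lemma continuous_eta': "continuous_on A eta'"
  unfolding eta'_def[abs_def] by (intro continuous_intros)

lemma continuous_hlim: "continuous_on UNIV hlim"
  unfolding hlim_def[abs_def] Let_def H_def
  by (intro continuous_intros continuous_on_compose2[OF continuous_Theta]) auto

lemma C2_on_cong_open:
  assumes "C2_on U f" "open U" "\<And>x. x \<in> U \<Longrightarrow> f x = g x" shows "C2_on U g"
proof -
  obtain f' f'' where f: "\<forall>x\<in>U. (f has_real_derivative f' x) (at x)"
    "\<forall>x\<in>U. (f' has_real_derivative f'' x) (at x)" "continuous_on U f''"
    using assms(1) by (auto simp: C2_on_def)
  have "(g has_real_derivative f' x) (at x)" if "x \<in> U" for x
    by (rule has_field_derivative_transform_within_open[OF f(1)[rule_format, OF that] assms(2) that assms(3)])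
  then show ?thesis using f by (auto simp: C2_on_def)
qed

text \<open>Derivatives are unique, so the two choices of first and second derivative agree on the
  overlap and glue.\<close>

lemma C2_on_Un:
  assumes U: "open U" "C2_on U g" and W: "open W" "C2_on W g" shows "C2_on (U \<union> W) g"
proof -
  obtain u u' where u: "\<forall>x\<in>U. (g has_real_derivative u x) (at x)"
    "\<forall>x\<in>U. (u has_real_derivative u' x) (at x)" "continuous_on U u'"
    using U(2) by (auto simp: C2_on_def)
  obtain w w' where w: "\<forall>x\<in>W. (g has_real_derivative w x) (at x)"
    "\<forall>x\<in>W. (w has_real_derivative w' x) (at x)" "continuous_on W w'"
    using W(2) by (auto simp: C2_on_def)
  define k where "k x = (if x \<in> U then u x else w x)" for x
  define k' where "k' x = (if x \<in> U then u' x else w' x)" for x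
  have uw: "u x = w x" if "x \<in> U" "x \<in> W" for x
    using u(1) w(1) that DERIV_unique by blast
  have uw': "u' x = w' x" if "x \<in> U" "x \<in> W" for x
  proof -
    have "(w has_real_derivative u' x) (at x)"
      by (rule has_field_derivative_transform_within_open[of u _ _ "U \<inter> W"]) (use u that U W uw in auto)
    then show ?thesis using w(2) that DERIV_unique by blast
  qed
  have kU: "k x = u x" "k' x = u' x" if "x \<in> U" for x using that by (auto simp: k_def k'_def)
  have kW: "k x = w x" "k' x = w' x" if "x \<in> W" for x using that uw uw' by (auto simp: k_def k'_def)
  have "(g has_real_derivative k x) (at x)" if "x \<in> U \<union> W" for x
    using that u(1) w(1) kU kW by auto
  moreover have "(k has_real_derivative k' x) (at x)" if "x \<in> U \<union> W" for x
    using that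
  proof
    assume x: "x \<in> U"
    then have "(u has_real_derivative k' x) (at x)" using u(2) kU by auto
    then show ?thesis by (rule has_field_derivative_transform_within_open[OF _ U(1) x]) (simp add: kU)
  next
    assume x: "x \<in> W"
    then have "(w has_real_derivative k' x) (at x)" using w(2) kW by auto
    then show ?thesis by (rule has_field_derivative_transform_within_open[OF _ W(1) x]) (simp add: kW)
  qed
  moreover have "continuous_on (U \<union> W) k'"
  proof (rule continuous_on_open_Un[OF U(1) W(1)])
    show "continuous_on U k'" using u(3) by (rule continuous_on_eq) (simp add: kU)
    show "continuous_on W k'" using w(3) by (rule continuous_on_eq) (simp add: kW)
  qed
  ultimately show ?thesis unfolding C2_on_def by blast
qed

lemma DERIV_H: "(H has_real_derivative eta (1/2 + t) + eta (1/2 - t)) (at t)"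
  unfolding H_def[abs_def]
  by (auto intro!: derivative_eq_intros DERIV_chain2[OF Theta_deriv])

lemma C2_on_H: "C2_on A H"
proof -
  have "((\<lambda>t. eta (1/2 + t) + eta (1/2 - t)) has_real_derivative eta' (1/2 + t) - eta' (1/2 - t)) (at t)" for t
    by (auto intro!: derivative_eq_intros DERIV_chain2[OF eta_deriv])
  moreover have "continuous_on A (\<lambda>t. eta' (1/2 + t) - eta' (1/2 - t))"
    by (intro continuous_intros continuous_on_compose2[OF continuous_eta'[of UNIV]]) auto
  ultimately show ?thesis
    unfolding C2_on_def using DERIV_H
    by (intro exI[of _ "\<lambda>t. eta (1/2 + t) + eta (1/2 - t)"] exI[of _ "\<lambda>t. eta' (1/2 + t) - eta' (1/2 - t)"]) auto
qed

lemma C2_on_H_reflect: "C2_on A (\<lambda>t. H (1 - t) + 2 * t - 1)"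
proof -
  have "((\<lambda>t. H (1 - t) + 2 * t - 1) has_real_derivative 2 - (eta (3/2 - t) + eta (t - 1/2))) (at t)" for t
    by (auto intro!: derivative_eq_intros DERIV_chain2[OF DERIV_H])
  moreover have "((\<lambda>t. 2 - (eta (3/2 - t) + eta (t - 1/2))) has_real_derivative eta' (3/2 - t) - eta' (t - 1/2)) (at t)" for t
    by (auto intro!: derivative_eq_intros DERIV_chain2[OF eta_deriv])
  moreover have "continuous_on A (\<lambda>t. eta' (3/2 - t) - eta' (t - 1/2))"
    by (intro continuous_intros continuous_on_compose2[OF continuous_eta'[of UNIV]]) auto
  ultimately show ?thesis
    unfolding C2_on_def
    by (intro exI[of _ "\<lambda>t. 2 - (eta (3/2 - t) + eta (t - 1/2))"] exI[of _ "\<lambda>t. eta' (3/2 - t) - eta' (t - 1/2)"]) auto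
qed

text \<open>The formula on \<open>[0, 1/2]\<close> remains valid slightly beyond \<open>1/2\<close>; this overlap gives smoothness there.\<close>

lemma hlim_eq_H:
  assumes "0 \<le> t" "t \<le> 3/5" shows "hlim t = H t"
proof (cases "t \<le> 1/2")
  case False
  then have "hlim t = H (1 - t) + 2 * t - 1" using assms by (intro hlim_simps) auto
  \<comment> \<open>Here \<open>1/2 + t\<close> and \<open>3/2 - t\<close> both exceed
    \<open>5/9\<close>, where \<open>Theta\<close> has slope \<open>1\<close>, which gives
    \<open>2 t - 1\<close>. Moreover \<open>t - 1/2\<close> is at most \<open>1/10 < 1/9\<close>,
    where \<open>Theta\<close> is the even function \<open>3/2 s^2\<close>.\<close>
  also have "\<dots> = H t"
    using False assms by (simp add: H_def Theta_def max_def power2_eq_square power3_eq_cube) (simp add: field_simps)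
  finally show ?thesis .
qed (use assms in \<open>simp add: hlim_simps\<close>)

lemma C2_on_hlim: "C2_on {0<..<1} hlim"
proof -
  have "C2_on {0<..<3/5} hlim"
    by (rule C2_on_cong_open[OF C2_on_H]) (auto simp: hlim_eq_H)
  moreover have "C2_on {1/2<..<1} hlim"
    by (rule C2_on_cong_open[OF C2_on_H_reflect]) (auto simp: hlim_simps)
  ultimately have "C2_on ({0<..<3/5} \<union> {1/2<..<1}) hlim" by (intro C2_on_Un) auto
  moreover have "{0<..<3/5} \<union> {1/2<..<1} = {0<..<1::real}" by auto
  ultimately show ?thesis by simp
qed

lemma hlim_cases:
  "t \<in> {0..1/18} \<Longrightarrow> hlim t = - (9/4) * t^3 + (95/48) * t"
  "t \<in> {1/18..7/18} \<Longrightarrow> hlim t = - (9/8) * t^3 - (3/16) * t^2 + (191/96) * t - 1/5184"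
  "t \<in> {7/18..1/2} \<Longrightarrow> hlim t = - (3/2) * t^2 + (5/2) * t - 43/648"
proof -
  have "hlim t = 3/2 * (1/2 + t)\<^sup>2 - 3/2 * (1/2 - t)\<^sup>2 - 9/8 * (7/18 + t) ^ 3
      + 9/8 * max 0 (t - 1/18) ^ 3 + 9/8 * max 0 (7/18 - t) ^ 3" if t: "0 \<le> t" "t \<le> 1/2"
  proof -
    \<comment> \<open>On this range two of the four truncations are resolved once and for all; the
      other two switch at \<open>t = 1/18\<close> and \<open>t = 7/18\<close> and separate the three
      formulas.\<close>
    have m: "max 0 (1/2 + t - 1/9) = 7/18 + t" "max 0 (1/2 - t - 5/9) = 0"
      "1/2 + t - 5/9 = t - 1/18" "1/2 - t - 1/9 = 7/18 - t" using t by auto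
    show ?thesis unfolding hlim_simps(2)[OF t] H_def Theta_def m by simp
  qed
  note eq = this
  show "hlim t = - (9/4) * t^3 + (95/48) * t" if "t \<in> {0..1/18}"
  proof -
    have "max 0 (t - 1/18) = 0" "max 0 (7/18 - t) = 7/18 - t" using that by auto
    then show ?thesis using that eq by (simp add: power2_eq_square power3_eq_cube) (simp add: field_simps)
  qed
  show "hlim t = - (9/8) * t^3 - (3/16) * t^2 + (191/96) * t - 1/5184" if "t \<in> {1/18..7/18}"
  proof -
    have "max 0 (t - 1/18) = t - 1/18" "max 0 (7/18 - t) = 7/18 - t" using that by auto
    then show ?thesis using that eq by (simp add: power2_eq_square power3_eq_cube) (simp add: field_simps)
  qed
  show "hlim t = - (3/2) * t^2 + (5/2) * t - 43/648" if "t \<in> {7/18..1/2}"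
  proof -
    have "max 0 (t - 1/18) = t - 1/18" "max 0 (7/18 - t) = 0" using that by auto
    then show ?thesis using that eq by (simp add: power2_eq_square power3_eq_cube) (simp add: field_simps)
  qed
qed

theorem theorem4p6:
  fixes S :: "(nat ^ 3 \<Rightarrow> int) ring"
    and x y z f :: "nat ^ 3 \<Rightarrow> int"
    and h :: "real \<Rightarrow> real"
  assumes "S = mpower_series \<Z>"
    and "x = mvar \<Z> 1" and "y = mvar \<Z> 2" and "z = mvar \<Z> 3"
    and "f = x [^]\<^bsub>S\<^esub> (2::nat) \<oplus>\<^bsub>S\<^esub> y [^]\<^bsub>S\<^esub> (3::nat) \<oplus>\<^bsub>S\<^esub> y \<otimes>\<^bsub>S\<^esub> z [^]\<^bsub>S\<^esub> (3::nat)"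
    and "h = limit_h f"
  shows "(\<forall>p t. prime p \<longrightarrow> convergent (h_seq p (residue_ring (int p)) (reduce_mod p f) t))
    \<and> (\<forall>t. ((\<lambda>p. h_mod f p t) \<longlongrightarrow> h t) primes_at_top)
    \<and> (\<forall>t\<in>{0..1/18}. h t = - (9/4) * t^3 + (95/48) * t)
    \<and> (\<forall>t\<in>{1/18..7/18}. h t = - (9/8) * t^3 - (3/16) * t^2 + (191/96) * t - 1/5184)
    \<and> (\<forall>t\<in>{7/18..1/2}. h t = - (3/2) * t^2 + (5/2) * t - 43/648)
    \<and> (\<forall>t\<in>{1/2..1}. h t = h (1 - t) + 2 * t - 1)
    \<and> continuous_on UNIV h
    \<and> C2_on {0<..<1} h"
proof -
  have f: "f = e7" using e7_eq assms(1-5) by simp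
  show ?thesis
    unfolding assms(6) f limit_h_e7
    by (intro conjI allI ballI impI h_seq_convergent h_mod_e7_tendsto hlim_cases continuous_hlim C2_on_hlim)
       (auto simp: hlim_simps)
qed

end
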